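(* Let $k\ge0$, let $U$ be a domain in $\mathbb{R}^n$, and let $C(U)\subset\mathbb{S}^n$ be its image under the Cayley transformation. (i) Let $g:C(U)\times\mathbb{R}^n\to Cl_{n+1}$ be $C^1$ and, for each $x_s\in C(U)$, a left monogenic polynomial homogeneous of degree $k$ in $u$. Then $R^S_{k,u}g(x_s,u)=0$ (on $C(U)$) if and only if $$R_{k,w}\,J(C,x)\,g\Big(C(x),\frac{(x+e_{n+1})w(x+e_{n+1})}{\|x+e_{n+1}\|^2}\Big)=0\quad(\text{on }U),\qquad J(C,x)=\frac{x+e_{n+1}}{\|x+e_{n+1}\|^n}.$$ (ii) Let $f:U\times\mathbb{R}^n\to Cl_{n+1}$ be $C^1$ and, for each $x\in U$, a left monogenic polynomial homogeneous of degree $k$ in $u$. Then $R_{k,u}f(x,u)=0$ (on $U$) if and only if $$R^S_{k,w}\,J(C^{-1},x_s)\,f\Big(C^{-1}(x_s),\frac{(x_s-e_{n+1})w(x_s-e_{n+1})}{\|x_s-e_{n+1}\|^2}\Big)=0\quad(\text{on }C(U)),\qquad J(C^{-1},x_s)=\frac{x_s-e_{n+1}}{\|x_s-e_{n+1}\|^n}.$$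
   Context: $Cl_{n+1}$ is the real Clifford algebra generated by $\mathbb{R}^{n+1}$ with orthonormal basis $e_1,\dots,e_{n+1}$ and relations $e_ie_j+e_je_i=-2\delta_{ij}$; $\mathbb{R}^n=\mathrm{span}(e_1,\dots,e_n)\subset\mathbb{R}^{n+1}\subset Cl_{n+1}$, and products of vectors are Clifford products. $\mathbb{S}^n$ is the unit sphere of $\mathbb{R}^{n+1}$. The Cayley transformation is $C:\mathbb{R}^n\to\mathbb{S}^n\setminus\{e_{n+1}\}$, $C(x)=(e_{n+1}x+1)(x+e_{n+1})^{-1}$, with inverse $C^{-1}(x_s)=(-e_{n+1}x_s+1)(x_s-e_{n+1})^{-1}$. Dirac operators: on $\mathbb{R}^n$, $D_x=\sum_{j=1}^ne_j\partial_{x_j}$. On $\mathbb{S}^n$, $D_s=D_{s,x_s}=x_s(\Lambda+\frac n2)$ with $\Lambda=\sum_{1\le i<j\le n+1}e_ie_j\big(x_{s,i}\frac{\partial}{\partial x_{s,j}}-x_{s,j}\frac{\partial}{\partial x_{s,i}}\big)$ (vector fields tangent to $\mathbb{S}^n$). Projections: for an $n$-dimensional linear subspace $H\subset\mathbb{R}^{n+1}$ with orthonormal basis $\varepsilon_j$, let $D_H=\sum_j\varepsilon_j\partial_{\varepsilon_j}$; $\mathcal{H}_k(H)$ is the space of $Cl_{n+1}$-valued harmonic polynomials on $H$ homogeneous of degree $k$, $\mathcal{M}_k(H)$ the $Cl_{n+1}$-valued polynomials $p$ on $H$ homogeneous of degree $k$ with $D_Hp=0$ (left monogenic), $\mathcal{M}_{-1}(H)=0$;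 $P_k$ is the projection of $\mathcal{H}_k(H)=\mathcal{M}_k(H)\oplus w\mathcal{M}_{k-1}(H)$ onto $\mathcal{M}_k(H)$. It is written $P_{k,u}$ for $H=\mathbb{R}^n$ with variable $u$. "Left monogenic in $u$" means in $\mathcal{M}_k(\mathbb{R}^n)$. Operators: $R_{k,u}f(x,u)=P_{k,u}D_xf(x,u)$ is the Rarita-Schwinger operator in Euclidean space; $R^S_{k,u}g(x_s,u)=P_{k,u}D_{s,x_s}g(x_s,u)$ is the spherical Rarita-Schwinger type operator. Operators in the variable $w$: - For $x\in U$ put $a=\frac{x+e_{n+1}}{\|x+e_{n+1}\|}$. Then $R_{k,w}J(C,x)g(C(x),awa)$ means: apply $D_x$ to $J(C,x)g(C(x),u)$ with $u\in\mathbb{R}^n$ held fixed, substitute $u=awa$ with $w\in a\mathbb{R}^na$, and apply the projection $P_{k,w}=P_k$ for $H=a\mathbb{R}^na$. - For $x_s\in C(U)$ put $a=\frac{x_s-e_{n+1}}{\|x_s-e_{n+1}\|}$. Then $R^S_{k,w}J(C^{-1},x_s)f(C^{-1}(x_s),awa)$ means: apply $D_{s,x_s}$ to $J(C^{-1},x_s)f(C^{-1}(x_s),u)$ with $u\in\mathbb{R}^n$ held fixed, substitute $u=awa$ with $w\in a\mathbb{R}^na$, and apply $P_{k,w}=P_k$ for $H=a\mathbb{R}^na$. *)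

theory Defs
  imports "HOL-Analysis.Analysis"
begin

section \<open>The real Clifford algebra\<close>

text \<open>
  The index type \<open>'m\<close> plays the role of the set of indices $1, \dots, n+1$, so that
  $n + 1 = $ \<open>CARD('m)\<close>. An element of the algebra is the family of its coordinates with
  respect to the basis $e_A = e_{i_1} \cdots e_{i_r}$, where $A = \{i_1 < \dots < i_r\}$
  ranges over the sets of indices.
\<close>

typedef (overloaded) 'm cl = "UNIV :: (real ^ ('m::finite) set) set"
  morphisms coords of_coords ..

lemma coords_of_coords [simp]: "coords (of_coords v) = v"
  by (simp add: of_coords_inverse)

lemma of_coords_coords [simp]: "of_coords (coords x) = x"
  by (rule coords_inverse)

lemma cl_eq_iff: "x = y \<longleftrightarrow> coords x = coords y"
  by (simp add: coords_inject)

text \<open>The Euclidean structure is the one for which the $e_A$ are orthonormal.\<close>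

instantiation cl :: (finite) real_vector
begin
definition "0 = of_coords 0"
definition "x + y = of_coords (coords x + coords y)"
definition "x - y = of_coords (coords x - coords y)"
definition "- x = of_coords (- coords x)"
definition "r *\<^sub>R x = of_coords (r *\<^sub>R coords x)"
instance
  by standard
    (simp_all add: zero_cl_def plus_cl_def minus_cl_def uminus_cl_def scaleR_cl_def cl_eq_iff
      algebra_simps)
end

lemma coords_simps [simp]:
  "coords 0 = 0" "coords (x + y) = coords x + coords y" "coords (x - y) = coords x - coords y"
  "coords (- x) = - coords x" "coords (r *\<^sub>R x) = r *\<^sub>R coords x"
  by (simp_all add: zero_cl_def plus_cl_def minus_cl_def uminus_cl_def scaleR_cl_def)

instantiation cl :: (finite) real_inner
begin
definition "x \<bullet> y = coords x \<bullet> coords y" for x y :: "'a cl"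
definition "norm x = norm (coords x)" for x :: "'a cl"
definition "dist x y = dist (coords x) (coords y)" for x y :: "'a cl"
definition "sgn x = x /\<^sub>R norm x" for x :: "'a cl"
definition [code del]:
  "(uniformity :: ('a cl \<times> 'a cl) filter) = (INF e\<in>{0<..}. principal {(x, y). dist x y < e})"
definition [code del]:
  "open U \<longleftrightarrow> (\<forall>x\<in>U. \<forall>\<^sub>F (x', y) in uniformity. x' = x \<longrightarrow> y \<in> U)" for U :: "'a cl set"
instance
proof
  show "x \<bullet> y = y \<bullet> x" for x y :: "'a cl"
    unfolding inner_cl_def by (rule inner_commute)
qed (simp_all add: inner_cl_def norm_cl_def dist_cl_def sgn_cl_def uniformity_cl_def open_cl_def
      dist_norm norm_eq_sqrt_inner inner_add_left cl_eq_iff)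
end

instantiation cl :: (finite) euclidean_space
begin
definition "Basis = of_coords ` Basis"
instance
proof
  show "(Basis :: 'a cl set) \<noteq> {}" "finite (Basis :: 'a cl set)"
    by (simp_all add: Basis_cl_def)
  show "u \<bullet> v = (if u = v then 1 else 0)" if "u \<in> Basis" "v \<in> Basis" for u v :: "'a cl"
    using that by (auto simp: Basis_cl_def inner_cl_def cl_eq_iff inner_Basis)
  show "(\<forall>u\<in>Basis. x \<bullet> u = 0) \<longleftrightarrow> x = 0" for x :: "'a cl"
    by (simp add: Basis_cl_def inner_cl_def cl_eq_iff euclidean_all_zero_iff)
qed
end

text \<open>
  $e_A e_B = \pm e_{A \triangle B}$: in sorting the product one picks up a factor $-1$ for every
  transposition of some $e_i$, $i \in A$, with some $e_j$, $j \in B$, $j < i$, and a factor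
  $e_i^2 = -1$ for every $i \in A \cap B$.
\<close>

definition cl_sign :: "('m::{finite,linorder}) set \<Rightarrow> 'm set \<Rightarrow> real" where
  "cl_sign A B = (\<Prod>i\<in>A. \<Prod>j\<in>B. if j \<le> i then -1 else 1)"

lemma prod_sym_diff:
  fixes f :: "'a::finite \<Rightarrow> real"
  assumes "\<And>i. f i * f i = 1"
  shows "prod f (sym_diff A B) = prod f A * prod f B"
proof -
  have A: "prod f A = prod f (A - B) * prod f (A \<inter> B)"
    by (subst prod.union_disjoint [symmetric]) (auto intro!: arg_cong [where f = "prod f"])
  have B: "prod f B = prod f (B - A) * prod f (A \<inter> B)"
    by (subst prod.union_disjoint [symmetric]) (auto intro!: arg_cong [where f = "prod f"])
  have AB: "prod f (A \<inter> B) * prod f (A \<inter> B) = 1"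
    by (simp add: prod.distrib [symmetric] assms)
  have "prod f (sym_diff A B) = prod f (A - B) * prod f (B - A)"
    by (rule prod.union_disjoint) auto
  also have "\<dots> = prod f (A - B) * prod f (B - A) * (prod f (A \<inter> B) * prod f (A \<inter> B))"
    by (simp add: AB)
  finally show ?thesis
    by (simp add: A B mult_ac)
qed

lemma cl_sign_sym_diff_left: "cl_sign (sym_diff A B) C = cl_sign A C * cl_sign B C"
  unfolding cl_sign_def
  by (rule prod_sym_diff)
    (auto simp: prod.distrib [symmetric] intro!: prod.neutral)

lemma cl_sign_sym_diff_right: "cl_sign A (sym_diff B C) = cl_sign A B * cl_sign A C"
  unfolding cl_sign_def prod.distrib [symmetric]
  by (rule prod.cong [OF refl], rule prod_sym_diff) simp

instantiation cl :: ("{finite,linorder}") real_algebra_1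
begin
definition "1 = of_coords (axis {} 1)"
definition "x * y = of_coords (\<chi> C. \<Sum>(A, B) | sym_diff A B = C.
  cl_sign A B * coords x $ A * coords y $ B)" for x y :: "'a cl"

lemma coords_times:
  "coords (x * y) $ C = (\<Sum>A\<in>UNIV. cl_sign A (sym_diff A C) * coords x $ A * coords y $ (sym_diff A C))"
  for x y :: "'a cl"
proof -
  have "coords (x * y) $ C
      = (\<Sum>(A, B) | sym_diff A B = C. cl_sign A B * coords x $ A * coords y $ B)"
    by (simp add: times_cl_def)
  also have "\<dots> = (\<Sum>A\<in>UNIV. cl_sign A (sym_diff A C) * coords x $ A * coords y $ (sym_diff A C))"
  proof (rule sum.reindex_bij_witness [where i = "\<lambda>A. (A, sym_diff A C)" and j = fst])
    fix p assume "p \<in> {(A, B). sym_diff A B = C}"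
    moreover from this have "sym_diff (fst p) C = snd p" by auto
    ultimately show "(fst p, sym_diff (fst p) C) = p"
      "cl_sign (fst p) (sym_diff (fst p) C) * coords x $ fst p * coords y $ sym_diff (fst p) C =
        (case p of (A, B) \<Rightarrow> cl_sign A B * coords x $ A * coords y $ B)"
      by (simp_all add: case_prod_beta)
  qed auto
  finally show ?thesis .
qed

instance
proof
  fix x y z :: "'a cl" and r :: real
  show "(x + y) * z = x * z + y * z" "x * (y + z) = x * y + x * z"
    "r *\<^sub>R x * y = r *\<^sub>R (x * y)" "x * r *\<^sub>R y = r *\<^sub>R (x * y)"
    by (simp_all add: cl_eq_iff vec_eq_iff coords_times algebra_simps sum.distrib sum_distrib_left)
  show "1 * x = x"
  proof -
    have "coords (1 * x) $ C = coords x $ C" for C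
    proof -
      have "coords (1 * x) $ C = (\<Sum>A\<in>(UNIV :: 'a set set). if A = {} then coords x $ C else 0)"
        unfolding coords_times
        by (intro sum.cong refl) (simp add: one_cl_def axis_def cl_sign_def)
      then show ?thesis by simp
    qed
    then show ?thesis by (simp add: cl_eq_iff vec_eq_iff)
  qed
  show "x * 1 = x"
  proof -
    have "coords (x * 1) $ C = coords x $ C" for C
    proof -
      have "coords (x * 1) $ C = (\<Sum>A\<in>UNIV. if A = C then coords x $ C else 0)"
        unfolding coords_times
      proof (intro sum.cong refl)
        fix A :: "'a set"
        have "sym_diff A C = {} \<longleftrightarrow> A = C" by auto
        then show "cl_sign A (sym_diff A C) * coords x $ A * coords 1 $ sym_diff A C
            = (if A = C then coords x $ C else 0)"
          by (simp add: one_cl_def axis_def cl_sign_def)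
      qed
      then show ?thesis by simp
    qed
    then show ?thesis by (simp add: cl_eq_iff vec_eq_iff)
  qed
  show "(0::'a cl) \<noteq> 1"
    by (auto simp: cl_eq_iff one_cl_def vec_eq_iff axis_def)
  show "x * y * z = x * (y * z)"
  proof -
    have "coords (x * y * z) $ D = coords (x * (y * z)) $ D" for D
    proof -
      have sd: "sym_diff (sym_diff A C) (sym_diff A D) = sym_diff C D" for A C :: "'a set"
        by blast
      have "coords (x * y * z) $ D
        = (\<Sum>C\<in>UNIV. \<Sum>A\<in>UNIV. cl_sign C (sym_diff C D) * (cl_sign A (sym_diff A C)
            * coords x $ A * coords y $ (sym_diff A C)) * coords z $ (sym_diff C D))"
        by (simp only: coords_times sum_distrib_left sum_distrib_right)
      also have "\<dots> = (\<Sum>A\<in>UNIV. \<Sum>C\<in>UNIV. cl_sign C (sym_diff C D) * (cl_sign A (sym_diff A C)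
            * coords x $ A * coords y $ (sym_diff A C)) * coords z $ (sym_diff C D))"
        by (rule sum.swap)
      also have "\<dots> = (\<Sum>A\<in>UNIV. \<Sum>B\<in>UNIV. cl_sign A (sym_diff A D) * coords x $ A *
           (cl_sign B (sym_diff B (sym_diff A D)) * coords y $ B
            * coords z $ (sym_diff B (sym_diff A D))))"
      proof (rule sum.cong [OF refl])
        fix A :: "'a set"
        show "(\<Sum>C\<in>UNIV. cl_sign C (sym_diff C D) * (cl_sign A (sym_diff A C)
            * coords x $ A * coords y $ (sym_diff A C)) * coords z $ (sym_diff C D))
          = (\<Sum>B\<in>UNIV. cl_sign A (sym_diff A D) * coords x $ A *
           (cl_sign B (sym_diff B (sym_diff A D)) * coords y $ B
            * coords z $ (sym_diff B (sym_diff A D))))"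
        proof (rule sum.reindex_bij_witness [where i = "\<lambda>B. sym_diff A B" and j = "\<lambda>C. sym_diff A C"])
          fix C :: "'a set"
          have sq: "cl_sign A C * cl_sign A C = 1" for A C :: "'a set"
            by (auto simp: cl_sign_def prod.distrib [symmetric] intro!: prod.neutral)
          have sq': "cl_sign A D * (cl_sign A D * r) = r" for r
            by (simp add: sq mult.assoc [symmetric])
          show "cl_sign A (sym_diff A D) * coords x $ A *
              (cl_sign (sym_diff A C) (sym_diff (sym_diff A C) (sym_diff A D)) * coords y $ (sym_diff A C)
                * coords z $ (sym_diff (sym_diff A C) (sym_diff A D)))
            = cl_sign C (sym_diff C D) * (cl_sign A (sym_diff A C)
                * coords x $ A * coords y $ (sym_diff A C)) * coords z $ (sym_diff C D)"
            unfolding sd cl_sign_sym_diff_left cl_sign_sym_diff_right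
            by (simp add: mult_ac sq')
        qed auto
      qed
      also have "\<dots> = coords (x * (y * z)) $ D"
        by (simp only: coords_times sum_distrib_left)
      finally show ?thesis .
    qed
    then show ?thesis by (simp add: cl_eq_iff vec_eq_iff)
  qed
qed
end

definition cl_e :: "'m \<Rightarrow> 'm::{finite,linorder} cl" where
  "cl_e i = of_coords (axis {i} 1)"

definition cl_last :: "'m::{finite,linorder} cl" where
  "cl_last = cl_e (Max UNIV)"

lemma cl_e_times_cl_e:
  "cl_e i * cl_e j = (if j \<le> i then -1 else 1) *\<^sub>R of_coords (axis (sym_diff {i} {j}) 1)"
proof -
  have "coords (cl_e i * cl_e j) $ C
    = (if j \<le> i then -1 else 1) * (axis (sym_diff {i} {j}) 1 $ C)" for C
  proof -
    have "coords (cl_e i * cl_e j) $ C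
      = (\<Sum>A\<in>UNIV. if A = {i} then (if j \<le> i then -1 else 1) * (axis (sym_diff {i} {j}) 1 $ C) else 0)"
      unfolding coords_times
    proof (rule sum.cong [OF refl])
      fix A :: "'a set"
      define D where "D = sym_diff {i} C"
      have "D = {j} \<longleftrightarrow> sym_diff {i} {j} = C" unfolding D_def by auto
      then have "axis (sym_diff {i} {j}) 1 $ C = (if D = {j} then 1 else 0 :: real)"
        by (simp only: axis_def vec_lambda_beta eq_commute [of C])
      then show "cl_sign A (sym_diff A C) * coords (cl_e i) $ A * coords (cl_e j) $ sym_diff A C =
         (if A = {i} then (if j \<le> i then -1 else 1) * (axis (sym_diff {i} {j}) 1 $ C) else 0)"
        by (cases "A = {i}"; cases "D = {j}")
          (simp_all only: D_def [symmetric], simp_all add: cl_e_def axis_def cl_sign_def)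
    qed
    then show ?thesis by simp
  qed
  then show ?thesis
    by (simp add: cl_eq_iff vec_eq_iff)
qed

lemma clifford_relations: "cl_e i * cl_e j + cl_e j * cl_e i = (if i = j then -2 else 0)"
proof (cases "i = j")
  case True
  have "cl_e i * cl_e i = - 1"
    by (simp add: cl_e_times_cl_e one_cl_def)
  with True show ?thesis by simp
next
  case False
  define v :: "'a cl" where "v = of_coords (axis (sym_diff {i} {j}) 1)"
  have ij: "cl_e i * cl_e j = (if j \<le> i then -1 else 1) *\<^sub>R v"
    unfolding v_def by (rule cl_e_times_cl_e)
  have "sym_diff {j} {i} = sym_diff {i} {j}" by (rule Un_commute)
  then have ji: "cl_e j * cl_e i = (if i \<le> j then -1 else 1) *\<^sub>R v"
    unfolding v_def cl_e_times_cl_e by (simp only:)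
  have "i < j \<or> j < i" using False by auto
  then show ?thesis
    unfolding ij ji by (auto simp: False not_le)
qed


section \<open>Euclidean space and the Cayley transformation inside the algebra\<close>

text \<open>
  Vectors are elements of the algebra: $\mathbb{R}^{n+1}$ is the span of all \<open>cl_e i\<close>, and
  $\mathbb{R}^n$ that of all but the last.
\<close>

definition Rn :: "('m::{finite,linorder}) cl set" where
  "Rn = span (cl_e ` {..<Max UNIV})"

definition cl_inv :: "('m::{finite,linorder}) cl \<Rightarrow> 'm cl" where
  "cl_inv x = (THE y. x * y = 1 \<and> y * x = 1)"

definition cayley :: "('m::{finite,linorder}) cl \<Rightarrow> 'm cl" where
  "cayley x = (cl_last * x + 1) * cl_inv (x + cl_last)"

definition cayley_inv :: "('m::{finite,linorder}) cl \<Rightarrow> 'm cl" where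
  "cayley_inv y = (- cl_last * y + 1) * cl_inv (y - cl_last)"

definition J_cayley :: "('m::{finite,linorder}) cl \<Rightarrow> 'm cl" where
  "J_cayley x = (x + cl_last) /\<^sub>R norm (x + cl_last) ^ (CARD('m) - 1)"

definition J_cayley_inv :: "('m::{finite,linorder}) cl \<Rightarrow> 'm cl" where
  "J_cayley_inv y = (y - cl_last) /\<^sub>R norm (y - cl_last) ^ (CARD('m) - 1)"

section \<open>Dirac operators\<close>

text \<open>For \<open>f\<close> given on a set, \<open>x\<close> relatively interior to it and \<open>v\<close> a direction along it,
  only the values of \<open>f\<close> on the set matter.\<close>

definition dir_deriv :: "('a::real_normed_vector \<Rightarrow> 'b::real_normed_vector) \<Rightarrow> 'a \<Rightarrow> 'a \<Rightarrow> 'b" where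
  "dir_deriv f x v = vector_derivative (\<lambda>t. f (x + t *\<^sub>R v)) (at 0)"

definition dirac :: "('m::{finite,linorder}) cl set \<Rightarrow> ('m cl \<Rightarrow> 'm cl) \<Rightarrow> 'm cl \<Rightarrow> 'm cl" where
  "dirac B f x = (\<Sum>\<epsilon>\<in>B. \<epsilon> * dir_deriv f x \<epsilon>)"

definition dirac_Rn :: "(('m::{finite,linorder}) cl \<Rightarrow> 'm cl) \<Rightarrow> 'm cl \<Rightarrow> 'm cl" where
  "dirac_Rn = dirac (cl_e ` {..<Max UNIV})"

text \<open>
  The vector fields $x_i \partial_j - x_j \partial_i$ are tangent to the sphere, so they act on
  functions on the sphere; they are evaluated by applying the partial derivatives to the extension
  $y \mapsto f(y / \|y\|)$, the result being the same for any other differentiable extension.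
\<close>

definition Lambda :: "(('m::{finite,linorder}) cl \<Rightarrow> 'm cl) \<Rightarrow> 'm cl \<Rightarrow> 'm cl" where
  "Lambda f x = (\<Sum>(i, j) | i < j. cl_e i * cl_e j *
     ((x \<bullet> cl_e i) *\<^sub>R dir_deriv (\<lambda>y. f (sgn y)) x (cl_e j)
      - (x \<bullet> cl_e j) *\<^sub>R dir_deriv (\<lambda>y. f (sgn y)) x (cl_e i)))"

definition dirac_Sn :: "(('m::{finite,linorder}) cl \<Rightarrow> 'm cl) \<Rightarrow> 'm cl \<Rightarrow> 'm cl" where
  "dirac_Sn f x = x * (Lambda f x + (real (CARD('m) - 1) / 2) *\<^sub>R f x)"

section \<open>Harmonic and monogenic polynomials on a subspace\<close>

text \<open>
  A function on a subspace \<open>H\<close> is represented by a function on the whole algebra whose values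
  outside \<open>H\<close> are irrelevant.
\<close>

definition onb :: "'a::euclidean_space set \<Rightarrow> 'a set" where
  "onb H = (SOME B. B \<subseteq> H \<and> pairwise orthogonal B \<and> (\<forall>b\<in>B. norm b = 1) \<and> span B = H)"

definition hom_polys :: "('m::{finite,linorder}) cl set \<Rightarrow> nat \<Rightarrow> ('m cl \<Rightarrow> 'm cl) set" where
  "hom_polys H k = {p. (\<exists>q. polynomial_function q \<and> (\<forall>w\<in>H. p w = q w)) \<and>
     (\<forall>w\<in>H. \<forall>t. p (t *\<^sub>R w) = t ^ k *\<^sub>R p w)}"

definition harmonics :: "('m::{finite,linorder}) cl set \<Rightarrow> nat \<Rightarrow> ('m cl \<Rightarrow> 'm cl) set" where
  "harmonics H k = {p \<in> hom_polys H k.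
     \<forall>w\<in>H. (\<Sum>\<epsilon>\<in>onb H. dir_deriv (\<lambda>v. dir_deriv p v \<epsilon>) w \<epsilon>) = 0}"

definition monogenics :: "('m::{finite,linorder}) cl set \<Rightarrow> nat \<Rightarrow> ('m cl \<Rightarrow> 'm cl) set" where
  "monogenics H k = {p \<in> hom_polys H k. \<forall>w\<in>H. dirac (onb H) p w = 0}"

text \<open>
  The projection of $\mathcal{H}_k(H) = \mathcal{M}_k(H) \oplus w \mathcal{M}_{k-1}(H)$ onto
  $\mathcal{M}_k(H)$, with $\mathcal{M}_{-1}(H) = 0$. As the sum is direct, the values on \<open>H\<close> of
  the chosen \<open>q\<close> do not depend on the choice.
\<close>

definition monogenic_proj ::
  "('m::{finite,linorder}) cl set \<Rightarrow> nat \<Rightarrow> ('m cl \<Rightarrow> 'm cl) \<Rightarrow> 'm cl \<Rightarrow> 'm cl" where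
  "monogenic_proj H k p =
     (if p \<in> harmonics H k
      then SOME q. q \<in> monogenics H k \<and>
        (\<exists>r \<in> (if k = 0 then {\<lambda>_. 0} else monogenics H (k - 1)). \<forall>w\<in>H. p w = q w + w * r w)
      else undefined)"

section \<open>Rarita-Schwinger type operators\<close>

definition rarita_Rn ::
  "nat \<Rightarrow> (('m::{finite,linorder}) cl \<Rightarrow> 'm cl \<Rightarrow> 'm cl) \<Rightarrow> 'm cl \<Rightarrow> 'm cl \<Rightarrow> 'm cl" where
  "rarita_Rn k f x = monogenic_proj Rn k (\<lambda>u. dirac_Rn (\<lambda>y. f y u) x)"

definition rarita_Sn ::
  "nat \<Rightarrow> (('m::{finite,linorder}) cl \<Rightarrow> 'm cl \<Rightarrow> 'm cl) \<Rightarrow> 'm cl \<Rightarrow> 'm cl \<Rightarrow> 'm cl" where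
  "rarita_Sn k g x = monogenic_proj Rn k (\<lambda>u. dirac_Sn (\<lambda>y. g y u) x)"

text \<open>
  The operators in the variable $w = aua \in a \mathbb{R}^n a$ for a unit vector $a$; as
  $a^2 = -1$, also $u = awa$. In use $a$ depends on the point \<open>x\<close>, but it is the fixed value at
  \<open>x\<close> that is substituted after differentiating with \<open>u\<close> held fixed.
\<close>

definition conj_Rn :: "('m::{finite,linorder}) cl \<Rightarrow> 'm cl set" where
  "conj_Rn a = (\<lambda>u. a * u * a) ` Rn"

definition rarita_Rn_conj ::
  "'m cl \<Rightarrow> nat \<Rightarrow> (('m::{finite,linorder}) cl \<Rightarrow> 'm cl \<Rightarrow> 'm cl) \<Rightarrow> 'm cl \<Rightarrow> 'm cl \<Rightarrow> 'm cl" where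
  "rarita_Rn_conj a k F x =
     monogenic_proj (conj_Rn a) k (\<lambda>w. dirac_Rn (\<lambda>y. F y (a * w * a)) x)"

definition rarita_Sn_conj ::
  "'m cl \<Rightarrow> nat \<Rightarrow> (('m::{finite,linorder}) cl \<Rightarrow> 'm cl \<Rightarrow> 'm cl) \<Rightarrow> 'm cl \<Rightarrow> 'm cl \<Rightarrow> 'm cl" where
  "rarita_Sn_conj a k G x =
     monogenic_proj (conj_Rn a) k (\<lambda>w. dirac_Sn (\<lambda>y. G y (a * w * a)) x)"

section \<open>Continuously differentiable functions\<close>

text \<open>
  A function on an arbitrary subset of a normed space is $C^1$ if it has local $C^1$ extensions;
  for submanifolds, such as relatively open subsets of the sphere, this agrees with the
  definition by charts.
\<close>

definition C1_on :: "'a::real_normed_vector set \<Rightarrow> ('a \<Rightarrow> 'b::real_normed_vector) \<Rightarrow> bool" where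
  "C1_on S f \<longleftrightarrow> (\<forall>p\<in>S. \<exists>W h h'. open W \<and> p \<in> W \<and>
     (\<forall>q\<in>W. (h has_derivative blinfun_apply (h' q)) (at q)) \<and> continuous_on W h' \<and>
     (\<forall>q\<in>S \<inter> W. f q = h q))"

end

theory Submission
  imports Defs
begin

text \<open>
  Write $e$ for the last basis vector, $z = x + e$ and $a = z / \|z\|$. For a unit vector $a$ the
  map $v \mapsto a v a$ is the reflection in the hyperplane orthogonal to $a$
  (\<open>unit_conj_reflection\<close>), and both the Cayley transformation and the substitution $u = awa$
  are made of it: $C(x) = aea = e - 2z/\|z\|^2$, so that the differential of $C$ at $x$ is
  $v \mapsto -2\|z\|^{-2} a v a$.

  This makes the Dirac operators conformally covariant (\<open>dirac_cayley_covariance\<close>):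
  \[ D_x \big(J(C,x)\, g(C(x))\big) = -2 \|z\|^{-n-1} a\, (D_s g)(C(x)). \]
  In the product rule, the derivative of $g \circ C$ produces the sum over the reflected frame
  $a e_j a$, which is an orthonormal frame of the tangent space at $C(x)$, and the derivative of
  $J$ produces exactly the term $\frac n2$ of $D_s$. The second part of the theorem uses the same identity
  for $g(y,u) = J(C^{-1},y) f(C^{-1}(y),u)$, because $J(C,x) J(C^{-1},C(x))$ is a nonzero real
  constant.

  It remains to see that the projections respect the factor $a$ and the substitution. For $p$ harmonic and
  homogeneous of degree $k$ on $H$ the Fischer decomposition is explicit
  (\<open>monogenic_proj_eq\<close>):
  \[ P_k p\,(w) = p(w) + \frac{1}{\dim H + 2k - 2}\, w\, D_H p\,(w). \]
  Reflecting a basis gives $D_{aHa}\, (a\, p(awa)) = -a\, (D_H p)(awa)$, and $w a = -a (awa)$, so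
  the two signs cancel and $P_k$ commutes with $p \mapsto a\, p(a \cdot a)$
  (\<open>monogenic_proj_conj\<close>). As $a$ is invertible, one side vanishes exactly if the other does.

  The formula for $P_k$ needs $D_x f(x,\cdot)$ to be a harmonic polynomial again, although $f$
  is only $C^1$ in $x$. Each $\partial_{x_j} f(x,\cdot)$ is a pointwise limit of difference quotients
  that are harmonic and homogeneous of degree $k$, and this class is closed under pointwise limits
  (\<open>harmonics_pointwise_limit\<close>): on polynomials of degree at most $k$, a directional derivative is
  a fixed linear combination of $k+1$ values, so derivatives converge along with the values.
\<close>

section \<open>Vectors in the Clifford algebra\<close>

definition vecs :: "('m::{finite,linorder}) cl set" where
  "vecs = span (range cl_e)"

lemma subspace_vecs: "subspace vecs"
  by (simp add: vecs_def)

lemma cl_e_in_vecs [simp]: "cl_e i \<in> vecs"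
  by (simp add: vecs_def span_base)

lemma cl_last_in_vecs [simp]: "cl_last \<in> vecs"
  by (simp add: cl_last_def)

lemma inner_cl_e: "cl_e i \<bullet> cl_e j = (if i = j then 1 else 0)"
  by (simp add: cl_e_def inner_cl_def inner_axis_axis)

lemma norm_cl_e [simp]: "norm (cl_e i) = 1"
  by (simp add: norm_eq_sqrt_inner inner_cl_e)

lemma norm_cl_last [simp]: "norm cl_last = 1"
  by (simp add: cl_last_def)

lemma inj_cl_e: "inj cl_e"
  by (rule injI) (metis inner_cl_e zero_neq_one)

lemma bounded_bilinear_cl: "bounded_bilinear (\<lambda>x y :: ('m::{finite,linorder}) cl. x * y)"
  unfolding bilinear_conv_bounded_bilinear [symmetric] bilinear_def
  by (auto intro!: linearI simp: algebra_simps)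

text \<open>
  Both sides are bilinear in $u$ and $v$, so the relations between the generators suffice.
\<close>

lemma vecs_anticommute:
  assumes "u \<in> vecs" "v \<in> vecs"
  shows "u * v + v * u = (- 2 * (u \<bullet> v)) *\<^sub>R (1 :: ('m::{finite,linorder}) cl)"
proof -
  have two: "(2 :: 'm cl) = 2 *\<^sub>R 1"
    by (simp add: scaleR_2)
  have gen: "cl_e i * v + v * cl_e i = (- 2 * (cl_e i \<bullet> v)) *\<^sub>R (1 :: 'm cl)" for i
    using assms(2) unfolding vecs_def
  proof (induction rule: span_induct_alt)
    case (step c x y)
    then obtain j where x: "x = cl_e j" by auto
    have "cl_e i * (c *\<^sub>R x + y) + (c *\<^sub>R x + y) * cl_e i
      = c *\<^sub>R (cl_e i * cl_e j + cl_e j * cl_e i) + (cl_e i * y + y * cl_e i)"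
      by (simp add: x algebra_simps)
    also have "\<dots> = (- 2 * (cl_e i \<bullet> (c *\<^sub>R x + y))) *\<^sub>R (1 :: 'm cl)"
      unfolding step.IH clifford_relations
      by (simp add: x two inner_cl_e algebra_simps)
    finally show ?case .
  qed simp
  show ?thesis
    using assms(1) unfolding vecs_def
  proof (induction rule: span_induct_alt)
    case (step c x y)
    then obtain j where x: "x = cl_e j" by auto
    have "(c *\<^sub>R x + y) * v + v * (c *\<^sub>R x + y)
      = c *\<^sub>R (cl_e j * v + v * cl_e j) + (y * v + v * y)"
      by (simp add: x algebra_simps)
    also have "\<dots> = (- 2 * ((c *\<^sub>R x + y) \<bullet> v)) *\<^sub>R (1 :: 'm cl)"
      unfolding step.IH gen
      by (simp add: x algebra_simps)
    finally show ?case .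
  qed simp
qed

lemma vecs_square:
  assumes "v \<in> vecs"
  shows "v * v = - (norm v)\<^sup>2 *\<^sub>R (1 :: ('m::{finite,linorder}) cl)"
proof -
  have "2 *\<^sub>R (v * v) = 2 *\<^sub>R (- (norm v)\<^sup>2 *\<^sub>R (1 :: 'm cl))"
    using vecs_anticommute [OF assms assms] by (simp add: scaleR_2 power2_norm_eq_inner)
  then show ?thesis
    by (simp only: scaleR_cancel_left) simp
qed

lemma unit_square: "a \<in> vecs \<Longrightarrow> norm a = 1 \<Longrightarrow> a * a = - (1 :: ('m::{finite,linorder}) cl)"
  by (simp add: vecs_square)

lemma unit_cancel:
  assumes "a \<in> vecs" "norm a = 1"
  shows "a * (a * x) = - (x :: ('m::{finite,linorder}) cl)"
  by (simp add: mult.assoc [symmetric] unit_square [OF assms])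

lemma unit_conj_conj:
  assumes "a \<in> vecs" "norm a = 1"
  shows "a * (a * x * a) * a = (x :: ('m::{finite,linorder}) cl)"
  by (simp add: mult.assoc unit_cancel [OF assms] unit_square [OF assms])

text \<open>
  Moving $a$ past $v$ costs $-2 (a \cdot v)$, and $a^2 = -1$ removes the remaining factors.
\<close>

lemma unit_conj_reflection:
  assumes "a \<in> vecs" "norm a = 1" "v \<in> vecs"
  shows "a * v * a = v - (2 * (a \<bullet> v)) *\<^sub>R (a :: ('m::{finite,linorder}) cl)"
proof -
  have "a * v * a = (a * v + v * a) * a - v * (a * a)"
    by (simp add: algebra_simps)
  also have "\<dots> = v - (2 * (a \<bullet> v)) *\<^sub>R a"
    unfolding vecs_anticommute [OF assms(1,3)] unit_square [OF assms(1,2)] by simp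
  finally show ?thesis .
qed

lemma unit_conj_in_vecs:
  assumes "a \<in> vecs" "norm a = 1" "v \<in> vecs"
  shows "a * v * a \<in> vecs"
  unfolding unit_conj_reflection [OF assms]
  by (intro subspace_diff subspace_scale subspace_vecs assms)

lemma unit_conj_inner:
  assumes "a \<in> vecs" "norm a = 1" "u \<in> vecs" "v \<in> vecs"
  shows "(a * u * a) \<bullet> (a * v * a) = u \<bullet> (v :: ('m::{finite,linorder}) cl)"
proof -
  have "a \<bullet> a = 1" using assms(2) by (simp add: dot_square_norm)
  then show ?thesis
    unfolding unit_conj_reflection [OF assms(1,2,3)] unit_conj_reflection [OF assms(1,2,4)]
    by (simp add: algebra_simps inner_commute)
qed

text \<open>
  $v^2$ is a nonzero real multiple of $1$.
\<close>

lemma cl_inv_vec: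
  assumes "v \<in> vecs" "v \<noteq> 0"
  shows "cl_inv v = - (v /\<^sub>R (norm v)\<^sup>2)"
  unfolding cl_inv_def
proof (rule the_equality)
  show "v * - (v /\<^sub>R (norm v)\<^sup>2) = 1 \<and> - (v /\<^sub>R (norm v)\<^sup>2) * v = 1"
    using assms by (simp add: vecs_square)
next
  fix y assume y: "v * y = 1 \<and> y * v = 1"
  have "- ((norm v)\<^sup>2 *\<^sub>R y) = v * v * y"
    by (simp add: vecs_square assms)
  also have "\<dots> = v" by (simp add: mult.assoc y)
  finally have "v = - ((norm v)\<^sup>2 *\<^sub>R y)" ..
  then show "y = - (v /\<^sub>R (norm v)\<^sup>2)"
    using assms(2) by (metis (no_types) add.inverse_inverse left_inverse norm_eq_zero
      power_eq_0_iff scaleR_minus_right scaleR_one scaleR_scaleR)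
qed

section \<open>Orthonormal bases of subspaces\<close>

definition orthonormal_basis :: "'a::euclidean_space set \<Rightarrow> 'a set \<Rightarrow> bool" where
  "orthonormal_basis B H \<longleftrightarrow>
     B \<subseteq> H \<and> pairwise orthogonal B \<and> (\<forall>b\<in>B. norm b = 1) \<and> span B = H"

lemma orthonormal_basis_onb: "subspace H \<Longrightarrow> orthonormal_basis (onb H) H"
  unfolding onb_def orthonormal_basis_def
  by (rule someI_ex) (metis orthonormal_basis_subspace)

lemma orthonormal_basis_independent: "orthonormal_basis B H \<Longrightarrow> independent B"
  unfolding orthonormal_basis_def by (intro pairwise_orthogonal_independent) auto

lemma orthonormal_basis_finite: "orthonormal_basis B H \<Longrightarrow> finite B"
  using independent_imp_finite orthonormal_basis_independent by blast

lemma orthonormal_basis_card: "orthonormal_basis B H \<Longrightarrow> card B = dim H"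
  by (metis dim_eq_card orthonormal_basis_def orthonormal_basis_independent span_span)

lemma orthonormal_basis_subset: "orthonormal_basis B H \<Longrightarrow> b \<in> B \<Longrightarrow> b \<in> H"
  unfolding orthonormal_basis_def by auto

lemma orthonormal_basis_imp_subspace: "orthonormal_basis B H \<Longrightarrow> subspace H"
  unfolding orthonormal_basis_def by (metis subspace_span)

lemma orthonormal_basis_expansion:
  "orthonormal_basis B H \<Longrightarrow> w \<in> H \<Longrightarrow> (\<Sum>b\<in>B. (w \<bullet> b) *\<^sub>R b) = w"
  using orthonormal_basis_finite [of B H] unfolding orthonormal_basis_def
  by (intro orthonormal_basis_expand) auto

lemma orthonormal_basis_inner:
  "orthonormal_basis B H \<Longrightarrow> b \<in> B \<Longrightarrow> c \<in> B \<Longrightarrow> b \<bullet> c = (if b = c then 1 else 0)"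
  unfolding orthonormal_basis_def pairwise_def orthogonal_def by (auto simp: dot_square_norm)

lemma orthonormal_basis_image:
  fixes \<phi> :: "'a::euclidean_space \<Rightarrow> 'a"
  assumes B: "orthonormal_basis B H" and lin: "linear \<phi>"
    and iso: "\<And>u v. u \<in> H \<Longrightarrow> v \<in> H \<Longrightarrow> \<phi> u \<bullet> \<phi> v = u \<bullet> v"
  shows "orthonormal_basis (\<phi> ` B) (\<phi> ` H)"
  using assms(1) linear_span_image [OF lin, of B] unfolding orthonormal_basis_def
  by (auto simp: pairwise_def orthogonal_def norm_eq_sqrt_inner iso subset_iff)

lemma orthonormal_basis_vecs: "orthonormal_basis (range cl_e) vecs"
  unfolding orthonormal_basis_def
  by (auto simp: vecs_def span_base pairwise_def orthogonal_def inner_cl_e)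

lemma orthonormal_basis_Rn: "orthonormal_basis (cl_e ` {..<Max UNIV}) Rn"
  unfolding orthonormal_basis_def
  by (auto simp: Rn_def span_base pairwise_def orthogonal_def inner_cl_e)

lemma subspace_Rn: "subspace Rn"
  by (simp add: Rn_def)

lemma Rn_subset_vecs: "Rn \<subseteq> vecs"
  unfolding Rn_def vecs_def by (intro span_mono) auto

lemma Rn_inner_last: "x \<in> Rn \<Longrightarrow> x \<bullet> cl_last = 0"
  unfolding Rn_def
proof (induction rule: span_induct_alt)
  case (step c x y)
  then obtain j where "x = cl_e j" "j < Max UNIV" by auto
  with step.IH show ?case by (simp add: cl_last_def inner_cl_e inner_add_left)
qed simp

text \<open>
  The derivative of a function that is polynomial only on \<open>H\<close> is linear only in the directions of
  \<open>H\<close>, hence the relativised notion.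
\<close>

definition linear_on_subspace :: "'a::real_vector set \<Rightarrow> ('a \<Rightarrow> 'b::real_vector) \<Rightarrow> bool" where
  "linear_on_subspace H T \<longleftrightarrow> (\<forall>u\<in>H. \<forall>v\<in>H. T (u + v) = T u + T v) \<and> (\<forall>c. \<forall>u\<in>H. T (c *\<^sub>R u) = c *\<^sub>R T u)"

lemma linear_on_subspace_sum:
  assumes "linear_on_subspace H T" "subspace H" "finite I" "\<And>i. i \<in> I \<Longrightarrow> v i \<in> H"
  shows "T (\<Sum>i\<in>I. c i *\<^sub>R v i) = (\<Sum>i\<in>I. c i *\<^sub>R T (v i))"
  using assms(3,4)
proof (induction I)
  case empty
  then show ?case using assms(1,2)
    by (metis linear_on_subspace_def scale_zero_left subspace_0 sum.empty)
next
  case (insert i I)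
  then have "(\<Sum>i\<in>I. c i *\<^sub>R v i) \<in> H"
    using assms(2) by (auto intro!: subspace_sum subspace_scale)
  then show ?case
    using insert assms(1) subspace_scale [OF assms(2)] unfolding linear_on_subspace_def by simp
qed

text \<open>
  Expanding $b$ in the other basis and exchanging the sums reassembles each $c$ from its coordinates.
  In particular the Dirac operator of a subspace is the same for the arbitrary basis \<open>onb H\<close> as for any
  basis that suits a computation.
\<close>

lemma sum_onb_independent:
  fixes T :: "('m::{finite,linorder}) cl \<Rightarrow> 'm cl"
  assumes B: "orthonormal_basis B H" and C: "orthonormal_basis C H"
    and T: "linear_on_subspace H T"
  shows "(\<Sum>b\<in>B. b * T b) = (\<Sum>c\<in>C. c * T c)"
proof -
  note H = orthonormal_basis_imp_subspace [OF B]
  have "(\<Sum>b\<in>B. b * T b) = (\<Sum>b\<in>B. b * T (\<Sum>c\<in>C. (b \<bullet> c) *\<^sub>R c))"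
    by (intro sum.cong refl)
      (simp add: orthonormal_basis_expansion [OF C] orthonormal_basis_subset [OF B])
  also have "\<dots> = (\<Sum>b\<in>B. \<Sum>c\<in>C. ((c \<bullet> b) *\<^sub>R b) * T c)"
    by (subst linear_on_subspace_sum [OF T H orthonormal_basis_finite [OF C]])
      (simp_all add: orthonormal_basis_subset [OF C] sum_distrib_left inner_commute)
  also have "\<dots> = (\<Sum>c\<in>C. \<Sum>b\<in>B. ((c \<bullet> b) *\<^sub>R b) * T c)"
    by (rule sum.swap)
  also have "\<dots> = (\<Sum>c\<in>C. (\<Sum>b\<in>B. (c \<bullet> b) *\<^sub>R b) * T c)"
    by (simp only: sum_distrib_right)
  also have "\<dots> = (\<Sum>c\<in>C. c * T c)"
    by (intro sum.cong refl)
      (simp add: orthonormal_basis_expansion [OF B] orthonormal_basis_subset [OF C])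
  finally show ?thesis .
qed

lemma linear_conj: "linear (\<lambda>u :: ('m::{finite,linorder}) cl. a * u * a)"
  by (rule linearI) (simp_all add: algebra_simps)

lemma subspace_conj_Rn: "subspace (conj_Rn a)"
  unfolding conj_Rn_def by (rule linear_subspace_image [OF linear_conj subspace_Rn])

lemma conj_Rn_subset_vecs: "a \<in> vecs \<Longrightarrow> norm a = 1 \<Longrightarrow> conj_Rn a \<subseteq> vecs"
  unfolding conj_Rn_def using unit_conj_in_vecs Rn_subset_vecs by blast

section \<open>Polynomials and their directional derivatives\<close>

lemma dir_deriv_eqI:
  "((\<lambda>t. f (x + t *\<^sub>R v)) has_vector_derivative d) (at 0) \<Longrightarrow> dir_deriv f x v = d"
  unfolding dir_deriv_def by (rule vector_derivative_at)

lemma has_vector_derivative_along: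
  assumes "(f has_derivative f') (at x)"
  shows "((\<lambda>t. f (x + t *\<^sub>R v)) has_vector_derivative f' v) (at 0)"
proof -
  interpret bounded_linear f' using assms by (rule has_derivative_bounded_linear)
  have "((\<lambda>t. x + t *\<^sub>R v) has_derivative (\<lambda>t. t *\<^sub>R v)) (at 0)"
    by (auto intro!: derivative_eq_intros)
  then have "((\<lambda>t. f (x + t *\<^sub>R v)) has_derivative (\<lambda>t. f' (t *\<^sub>R v))) (at 0)"
    by (rule has_derivative_compose) (use assms in simp)
  then show ?thesis
    by (simp add: has_vector_derivative_def scaleR)
qed

lemma dir_deriv_has_derivative:
  "(f has_derivative f') (at x) \<Longrightarrow> dir_deriv f x v = f' v"
  by (intro dir_deriv_eqI has_vector_derivative_along)

lemma polynomial_function_cl_mult [intro]: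
  fixes p q :: "'a::real_normed_vector \<Rightarrow> ('m::{finite,linorder}) cl"
  assumes "polynomial_function p" "polynomial_function q"
  shows "polynomial_function (\<lambda>x. p x * q x)"
proof -
  have "p x * q x = (\<Sum>b\<in>Basis. \<Sum>c\<in>Basis. ((p x \<bullet> b) * (q x \<bullet> c)) *\<^sub>R (b * c))" for x
  proof -
    have "p x * q x = (\<Sum>b\<in>Basis. (p x \<bullet> b) *\<^sub>R b) * (\<Sum>c\<in>Basis. (q x \<bullet> c) *\<^sub>R c)"
      by (simp add: euclidean_representation)
    then show ?thesis
      unfolding sum_product by (simp add: mult.commute)
  qed
  moreover have "polynomial_function (\<lambda>x. ((p x \<bullet> b) * (q x \<bullet> c)) *\<^sub>R (b * c))" for b c
    by (intro polynomial_function_mult polynomial_function_const)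
      (auto simp: real_polynomial_function_eq [symmetric]
        intro!: real_polynomial_function.intros(4), auto simp: real_polynomial_function_eq assms
        intro!: polynomial_function_inner)
  ultimately show ?thesis
    by (simp add: polynomial_function_sum)
qed

text \<open>
  Existence of the first derivatives and symmetry of the mixed second derivative are proved in one
  induction, since the product rule for the mixed derivative involves all the first ones.
\<close>

lemma real_polynomial_partials:
  assumes "real_polynomial_function p"
  shows "\<exists>p1 p2 p12. real_polynomial_function p1 \<and> real_polynomial_function p2 \<and>
    (\<forall>x. ((\<lambda>t. p (x + t *\<^sub>R u)) has_real_derivative p1 x) (at 0) \<and>
      ((\<lambda>t. p (x + t *\<^sub>R v)) has_real_derivative p2 x) (at 0) \<and>
      ((\<lambda>t. p1 (x + t *\<^sub>R v)) has_real_derivative p12 x) (at 0) \<and>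
      ((\<lambda>t. p2 (x + t *\<^sub>R u)) has_real_derivative p12 x) (at 0))"
    (is "\<exists>p1 p2 p12. ?R p p1 p2 p12")
  using assms
proof (induction p rule: real_polynomial_function.induct)
  case (linear f)
  then interpret bounded_linear f .
  have "?R f (\<lambda>_. f u) (\<lambda>_. f v) (\<lambda>_. 0)"
    by (auto simp: add scaleR intro!: derivative_eq_intros)
  then show ?case by iprover
next
  case (const c)
  have "?R (\<lambda>_. c) (\<lambda>_. 0) (\<lambda>_. 0) (\<lambda>_. 0)"
    by (auto intro!: derivative_eq_intros)
  then show ?case by iprover
next
  case (add f g)
  obtain f1 f2 f12 where f: "?R f f1 f2 f12"
    using add.IH(1) by (elim exE) (rule that)
  obtain g1 g2 g12 where g: "?R g g1 g2 g12"
    using add.IH(2) by (elim exE) (rule that)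
  have "?R (\<lambda>x. f x + g x) (\<lambda>x. f1 x + g1 x) (\<lambda>x. f2 x + g2 x) (\<lambda>x. f12 x + g12 x)"
    using f g by (intro conjI allI DERIV_add real_polynomial_function.intros(3)) simp_all
  then show ?case by iprover
next
  case (mult f g)
  obtain f1 f2 f12 where f: "?R f f1 f2 f12"
    using mult.IH(1) by (elim exE) (rule that)
  obtain g1 g2 g12 where g: "?R g g1 g2 g12"
    using mult.IH(2) by (elim exE) (rule that)
  have prod: "((\<lambda>t. a (x + t *\<^sub>R z) * b (x + t *\<^sub>R z)) has_real_derivative
      a' * b x + a x * b') (at 0)"
    if "((\<lambda>t. a (x + t *\<^sub>R z)) has_real_derivative a') (at 0)"
      "((\<lambda>t. b (x + t *\<^sub>R z)) has_real_derivative b') (at 0)" for a b a' b' and x z :: 'a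
    using DERIV_mult [OF that] by (simp add: mult.commute add.commute)
  have "?R (\<lambda>x. f x * g x) (\<lambda>x. f1 x * g x + f x * g1 x) (\<lambda>x. f2 x * g x + f x * g2 x)
    (\<lambda>x. (f12 x * g x + f1 x * g2 x) + (f2 x * g1 x + f x * g12 x))"
  proof (intro conjI allI)
    fix x
    show "((\<lambda>t. f1 (x + t *\<^sub>R v) * g (x + t *\<^sub>R v) + f (x + t *\<^sub>R v) * g1 (x + t *\<^sub>R v))
      has_real_derivative (f12 x * g x + f1 x * g2 x) + (f2 x * g1 x + f x * g12 x)) (at 0)"
      using f g by (intro DERIV_add prod) simp_all
    have "((\<lambda>t. f2 (x + t *\<^sub>R u) * g (x + t *\<^sub>R u) + f (x + t *\<^sub>R u) * g2 (x + t *\<^sub>R u))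
      has_real_derivative (f12 x * g x + f2 x * g1 x) + (f1 x * g2 x + f x * g12 x)) (at 0)"
      using f g by (intro DERIV_add prod) simp_all
    then show "((\<lambda>t. f2 (x + t *\<^sub>R u) * g (x + t *\<^sub>R u) + f (x + t *\<^sub>R u) * g2 (x + t *\<^sub>R u))
      has_real_derivative (f12 x * g x + f1 x * g2 x) + (f2 x * g1 x + f x * g12 x)) (at 0)"
      by (simp add: algebra_simps)
  qed (use f g mult.hyps in \<open>auto intro: prod real_polynomial_function.intros\<close>)
  then show ?case by iprover
qed

lemma polynomial_partials:
  fixes q :: "'a::real_normed_vector \<Rightarrow> 'b::euclidean_space"
  assumes "polynomial_function q"
  shows "polynomial_function (\<lambda>x. dir_deriv q x u)"
    and "((\<lambda>t. q (x + t *\<^sub>R u)) has_vector_derivative dir_deriv q x u) (at 0)"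
    and "dir_deriv (\<lambda>y. dir_deriv q y u) x v = dir_deriv (\<lambda>y. dir_deriv q y v) x u"
proof -
  have rq: "real_polynomial_function (\<lambda>x. q x \<bullet> b)" if "b \<in> Basis" for b
    using assms that by (simp add: polynomial_function_iff_Basis_inner)
  have "\<forall>b\<in>Basis. \<exists>p1 p2 p12. real_polynomial_function p1 \<and> real_polynomial_function p2 \<and>
    (\<forall>x. ((\<lambda>t. q (x + t *\<^sub>R u) \<bullet> b) has_real_derivative p1 x) (at 0) \<and>
      ((\<lambda>t. q (x + t *\<^sub>R v) \<bullet> b) has_real_derivative p2 x) (at 0) \<and>
      ((\<lambda>t. p1 (x + t *\<^sub>R v)) has_real_derivative p12 x) (at 0) \<and>
      ((\<lambda>t. p2 (x + t *\<^sub>R u)) has_real_derivative p12 x) (at 0))"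
    using real_polynomial_partials [OF rq] by (intro ballI)
  then obtain p1 p2 p12 where p: "\<forall>b\<in>Basis.
    real_polynomial_function (p1 b) \<and> real_polynomial_function (p2 b) \<and>
    (\<forall>x. ((\<lambda>t. q (x + t *\<^sub>R u) \<bullet> b) has_real_derivative p1 b x) (at 0) \<and>
      ((\<lambda>t. q (x + t *\<^sub>R v) \<bullet> b) has_real_derivative p2 b x) (at 0) \<and>
      ((\<lambda>t. p1 b (x + t *\<^sub>R v)) has_real_derivative p12 b x) (at 0) \<and>
      ((\<lambda>t. p2 b (x + t *\<^sub>R u)) has_real_derivative p12 b x) (at 0))"
    unfolding bchoice_iff by (elim exE) (rule that)
  define P where "P f x = (\<Sum>b\<in>Basis. f b x *\<^sub>R b)" for f :: "'b \<Rightarrow> 'a \<Rightarrow> real" and x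
  have q: "q = P (\<lambda>b x. q x \<bullet> b)"
    by (simp add: P_def euclidean_representation fun_eq_iff)
  have der: "((\<lambda>t. P f (x + t *\<^sub>R v)) has_vector_derivative P f' x) (at 0)"
    if that1: "\<And>b x. b \<in> Basis \<Longrightarrow> ((\<lambda>t. f b (x + t *\<^sub>R v)) has_real_derivative f' b x) (at 0)"
    for f f' x v
  proof -
    have "((\<lambda>t. f b (x + t *\<^sub>R v) *\<^sub>R b) has_vector_derivative f' b x *\<^sub>R b) (at 0)"
      if "b \<in> Basis" for b
      using has_vector_derivative_scaleR [OF that1 [OF that] has_vector_derivative_const] by simp
    then show ?thesis
      unfolding P_def by (intro has_vector_derivative_sum)
  qed
  have poly: "polynomial_function (P f)" if "\<And>b. b \<in> Basis \<Longrightarrow> real_polynomial_function (f b)" for f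
    unfolding P_def using that
    by (intro polynomial_function_sum polynomial_function_mult)
      (auto simp: real_polynomial_function_eq [symmetric])
  have d1: "((\<lambda>t. q (x + t *\<^sub>R u)) has_vector_derivative P p1 x) (at 0)" for x
    by (subst q, rule der) (use p in simp)
  have d2: "((\<lambda>t. q (x + t *\<^sub>R v)) has_vector_derivative P p2 x) (at 0)" for x
    by (subst q, rule der) (use p in simp)
  have d12: "((\<lambda>t. P p1 (x + t *\<^sub>R v)) has_vector_derivative P p12 x) (at 0)" for x
    by (rule der) (use p in simp)
  have d21: "((\<lambda>t. P p2 (x + t *\<^sub>R u)) has_vector_derivative P p12 x) (at 0)" for x
    by (rule der) (use p in simp)
  have e1: "dir_deriv q x u = P p1 x" for x by (rule dir_deriv_eqI [OF d1])
  have e2: "dir_deriv q x v = P p2 x" for x by (rule dir_deriv_eqI [OF d2])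
  show "polynomial_function (\<lambda>x. dir_deriv q x u)"
    unfolding e1 by (rule poly) (use p in simp)
  show "((\<lambda>t. q (x + t *\<^sub>R u)) has_vector_derivative dir_deriv q x u) (at 0)"
    unfolding e1 by (rule d1)
  show "dir_deriv (\<lambda>y. dir_deriv q y u) x v = dir_deriv (\<lambda>y. dir_deriv q y v) x u"
    unfolding e1 e2 dir_deriv_eqI [OF d12] dir_deriv_eqI [OF d21] ..
qed

lemma polynomial_dir_deriv_linear:
  fixes q :: "'a::real_normed_vector \<Rightarrow> 'b::euclidean_space"
  assumes "polynomial_function q"
  shows "linear (\<lambda>v. dir_deriv q x v)"
proof -
  obtain q' where q': "(q has_derivative q') (at x)"
    using differentiable_at_polynomial_function [OF assms] differentiable_def by blast
  show ?thesis
    unfolding dir_deriv_has_derivative [OF q'] using has_derivative_linear [OF q'] .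
qed

text \<open>
  Members of \<open>hom_polys H k\<close> agree with a polynomial on \<open>H\<close> only, so all calculus below
  is at points of \<open>H\<close> and in directions of \<open>H\<close>.
\<close>

definition polynomial_on :: "'a::real_normed_vector set \<Rightarrow> ('a \<Rightarrow> 'b::real_normed_vector) \<Rightarrow> bool" where
  "polynomial_on H p \<longleftrightarrow> (\<exists>q. polynomial_function q \<and> (\<forall>w\<in>H. p w = q w))"

text \<open>
  The line through $w$ in direction $v$ stays in the subspace.
\<close>

lemma dir_deriv_cong_on:
  assumes "subspace H" "\<And>w. w \<in> H \<Longrightarrow> p w = q w" "w \<in> H" "v \<in> H"
  shows "dir_deriv p w v = dir_deriv q w v"
  unfolding dir_deriv_def using assms by (simp add: subspace_add subspace_scale)

lemma polynomial_on_dir_deriv: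
  fixes p :: "'a::real_normed_vector \<Rightarrow> 'b::euclidean_space"
  assumes H: "subspace H" and p: "polynomial_on H p"
  shows "u \<in> H \<Longrightarrow> polynomial_on H (\<lambda>w. dir_deriv p w u)"
    and "u \<in> H \<Longrightarrow> w \<in> H \<Longrightarrow> ((\<lambda>t. p (w + t *\<^sub>R u)) has_vector_derivative dir_deriv p w u) (at 0)"
    and "u \<in> H \<Longrightarrow> v \<in> H \<Longrightarrow> w \<in> H \<Longrightarrow>
      dir_deriv (\<lambda>y. dir_deriv p y u) w v = dir_deriv (\<lambda>y. dir_deriv p y v) w u"
    and "w \<in> H \<Longrightarrow> linear_on_subspace H (dir_deriv p w)"
proof -
  obtain q where q: "polynomial_function q" and pq: "\<And>w. w \<in> H \<Longrightarrow> p w = q w"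
    using p unfolding polynomial_on_def by blast
  note dpq = dir_deriv_cong_on [OF H pq]
  show "polynomial_on H (\<lambda>w. dir_deriv p w u)" if "u \<in> H"
    unfolding polynomial_on_def
    by (rule exI [of _ "\<lambda>x. dir_deriv q x u"]) (simp add: polynomial_partials(1) [OF q] dpq that)
  show "((\<lambda>t. p (w + t *\<^sub>R u)) has_vector_derivative dir_deriv p w u) (at 0)" if "u \<in> H" "w \<in> H"
    using polynomial_partials(2) [OF q, of w u] that
    by (simp add: dpq pq H subspace_add subspace_scale)
  show "linear_on_subspace H (dir_deriv p w)" if "w \<in> H"
    using polynomial_dir_deriv_linear [OF q, of w] that H
    by (auto simp: linear_on_subspace_def dpq subspace_add subspace_scale linear_iff)
  show "dir_deriv (\<lambda>y. dir_deriv p y u) w v = dir_deriv (\<lambda>y. dir_deriv p y v) w u"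
    if "u \<in> H" "v \<in> H" "w \<in> H"
    using polynomial_partials(3) [OF q, of u w v] that
    by (simp add: dir_deriv_cong_on [OF H dpq] )
qed

lemma polynomial_onI: "polynomial_function q \<Longrightarrow> (\<And>w. w \<in> H \<Longrightarrow> p w = q w) \<Longrightarrow> polynomial_on H p"
  unfolding polynomial_on_def by (intro exI conjI ballI)

lemma polynomial_onE:
  assumes "polynomial_on H p"
  obtains q where "polynomial_function q" "\<And>w. w \<in> H \<Longrightarrow> p w = q w"
  using assms unfolding polynomial_on_def by (elim exE conjE) (rule that, simp_all)

lemma polynomial_on_const [intro]: "polynomial_on H (\<lambda>_. c)"
  by (rule polynomial_onI [OF polynomial_function_const]) simp

lemma polynomial_on_id [intro]: "polynomial_on H (\<lambda>w. w)"
  by (rule polynomial_onI [OF polynomial_function_id]) simp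

lemma polynomial_on_add [intro]:
  assumes "polynomial_on H p" "polynomial_on H q"
  shows "polynomial_on H (\<lambda>w. p w + q w)"
  using assms by (elim polynomial_onE) (rule polynomial_onI [OF polynomial_function_add], simp_all)

lemma polynomial_on_mult [intro]:
  fixes p q :: "'a::real_normed_vector \<Rightarrow> ('m::{finite,linorder}) cl"
  assumes "polynomial_on H p" "polynomial_on H q"
  shows "polynomial_on H (\<lambda>w. p w * q w)"
  using assms by (elim polynomial_onE) (rule polynomial_onI [OF polynomial_function_cl_mult], simp_all)

lemma polynomial_on_scaleR [intro]:
  assumes "polynomial_on H r" "polynomial_on H q"
  shows "polynomial_on H (\<lambda>w. r w *\<^sub>R q w)"
  using assms by (elim polynomial_onE) (rule polynomial_onI [OF polynomial_function_mult], simp_all)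

lemma polynomial_on_sum [intro]:
  assumes "finite I" "\<And>i. i \<in> I \<Longrightarrow> polynomial_on H (p i)"
  shows "polynomial_on H (\<lambda>w. \<Sum>i\<in>I. p i w)"
  using assms by (induction I) (auto intro: polynomial_on_add)

section \<open>Homogeneous polynomials on a subspace\<close>

lemma hom_polysD:
  assumes "p \<in> hom_polys H k"
  shows "polynomial_on H p" "\<And>w t. w \<in> H \<Longrightarrow> p (t *\<^sub>R w) = t ^ k *\<^sub>R p w"
  using assms unfolding hom_polys_def polynomial_on_def by auto

lemma hom_polysI:
  assumes "polynomial_on H p" "\<And>w t. w \<in> H \<Longrightarrow> p (t *\<^sub>R w) = t ^ k *\<^sub>R p w"
  shows "p \<in> hom_polys H k"
  using assms unfolding hom_polys_def polynomial_on_def by auto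

lemma hom_polys_mult_left:
  assumes "p \<in> hom_polys H k"
  shows "(\<lambda>w. c * p w) \<in> hom_polys H k"
  by (rule hom_polysI) (use hom_polysD [OF assms] in \<open>auto intro!: polynomial_on_mult\<close>)

lemma hom_polys_mult_var:
  assumes "p \<in> hom_polys H k"
  shows "(\<lambda>w. w * p w) \<in> hom_polys H (Suc k)"
  by (rule hom_polysI) (use hom_polysD [OF assms] in \<open>auto intro!: polynomial_on_mult\<close>)

lemma hom_polys_add:
  assumes "p \<in> hom_polys H k" "q \<in> hom_polys H k"
  shows "(\<lambda>w. p w + q w) \<in> hom_polys H k"
  by (rule hom_polysI)
    (use hom_polysD [OF assms(1)] hom_polysD [OF assms(2)] in
      \<open>auto intro!: polynomial_on_add simp: scaleR_add_right\<close>)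

lemma hom_polys_scaleR:
  assumes "p \<in> hom_polys H k"
  shows "(\<lambda>w. c *\<^sub>R p w) \<in> hom_polys H k"
  by (rule hom_polysI)
    (use hom_polysD [OF assms] in \<open>auto intro!: polynomial_on_scaleR simp: mult.commute\<close>)

lemma hom_polys_sum:
  assumes "finite I" "\<And>i. i \<in> I \<Longrightarrow> p i \<in> hom_polys H k"
  shows "(\<lambda>w. \<Sum>i\<in>I. p i w) \<in> hom_polys H k"
proof (rule hom_polysI)
  show "polynomial_on H (\<lambda>w. \<Sum>i\<in>I. p i w)"
    using assms hom_polysD(1) by (intro polynomial_on_sum) auto
next
  fix w t assume "w \<in> H"
  then show "(\<Sum>i\<in>I. p i (t *\<^sub>R w)) = t ^ k *\<^sub>R (\<Sum>i\<in>I. p i w)"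
    unfolding scaleR_sum_right by (intro sum.cong refl hom_polysD(2) [OF assms(2)])
qed

lemma hom_polys_cong:
  assumes "subspace H" "p \<in> hom_polys H k" "\<And>w. w \<in> H \<Longrightarrow> q w = p w"
  shows "q \<in> hom_polys H k"
proof (rule hom_polysI)
  show "polynomial_on H q"
    using hom_polysD(1) [OF assms(2)]
    by (elim polynomial_onE) (rule polynomial_onI, auto simp: assms(3))
qed (simp add: assms(3) subspace_scale [OF assms(1)] hom_polysD(2) [OF assms(2)])

text \<open>
  For $s \neq 0$ the claim comes from differentiating $p(sw + tv) = s^{k+1} p(w + (t/s) v)$ in $t$;
  the case $s = 0$ follows by continuity.
\<close>

lemma hom_polys_dir_deriv:
  assumes H: "subspace H" and p: "p \<in> hom_polys H (Suc k)" and v: "v \<in> H"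
  shows "(\<lambda>w. dir_deriv p w v) \<in> hom_polys H k"
proof (rule hom_polysI)
  note poly = hom_polysD(1) [OF p] and hom = hom_polysD(2) [OF p]
  show polyd: "polynomial_on H (\<lambda>w. dir_deriv p w v)"
    by (rule polynomial_on_dir_deriv(1) [OF H poly v])
  fix w t assume w: "w \<in> H"
  have nz: "dir_deriv p (s *\<^sub>R w) v = s ^ k *\<^sub>R dir_deriv p w v" if "s \<noteq> 0" for s
  proof (rule dir_deriv_eqI)
    have "((\<lambda>t. p (w + t *\<^sub>R v)) has_vector_derivative dir_deriv p w v) (at (0 / s))"
      using polynomial_on_dir_deriv(2) [OF H poly v w] by simp
    then have "(((\<lambda>t. p (w + t *\<^sub>R v)) \<circ> (\<lambda>t. t / s)) has_vector_derivative
        (1 / s) *\<^sub>R dir_deriv p w v) (at 0)"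
      by (intro vector_diff_chain_at) (auto simp: has_real_derivative_iff_has_vector_derivative [symmetric]
          intro!: derivative_eq_intros simp: that)
    then have "((\<lambda>t. s ^ Suc k *\<^sub>R p (w + (t / s) *\<^sub>R v)) has_vector_derivative
        s ^ Suc k *\<^sub>R (1 / s) *\<^sub>R dir_deriv p w v) (at 0)"
      unfolding o_def by (rule bounded_linear.has_vector_derivative [OF bounded_linear_scaleR_right])
    moreover have "s ^ Suc k *\<^sub>R p (w + (t / s) *\<^sub>R v) = p (s *\<^sub>R w + t *\<^sub>R v)" for t
    proof -
      have "s ^ Suc k *\<^sub>R p (w + (t / s) *\<^sub>R v) = p (s *\<^sub>R (w + (t / s) *\<^sub>R v))"
        by (rule hom [symmetric]) (intro subspace_add subspace_scale H w v)
      also have "s *\<^sub>R (w + (t / s) *\<^sub>R v) = s *\<^sub>R w + t *\<^sub>R v"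
        using that by (simp add: scaleR_add_right)
      finally show ?thesis .
    qed
    ultimately show "((\<lambda>t. p (s *\<^sub>R w + t *\<^sub>R v)) has_vector_derivative
        s ^ k *\<^sub>R dir_deriv p w v) (at 0)"
      using that by simp
  qed
  show "dir_deriv p (t *\<^sub>R w) v = t ^ k *\<^sub>R dir_deriv p w v"
  proof (cases "t = 0")
    case False
    then show ?thesis by (rule nz)
  next
    case True
    obtain q where q: "polynomial_function q" "\<And>w. w \<in> H \<Longrightarrow> dir_deriv p w v = q w"
      using polyd by (rule polynomial_onE) (rule that)
    have c: "isCont (\<lambda>s. q (s *\<^sub>R w) - s ^ k *\<^sub>R q w) 0"
    proof (intro continuous_diff continuous_scaleR continuous_power continuous_ident continuous_const)
      show "isCont (\<lambda>s. q (s *\<^sub>R w)) 0"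
        by (rule isCont_o2 [OF _ continuous_polymonial_function [OF q(1)]]) (intro continuous_intros)
    qed
    have "\<forall>\<^sub>F s in at (0::real). q (s *\<^sub>R w) - s ^ k *\<^sub>R q w = 0"
      using nz w H unfolding eventually_at_filter
      by (intro always_eventually) (simp add: q(2) [symmetric] subspace_scale)
    then have "(\<lambda>s. q (s *\<^sub>R w) - s ^ k *\<^sub>R q w) \<midarrow>0\<rightarrow> 0"
      by (rule tendsto_eventually)
    with c [unfolded isCont_def] have "q (0 *\<^sub>R w) - 0 ^ k *\<^sub>R q w = 0"
      by (intro tendsto_unique [OF trivial_limit_at])
    then show ?thesis
      using True w H by (simp add: q(2) subspace_0 [OF H])
  qed
qed

lemma hom_polys_0_dir_deriv:
  assumes H: "subspace H" and p: "p \<in> hom_polys H 0" and "w \<in> H" "v \<in> H"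
  shows "dir_deriv p w v = 0"
proof -
  have const: "p u = p 0" if "u \<in> H" for u
    using hom_polysD(2) [OF p that, of 0] by simp
  have "dir_deriv p w v = dir_deriv (\<lambda>_. p 0) w v"
    by (rule dir_deriv_cong_on [OF H const assms(3,4)])
  then show ?thesis
    by (simp add: dir_deriv_eqI [OF has_vector_derivative_const])
qed

text \<open>
  Both sides are the derivative of $p(w + tw) = (1+t)^k p(w)$ at $t = 0$.
\<close>

lemma euler_identity:
  assumes B: "orthonormal_basis B H" and p: "p \<in> hom_polys H k" and w: "w \<in> H"
  shows "(\<Sum>b\<in>B. (w \<bullet> b) *\<^sub>R dir_deriv p w b) = real k *\<^sub>R p w"
proof -
  note H = orthonormal_basis_imp_subspace [OF B]
  have "(\<Sum>b\<in>B. (w \<bullet> b) *\<^sub>R dir_deriv p w b) = dir_deriv p w (\<Sum>b\<in>B. (w \<bullet> b) *\<^sub>R b)"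
    using linear_on_subspace_sum [OF polynomial_on_dir_deriv(4) [OF H hom_polysD(1) [OF p] w] H
        orthonormal_basis_finite [OF B], of "\<lambda>b. b" "\<lambda>b. w \<bullet> b"] orthonormal_basis_subset [OF B]
    by simp
  also have "\<dots> = dir_deriv p w w"
    by (simp add: orthonormal_basis_expansion [OF B w])
  also have "\<dots> = real k *\<^sub>R p w"
  proof (rule dir_deriv_eqI)
    have "p (w + t *\<^sub>R w) = (1 + t) ^ k *\<^sub>R p w" for t
      using hom_polysD(2) [OF p w, of "1 + t"] by (simp add: scaleR_add_left)
    moreover have "((\<lambda>t. (1 + t) ^ k) has_real_derivative real k) (at 0)"
      by (auto intro!: derivative_eq_intros)
    then have "((\<lambda>t. (1 + t) ^ k *\<^sub>R p w) has_vector_derivative real k *\<^sub>R p w) (at 0)"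
      using has_vector_derivative_scaleR [OF _ has_vector_derivative_const,
          of "\<lambda>t. (1 + t) ^ k" "real k" 0 UNIV "p w"] by simp
    ultimately show "((\<lambda>t. p (w + t *\<^sub>R w)) has_vector_derivative real k *\<^sub>R p w) (at 0)"
      by simp
  qed
  finally show ?thesis .
qed

section \<open>The Dirac operator on a subspace\<close>

lemma dirac_cong_on:
  assumes "subspace H" "B \<subseteq> H" "\<And>w. w \<in> H \<Longrightarrow> p w = q w" "w \<in> H"
  shows "dirac B p w = dirac B q w"
  unfolding dirac_def
proof (rule sum.cong [OF refl])
  fix b assume "b \<in> B"
  then have "dir_deriv p w b = dir_deriv q w b"
    by (intro dir_deriv_cong_on [OF assms(1,3) assms(4) subsetD [OF assms(2)]])
  then show "b * dir_deriv p w b = b * dir_deriv q w b"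
    by simp
qed

lemma onb_subset: "subspace H \<Longrightarrow> onb H \<subseteq> H"
  by (rule subsetI) (rule orthonormal_basis_subset [OF orthonormal_basis_onb])

lemma dirac_basis_independent:
  assumes "orthonormal_basis B H" "orthonormal_basis C H" "polynomial_on H p" "w \<in> H"
  shows "dirac B p w = dirac C p w"
  unfolding dirac_def
  by (rule sum_onb_independent [OF assms(1,2)
        polynomial_on_dir_deriv(4) [OF orthonormal_basis_imp_subspace [OF assms(1)] assms(3,4)]])

lemma polynomial_on_dirac:
  assumes "orthonormal_basis B H" "polynomial_on H p"
  shows "polynomial_on H (dirac B p)"
  unfolding dirac_def
  by (rule polynomial_on_sum [OF orthonormal_basis_finite [OF assms(1)]],
      rule polynomial_on_mult [OF polynomial_on_const], rule polynomial_on_dir_deriv(1)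
        [OF orthonormal_basis_imp_subspace [OF assms(1)] assms(2)], rule orthonormal_basis_subset [OF assms(1)])

lemma hom_polys_dirac:
  assumes "orthonormal_basis B H" "p \<in> hom_polys H (Suc k)"
  shows "dirac B p \<in> hom_polys H k"
  unfolding dirac_def
  by (rule hom_polys_sum [OF orthonormal_basis_finite [OF assms(1)]], rule hom_polys_mult_left,
      rule hom_polys_dir_deriv [OF orthonormal_basis_imp_subspace [OF assms(1)] assms(2)],
      rule orthonormal_basis_subset [OF assms(1)])

lemma hom_polys_0_dirac:
  assumes "orthonormal_basis B H" "p \<in> hom_polys H 0" "w \<in> H"
  shows "dirac B p w = 0"
  unfolding dirac_def
  by (intro sum.neutral ballI)
    (simp add: hom_polys_0_dir_deriv [OF orthonormal_basis_imp_subspace [OF assms(1)] assms(2,3)]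
      orthonormal_basis_subset [OF assms(1)])

lemma dir_deriv_mult_left:
  fixes c :: "('m::{finite,linorder}) cl"
  assumes "((\<lambda>t. p (w + t *\<^sub>R v)) has_vector_derivative d) (at 0)"
  shows "dir_deriv (\<lambda>w. c * p w) w v = c * d"
  by (rule dir_deriv_eqI)
    (rule bounded_linear.has_vector_derivative
      [OF bounded_bilinear.bounded_linear_right [OF bounded_bilinear_cl] assms])

text \<open>
  $D^2$ is minus the Laplacian: the second derivatives are symmetric, so the double sum may be
  symmetrised, and the anticommutation relations leave only its diagonal.
\<close>

lemma dirac_dirac:
  fixes p :: "('m::{finite,linorder}) cl \<Rightarrow> 'm cl"
  assumes B: "orthonormal_basis B H" and sub: "H \<subseteq> vecs" and p: "polynomial_on H p" and w: "w \<in> H"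
  shows "dirac B (dirac B p) w = - (\<Sum>b\<in>B. dir_deriv (\<lambda>v. dir_deriv p v b) w b)"
proof -
  note H = orthonormal_basis_imp_subspace [OF B] and fin = orthonormal_basis_finite [OF B]
    and BH = orthonormal_basis_subset [OF B]
  define M where "M c b = dir_deriv (\<lambda>v. dir_deriv p v b) w c" for b c
  have M: "M c b = M b c" if "b \<in> B" "c \<in> B" for b c
    unfolding M_def by (rule polynomial_on_dir_deriv(3) [OF H p]) (use that BH w in auto)
  have der: "((\<lambda>t. dir_deriv p (w + t *\<^sub>R c) b) has_vector_derivative M c b) (at 0)"
    if "b \<in> B" "c \<in> B" for b c
    unfolding M_def
    by (rule polynomial_on_dir_deriv(2) [OF H polynomial_on_dir_deriv(1) [OF H p]])
      (use that BH w in auto)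
  have "dir_deriv (dirac B p) w c = (\<Sum>b\<in>B. b * M c b)" if "c \<in> B" for c
    unfolding dirac_def
    by (rule dir_deriv_eqI, rule has_vector_derivative_sum, rule bounded_linear.has_vector_derivative
      [OF bounded_bilinear.bounded_linear_right [OF bounded_bilinear_cl] der [OF _ that]])
  then have 1: "dirac B (dirac B p) w = (\<Sum>c\<in>B. \<Sum>b\<in>B. c * b * M c b)"
    by (simp add: dirac_def [of B "dirac B p"] sum_distrib_left mult.assoc)
  have 2: "(\<Sum>c\<in>B. \<Sum>b\<in>B. c * b * M c b) = (\<Sum>c\<in>B. \<Sum>b\<in>B. b * c * M c b)"
    by (subst sum.swap) (intro sum.cong refl, simp add: M)
  have "2 *\<^sub>R dirac B (dirac B p) w = (\<Sum>c\<in>B. \<Sum>b\<in>B. (c * b + b * c) * M c b)"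
    unfolding scaleR_2 distrib_right sum.distrib using 1 2 by simp
  also have "\<dots> = (\<Sum>c\<in>B. \<Sum>b\<in>B. if b = c then - 2 *\<^sub>R M c c else 0)"
  proof (intro sum.cong refl)
    fix b c assume bc: "b \<in> B" "c \<in> B"
    then have "c * b + b * c = (- 2 * (c \<bullet> b)) *\<^sub>R 1"
      by (intro vecs_anticommute) (use BH sub in auto)
    then show "(c * b + b * c) * M c b = (if b = c then - 2 *\<^sub>R M c c else 0)"
      using orthonormal_basis_inner [OF B bc(2,1)] by (cases "b = c") simp_all
  qed
  also have "\<dots> = (\<Sum>c\<in>B. - 2 *\<^sub>R M c c)"
    using fin by (intro sum.cong refl) simp
  also have "\<dots> = 2 *\<^sub>R - (\<Sum>c\<in>B. M c c)"
    unfolding scaleR_sum_right [symmetric] by simp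
  finally show ?thesis
    unfolding scaleR_cancel_left M_def by simp
qed

lemma harmonics_iff_dirac:
  assumes "subspace H" "H \<subseteq> vecs"
  shows "p \<in> harmonics H k \<longleftrightarrow>
    p \<in> hom_polys H k \<and> (\<forall>w\<in>H. dirac (onb H) (dirac (onb H) p) w = 0)"
proof (cases "p \<in> hom_polys H k")
  case True
  have "dirac (onb H) (dirac (onb H) p) w = 0 \<longleftrightarrow>
      (\<Sum>b\<in>onb H. dir_deriv (\<lambda>v. dir_deriv p v b) w b) = 0" if "w \<in> H" for w
    unfolding dirac_dirac [OF orthonormal_basis_onb [OF assms(1)] assms(2) hom_polysD(1) [OF True] that]
    by (rule neg_equal_0_iff_equal)
  then show ?thesis
    unfolding harmonics_def by (simp add: True cong: ball_cong)
qed (simp add: harmonics_def)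

lemma dirac_zero:
  assumes "subspace H" "B \<subseteq> H" "\<And>w. w \<in> H \<Longrightarrow> p w = 0" "w \<in> H"
  shows "dirac B p w = 0"
proof -
  have "dirac B p w = dirac B (\<lambda>_. 0) w"
    by (rule dirac_cong_on [OF assms])
  also have "\<dots> = 0"
    by (simp add: dirac_def dir_deriv_eqI [OF has_vector_derivative_const])
  finally show ?thesis .
qed

lemma monogenics_subset_harmonics:
  assumes "subspace H" "H \<subseteq> vecs"
  shows "monogenics H k \<subseteq> harmonics H k"
proof
  fix p assume p: "p \<in> monogenics H k"
  then have D: "dirac (onb H) p w = 0" if "w \<in> H" for w
    using that unfolding monogenics_def by blast
  have "\<forall>w\<in>H. dirac (onb H) (dirac (onb H) p) w = 0"
    by (intro ballI dirac_zero [OF assms(1) onb_subset [OF assms(1)] D])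
  with p show "p \<in> harmonics H k"
    unfolding harmonics_iff_dirac [OF assms] monogenics_def by blast
qed

lemma dirac_add_scaleR:
  assumes "polynomial_on H p" "polynomial_on H q" "subspace H" "B \<subseteq> H" "w \<in> H"
  shows "dirac B (\<lambda>w. p w + c *\<^sub>R q w) w = dirac B p w + c *\<^sub>R dirac B q w"
proof -
  have "dir_deriv (\<lambda>w. p w + c *\<^sub>R q w) w b = dir_deriv p w b + c *\<^sub>R dir_deriv q w b" if "b \<in> B" for b
  proof -
    have b: "b \<in> H" using that assms(4) by blast
    show ?thesis
      by (intro dir_deriv_eqI has_vector_derivative_add
          bounded_linear.has_vector_derivative [OF bounded_linear_scaleR_right]
          polynomial_on_dir_deriv(2) [OF assms(3) assms(1) b assms(5)]
          polynomial_on_dir_deriv(2) [OF assms(3) assms(2) b assms(5)])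
  qed
  then show ?thesis
    by (simp add: dirac_def sum.distrib distrib_left scaleR_sum_right)
qed

section \<open>The projection onto monogenic polynomials\<close>

text \<open>
  Moving each $b$ past $w$ costs $-2(w \cdot b)$, which Euler's identity sums up to the degree, and
  the derivatives of the factor $w$ contribute $\sum_b b^2 = -\dim H$. For monogenic $r$ only the multiple of
  $r$ is left, so $r$ can be recovered from $D(wr)$ if $\dim H > 0$.
\<close>

lemma dirac_var_mult:
  fixes r :: "('m::{finite,linorder}) cl \<Rightarrow> 'm cl"
  assumes B: "orthonormal_basis B H" and sub: "H \<subseteq> vecs" and r: "r \<in> hom_polys H k" and w: "w \<in> H"
  shows "dirac B (\<lambda>w. w * r w) w = - (real (dim H) + 2 * real k) *\<^sub>R r w - w * dirac B r w"
proof -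
  note H = orthonormal_basis_imp_subspace [OF B] and fin = orthonormal_basis_finite [OF B]
    and BH = orthonormal_basis_subset [OF B]
  have der: "dir_deriv (\<lambda>w. w * r w) w b = w * dir_deriv r w b + b * r w" if "b \<in> B" for b
  proof (rule dir_deriv_eqI)
    have "((\<lambda>t. w + t *\<^sub>R b) has_vector_derivative b) (at 0)"
      by (auto intro!: derivative_eq_intros)
    from bounded_bilinear.has_vector_derivative [OF bounded_bilinear_cl this
        polynomial_on_dir_deriv(2) [OF H hom_polysD(1) [OF r] BH [OF that] w]]
    show "((\<lambda>t. (w + t *\<^sub>R b) * r (w + t *\<^sub>R b)) has_vector_derivative
        w * dir_deriv r w b + b * r w) (at 0)" by simp
  qed
  have step: "b * (w * d + b * r w) = - (w * (b * d)) - 2 *\<^sub>R ((w \<bullet> b) *\<^sub>R d) - r w" if "b \<in> B" for b d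
  proof -
    have b: "b \<in> vecs" "norm b = 1" and wv: "w \<in> vecs"
      using that BH sub w B unfolding orthonormal_basis_def by auto
    have "b * (w * d + b * r w) = (b * w + w * b) * d - w * (b * d) + (b * b) * r w"
      by (simp add: algebra_simps)
    then show ?thesis
      unfolding vecs_anticommute [OF b(1) wv] unit_square [OF b] by (simp add: inner_commute)
  qed
  have "dirac B (\<lambda>w. w * r w) w = (\<Sum>b\<in>B. - (w * (b * dir_deriv r w b)) - 2 *\<^sub>R ((w \<bullet> b) *\<^sub>R dir_deriv r w b) - r w)"
    unfolding dirac_def using der step by (intro sum.cong refl) simp
  also have "\<dots> = - (w * dirac B r w) - 2 *\<^sub>R (\<Sum>b\<in>B. (w \<bullet> b) *\<^sub>R dir_deriv r w b) - real (card B) *\<^sub>R r w"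
    by (simp only: sum_subtractf sum_negf sum_distrib_left dirac_def scaleR_sum_right sum_constant_scaleR)
  also have "\<dots> = - (real (dim H) + 2 * real k) *\<^sub>R r w - w * dirac B r w"
    unfolding euler_identity [OF B r w] orthonormal_basis_card [OF B] by (simp add: algebra_simps)
  finally show ?thesis .
qed

text \<open>
  Applying $D$ to a decomposition $p = q + wr$ into monogenic parts gives
  $Dp = -(\dim H + 2k - 2) r$, which determines $r$ and $q$. Conversely the $r$ defined by this equation is
  monogenic because $D^2 p = 0$, and then so is $q = p - wr$. For $k = 0$ the polynomial is constant, so $Dp = 0$
  and the value of the coefficient, which involves a division by zero if $\dim H = 2$, is immaterial.
\<close>

lemma monogenic_proj_eq:
  fixes p :: "('m::{finite,linorder}) cl \<Rightarrow> 'm cl"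
  assumes H: "subspace H" and sub: "H \<subseteq> vecs" and dim: "dim H > 0"
    and p: "p \<in> harmonics H k" and w: "w \<in> H"
  shows "monogenic_proj H k p w = p w + (1 / (real (dim H) + 2 * real k - 2)) *\<^sub>R (w * dirac (onb H) p w)"
proof -
  define B where "B = onb H"
  define c where "c = 1 / (real (dim H) + 2 * real k - 2)"
  have B: "orthonormal_basis B H" unfolding B_def by (rule orthonormal_basis_onb [OF H])
  note BH = onb_subset [OF H, folded B_def]
  have php: "p \<in> hom_polys H k" and DD: "\<And>w. w \<in> H \<Longrightarrow> dirac B (dirac B p) w = 0"
    using p unfolding harmonics_iff_dirac [OF H sub] B_def by auto
  define R where "R = (if k = 0 then {\<lambda>_. 0} else monogenics H (k - 1))"
  define good where "good q \<longleftrightarrow> q \<in> monogenics H k \<and> (\<exists>r\<in>R. \<forall>w\<in>H. p w = q w + w * r w)" for q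
  have proj: "monogenic_proj H k p = (SOME q. good q)"
    using p unfolding monogenic_proj_def good_def R_def by simp
  have unique: "q w = p w + c *\<^sub>R (w * dirac B p w)" if gq: "good q" and wH: "w \<in> H" for q w
  proof -
    obtain r where q: "q \<in> hom_polys H k" "\<And>w. w \<in> H \<Longrightarrow> dirac B q w = 0" and r: "r \<in> R"
      and pq: "\<And>w. w \<in> H \<Longrightarrow> p w = q w + w * r w"
      using gq unfolding good_def monogenics_def B_def by auto
    show ?thesis
    proof (cases k)
      case 0
      then show ?thesis
        using hom_polys_0_dirac [OF B _ wH, of p] php r pq wH by (simp add: R_def)
    next
      case (Suc j)
      then have r: "r \<in> hom_polys H j" "\<And>w. w \<in> H \<Longrightarrow> dirac B r w = 0"
        using r unfolding R_def monogenics_def B_def by auto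
      have "dirac B p w = dirac B (\<lambda>w. q w + 1 *\<^sub>R (w * r w)) w"
        by (rule dirac_cong_on [OF H BH _ wH]) (simp add: pq)
      also have "\<dots> = dirac B q w + 1 *\<^sub>R dirac B (\<lambda>w. w * r w) w"
        using q(1) r(1) by (intro dirac_add_scaleR [OF _ _ H BH wH])
          (auto intro!: polynomial_on_mult dest: hom_polysD)
      also have "\<dots> = - (real (dim H) + 2 * real j) *\<^sub>R r w"
        by (simp add: q r dirac_var_mult [OF B sub r(1) wH] wH)
      finally have "dirac B p w = - (real (dim H) + 2 * real j) *\<^sub>R r w" .
      moreover have "real (dim H) + 2 * real j \<noteq> 0" using dim by linarith
      then have "c * - (real (dim H) + 2 * real j) = - 1"
        unfolding c_def Suc by (simp add: divide_simps)
      ultimately have "c *\<^sub>R dirac B p w = - r w"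
        by (metis scaleR_minus1_left scaleR_scaleR)
      then have "c *\<^sub>R (w * dirac B p w) = - (w * r w)"
        by (metis mult_minus_right mult_scaleR_right)
      then show ?thesis
        by (simp add: pq wH)
    qed
  qed
  have "\<exists>q. good q"
  proof (cases k)
    case 0
    have "good p"
      unfolding good_def R_def monogenics_def using 0 php hom_polys_0_dirac [OF B, of p]
      by (auto simp: B_def)
    then show ?thesis by (rule exI [of good])
  next
    case (Suc j)
    have hD: "dirac B p \<in> hom_polys H j"
      using php hom_polys_dirac [OF B] by (simp add: Suc)
    define r where "r w = (- c) *\<^sub>R dirac B p w" for w
    have r: "r \<in> hom_polys H j"
      unfolding r_def by (rule hom_polys_scaleR [OF hD])
    have Dr: "dirac B r w = 0" if "w \<in> H" for w
      using dirac_add_scaleR [OF polynomial_on_const [of _ 0] hom_polysD(1) [OF hD] H BH that, of "- c"]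
        DD [OF that] dirac_zero [OF H BH, of "\<lambda>_. 0" w] that
      by (simp add: r_def [abs_def])
    \<comment> \<open>written with \<open>(- 1) *\<^sub>R\<close> to match \<open>dirac_add_scaleR\<close>\<close>
    define q where "q w = p w + (- 1) *\<^sub>R (w * r w)" for w
    have "q \<in> hom_polys H k"
      unfolding q_def using hom_polys_mult_var [OF r] php
      by (intro hom_polys_add hom_polys_scaleR) (simp_all add: Suc)
    moreover have "dirac B q w = 0" if "w \<in> H" for w
    proof -
      have "dirac B q w = dirac B p w + (- 1) *\<^sub>R dirac B (\<lambda>w. w * r w) w"
        unfolding q_def [abs_def] using php r
        by (intro dirac_add_scaleR [OF _ _ H BH that])
          (auto intro!: polynomial_on_mult dest: hom_polysD)
      also have "\<dots> = dirac B p w + (real (dim H) + 2 * real j) *\<^sub>R r w"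
        by (simp add: dirac_var_mult [OF B sub r that] Dr that)
      also have "\<dots> = (1 - (real (dim H) + 2 * real j) * c) *\<^sub>R dirac B p w"
        by (simp add: r_def algebra_simps)
      also have "(real (dim H) + 2 * real j) * c = 1"
        using dim by (simp add: c_def Suc)
      finally show ?thesis by simp
    qed
    ultimately have "good q"
      unfolding good_def monogenics_def R_def using r Dr
      by (auto simp: Suc B_def q_def intro!: bexI [of _ r])
    then show ?thesis by (rule exI [of good])
  qed
  then have "good (monogenic_proj H k p)"
    unfolding proj by (rule someI_ex)
  then show ?thesis
    using unique [OF _ w] unfolding c_def B_def by simp
qed

section \<open>Operations on harmonic polynomials\<close>

lemma harmonics_cong:
  assumes "subspace H" "H \<subseteq> vecs" "p \<in> harmonics H k" "\<And>w. w \<in> H \<Longrightarrow> q w = p w"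
  shows "q \<in> harmonics H k"
proof -
  note onbH = onb_subset [OF assms(1)]
  have "dirac (onb H) (dirac (onb H) q) w = dirac (onb H) (dirac (onb H) p) w" if "w \<in> H" for w
    by (intro dirac_cong_on [OF assms(1) onbH] assms(4) that)
  then show ?thesis
    using assms(3) hom_polys_cong [OF assms(1) _ assms(4)]
    unfolding harmonics_iff_dirac [OF assms(1,2)] by simp
qed

lemma harmonics_mult_left:
  assumes "subspace H" "p \<in> harmonics H k" "H \<subseteq> vecs"
  shows "(\<lambda>w. c * p w) \<in> harmonics H k"
proof -
  have p: "p \<in> hom_polys H k" using assms(2) by (simp add: harmonics_def)
  note poly = hom_polysD(1) [OF p]
  have 1: "dir_deriv (\<lambda>w. c * p w) w b = c * dir_deriv p w b" if "w \<in> H" "b \<in> H" for w b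
    by (intro dir_deriv_mult_left polynomial_on_dir_deriv(2) [OF assms(1) poly] that)
  have 2: "dir_deriv (\<lambda>v. dir_deriv (\<lambda>w. c * p w) v b) w b = c * dir_deriv (\<lambda>v. dir_deriv p v b) w b"
    if "w \<in> H" "b \<in> H" for w b
  proof -
    have "dir_deriv (\<lambda>v. dir_deriv (\<lambda>w. c * p w) v b) w b = dir_deriv (\<lambda>v. c * dir_deriv p v b) w b"
      by (intro dir_deriv_cong_on [OF assms(1)] 1 that)
    also have "\<dots> = c * dir_deriv (\<lambda>v. dir_deriv p v b) w b"
      by (intro dir_deriv_mult_left polynomial_on_dir_deriv(2) [OF assms(1) polynomial_on_dir_deriv(1) [OF assms(1) poly]] that)
    finally show ?thesis .
  qed
  have "(\<Sum>b\<in>onb H. dir_deriv (\<lambda>v. dir_deriv (\<lambda>w. c * p w) v b) w b) = 0" if "w \<in> H" for w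
  proof -
    have "(\<Sum>b\<in>onb H. dir_deriv (\<lambda>v. dir_deriv (\<lambda>w. c * p w) v b) w b)
        = c * (\<Sum>b\<in>onb H. dir_deriv (\<lambda>v. dir_deriv p v b) w b)"
      unfolding sum_distrib_left using that onb_subset [OF assms(1)] by (intro sum.cong refl 2) auto
    then show ?thesis
      using assms(2) that by (simp add: harmonics_def)
  qed
  then show ?thesis
    by (simp add: harmonics_def hom_polys_mult_left [OF p])
qed

lemma harmonics_add_scaleR:
  assumes H: "subspace H" "H \<subseteq> vecs" and p: "p \<in> harmonics H k" and q: "q \<in> harmonics H k"
  shows "(\<lambda>w. p w + c *\<^sub>R q w) \<in> harmonics H k"
proof -
  note B = orthonormal_basis_onb [OF H(1)] and sub = onb_subset [OF H(1)]
  have php: "p \<in> hom_polys H k" "q \<in> hom_polys H k" using p q by (auto simp: harmonics_def)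
  note poly = hom_polysD(1) [OF php(1)] hom_polysD(1) [OF php(2)]
  have "dirac (onb H) (dirac (onb H) (\<lambda>w. p w + c *\<^sub>R q w)) w = 0" if w: "w \<in> H" for w
  proof -
    have "dirac (onb H) (dirac (onb H) (\<lambda>w. p w + c *\<^sub>R q w)) w
        = dirac (onb H) (\<lambda>w. dirac (onb H) p w + c *\<^sub>R dirac (onb H) q w) w"
      by (intro dirac_cong_on [OF H(1) sub] dirac_add_scaleR [OF poly H(1) sub] w)
    also have "\<dots> = dirac (onb H) (dirac (onb H) p) w + c *\<^sub>R dirac (onb H) (dirac (onb H) q) w"
      by (rule dirac_add_scaleR [OF polynomial_on_dirac [OF B poly(1)]
            polynomial_on_dirac [OF B poly(2)] H(1) sub w])
    finally show ?thesis
      using p q w unfolding harmonics_iff_dirac [OF H] by simp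
  qed
  then show ?thesis
    unfolding harmonics_iff_dirac [OF H] by (intro conjI ballI hom_polys_add hom_polys_scaleR php)
qed

section \<open>Reflections\<close>

context
  fixes a :: "('m::{finite,linorder}) cl"
  assumes a: "a \<in> vecs" "norm a = 1"
begin

lemma conj_mem_Rn: "w \<in> conj_Rn a \<Longrightarrow> a * w * a \<in> Rn"
  unfolding conj_Rn_def by (auto simp: unit_conj_conj [OF a])

lemma orthonormal_basis_conj:
  assumes "orthonormal_basis B Rn"
  shows "orthonormal_basis ((\<lambda>u. a * u * a) ` B) (conj_Rn a)"
  unfolding conj_Rn_def
  by (rule orthonormal_basis_image [OF assms linear_conj])
    (use Rn_subset_vecs in \<open>auto intro!: unit_conj_inner [OF a]\<close>)

lemma inj_conj: "inj_on (\<lambda>u. a * u * a) A"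
  by (rule inj_on_inverseI [where g = "\<lambda>u. a * u * a"]) (rule unit_conj_conj [OF a])

lemma dim_conj_Rn: "dim (conj_Rn a) = dim (Rn :: 'm cl set)"
proof -
  have B: "orthonormal_basis (onb Rn) (Rn :: 'm cl set)"
    by (rule orthonormal_basis_onb [OF subspace_Rn])
  show ?thesis
    using orthonormal_basis_card [OF orthonormal_basis_conj [OF B]] orthonormal_basis_card [OF B]
    by (simp add: card_image [OF inj_conj])
qed

text \<open>
  The scalar \<open>c\<close> is carried along so that the result can be applied twice: the Dirac operator turns
  the factor \<open>c\<close> into \<open>- c\<close>.
\<close>

lemma polynomial_on_conj:
  assumes "polynomial_on Rn p"
  shows "polynomial_on (conj_Rn a) (\<lambda>w. c *\<^sub>R (a * p (a * w * a)))"
proof -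
  obtain q where q: "polynomial_function q" "\<And>u. u \<in> Rn \<Longrightarrow> p u = q u"
    using assms by (rule polynomial_onE) (rule that)
  have "polynomial_function (q \<circ> (\<lambda>w. a * w * a))"
    by (rule polynomial_function_compose [OF _ q(1)]) (intro polynomial_function_cl_mult polynomial_function_const polynomial_function_id)
  then have "polynomial_function (\<lambda>w. c *\<^sub>R (a * q (a * w * a)))"
    unfolding o_def by (intro polynomial_function_cmul polynomial_function_cl_mult polynomial_function_const)
  then show ?thesis
    by (rule polynomial_onI) (simp add: q(2) conj_mem_Rn)
qed

text \<open>
  In the reflected basis $aba$ the directional derivatives of $a\,p(a \cdot a)$ at $w$ are $a$ times those of
  $p$ at $awa$, and $(aba)a = -ab$.
\<close>

lemma dirac_conj:
  assumes p: "polynomial_on Rn p" and w: "w \<in> conj_Rn a"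
  shows "dirac (onb (conj_Rn a)) (\<lambda>w. c *\<^sub>R (a * p (a * w * a))) w
    = (- c) *\<^sub>R (a * dirac (onb Rn) p (a * w * a))"
proof -
  define B :: "'m cl set" where "B = onb Rn"
  define p' where "p' w = c *\<^sub>R (a * p (a * w * a))" for w
  have B: "orthonormal_basis B Rn" unfolding B_def by (rule orthonormal_basis_onb [OF subspace_Rn])
  have "dirac (onb (conj_Rn a)) p' w = dirac ((\<lambda>u. a * u * a) ` B) p' w"
    unfolding p'_def [abs_def]
    by (rule dirac_basis_independent [OF orthonormal_basis_onb [OF subspace_conj_Rn]
          orthonormal_basis_conj [OF B] polynomial_on_conj [OF p] w])
  also have "\<dots> = (\<Sum>b\<in>B. (a * b * a) * dir_deriv p' w (a * b * a))"
    unfolding dirac_def by (simp add: sum.reindex [OF inj_conj])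
  also have "\<dots> = (\<Sum>b\<in>B. (- c) *\<^sub>R (a * (b * dir_deriv p (a * w * a) b)))"
  proof (rule sum.cong [OF refl])
    fix b assume b: "b \<in> B"
    have "((\<lambda>t. p (a * w * a + t *\<^sub>R b)) has_vector_derivative dir_deriv p (a * w * a) b) (at 0)"
      by (rule polynomial_on_dir_deriv(2) [OF subspace_Rn p orthonormal_basis_subset [OF B b] conj_mem_Rn [OF w]])
    then have "((\<lambda>t. c *\<^sub>R (a * p (a * w * a + t *\<^sub>R b))) has_vector_derivative
        c *\<^sub>R (a * dir_deriv p (a * w * a) b)) (at 0)"
      by (intro bounded_linear.has_vector_derivative [OF bounded_linear_scaleR_right]
          bounded_linear.has_vector_derivative
            [OF bounded_bilinear.bounded_linear_right [OF bounded_bilinear_cl]])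
    moreover have "a * (w + t *\<^sub>R (a * b * a)) * a = a * w * a + t *\<^sub>R b" for t
      by (simp add: distrib_left distrib_right unit_conj_conj [OF a])
    ultimately have "dir_deriv p' w (a * b * a) = c *\<^sub>R (a * dir_deriv p (a * w * a) b)"
      unfolding p'_def by (intro dir_deriv_eqI) simp
    then show "(a * b * a) * dir_deriv p' w (a * b * a) = (- c) *\<^sub>R (a * (b * dir_deriv p (a * w * a) b))"
      by (simp add: mult.assoc unit_cancel [OF a])
  qed
  also have "\<dots> = (- c) *\<^sub>R (a * dirac B p (a * w * a))"
    by (simp only: dirac_def sum_distrib_left scaleR_sum_right)
  finally show ?thesis
    unfolding p'_def B_def .
qed

lemma harmonics_conj:
  assumes p: "p \<in> harmonics Rn k"
  shows "(\<lambda>w. c *\<^sub>R (a * p (a * w * a))) \<in> harmonics (conj_Rn a) k"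
proof -
  note H' = subspace_conj_Rn [of a] conj_Rn_subset_vecs [OF a]
  have php: "p \<in> hom_polys Rn k" and DD: "\<And>u. u \<in> Rn \<Longrightarrow> dirac (onb Rn) (dirac (onb Rn) p) u = 0"
    using p unfolding harmonics_iff_dirac [OF subspace_Rn Rn_subset_vecs] by auto
  note poly = hom_polysD(1) [OF php]
  have "(\<lambda>w. c *\<^sub>R (a * p (a * w * a))) \<in> hom_polys (conj_Rn a) k"
  proof (rule hom_polysI [OF polynomial_on_conj [OF poly]])
    fix w t assume "w \<in> conj_Rn a"
    from hom_polysD(2) [OF php conj_mem_Rn [OF this], of t]
    show "c *\<^sub>R (a * p (a * (t *\<^sub>R w) * a)) = t ^ k *\<^sub>R c *\<^sub>R (a * p (a * w * a))"
      by (simp add: mult.commute)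
  qed
  moreover have "dirac (onb (conj_Rn a)) (dirac (onb (conj_Rn a)) (\<lambda>w. c *\<^sub>R (a * p (a * w * a)))) w = 0"
    if w: "w \<in> conj_Rn a" for w
  proof -
    have "dirac (onb (conj_Rn a)) (dirac (onb (conj_Rn a)) (\<lambda>w. c *\<^sub>R (a * p (a * w * a)))) w
      = dirac (onb (conj_Rn a)) (\<lambda>w. (- c) *\<^sub>R (a * dirac (onb Rn) p (a * w * a))) w"
      by (intro dirac_cong_on [OF H'(1) onb_subset [OF H'(1)]] dirac_conj [OF poly] w)
    also have "\<dots> = (- (- c)) *\<^sub>R (a * dirac (onb Rn) (dirac (onb Rn) p) (a * w * a))"
      by (rule dirac_conj [OF polynomial_on_dirac [OF orthonormal_basis_onb [OF subspace_Rn] poly] w])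
    also have "\<dots> = 0"
      by (simp add: DD conj_mem_Rn [OF w])
    finally show ?thesis .
  qed
  ultimately show ?thesis
    unfolding harmonics_iff_dirac [OF H'] by simp
qed

text \<open>
  In the explicit formula for the projection, the sign in \<open>dirac_conj\<close> cancels against the one in
  $wa = -a(awa)$.
\<close>

lemma monogenic_proj_conj:
  assumes dim: "dim (Rn :: 'm cl set) > 0" and p: "p \<in> harmonics Rn k"
    and p': "\<And>w. w \<in> conj_Rn a \<Longrightarrow> p' w = c *\<^sub>R (a * p (a * w * a))" and w: "w \<in> conj_Rn a"
  shows "monogenic_proj (conj_Rn a) k p' w = c *\<^sub>R (a * monogenic_proj Rn k p (a * w * a))"
proof -
  note H' = subspace_conj_Rn [of a] conj_Rn_subset_vecs [OF a]
  define \<kappa> where "\<kappa> = 1 / (real (dim (Rn :: 'm cl set)) + 2 * real k - 2)"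
  define d where "d = dirac (onb Rn) p (a * w * a)"
  have poly: "polynomial_on Rn p"
    using p hom_polysD(1) by (auto simp: harmonics_def)
  have p'h: "p' \<in> harmonics (conj_Rn a) k"
    by (rule harmonics_cong [OF H' harmonics_conj [OF p] p'])
  have Dp': "dirac (onb (conj_Rn a)) p' w = (- c) *\<^sub>R (a * d)"
    unfolding d_def dirac_conj [OF poly w, symmetric]
    by (rule dirac_cong_on [OF H'(1) onb_subset [OF H'(1)] p' w])
  have "w * a = - (a * (a * w * a))"
    by (simp add: mult.assoc unit_cancel [OF a])
  then have wad: "w * (a * d) = - (a * ((a * w * a) * d))"
    by (simp only: mult.assoc [symmetric] minus_mult_left)
  have "monogenic_proj (conj_Rn a) k p' w = p' w + \<kappa> *\<^sub>R (w * dirac (onb (conj_Rn a)) p' w)"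
    using monogenic_proj_eq [OF H' _ p'h w] dim unfolding dim_conj_Rn \<kappa>_def by simp
  also have "\<dots> = c *\<^sub>R (a * (p (a * w * a) + \<kappa> *\<^sub>R ((a * w * a) * d)))"
    unfolding Dp' p' [OF w] mult_scaleR_right wad by (simp add: distrib_left scaleR_add_right mult.commute)
  also have "p (a * w * a) + \<kappa> *\<^sub>R ((a * w * a) * d) = monogenic_proj Rn k p (a * w * a)"
    unfolding d_def \<kappa>_def
    by (rule monogenic_proj_eq [OF subspace_Rn Rn_subset_vecs dim p conj_mem_Rn [OF w], symmetric])
  finally show ?thesis .
qed

lemma monogenic_proj_conj_eq_0_iff:
  assumes dim: "dim (Rn :: 'm cl set) > 0" and p: "p \<in> harmonics Rn k" and c: "c \<noteq> 0"
    and p': "\<And>w. w \<in> conj_Rn a \<Longrightarrow> p' w = c *\<^sub>R (a * p (a * w * a))"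
  shows "(\<forall>w\<in>conj_Rn a. monogenic_proj (conj_Rn a) k p' w = 0) \<longleftrightarrow> (\<forall>u\<in>Rn. monogenic_proj Rn k p u = 0)"
proof -
  have "a * x = 0 \<longleftrightarrow> x = 0" for x
    using unit_cancel [OF a, of x] by (metis mult_zero_right neg_equal_0_iff_equal)
  then have iff: "monogenic_proj (conj_Rn a) k p' w = 0 \<longleftrightarrow> monogenic_proj Rn k p (a * w * a) = 0"
    if "w \<in> conj_Rn a" for w
  proof -
    have "monogenic_proj (conj_Rn a) k p' w = c *\<^sub>R (a * monogenic_proj Rn k p (a * w * a))"
      by (rule monogenic_proj_conj [OF dim p p' that])
    with c \<open>\<And>x. a * x = 0 \<longleftrightarrow> x = 0\<close> show ?thesis by simp
  qed
  show ?thesis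
  proof (intro iffI ballI)
    fix u :: "'m cl" assume *: "\<forall>w\<in>conj_Rn a. monogenic_proj (conj_Rn a) k p' w = 0" and "u \<in> Rn"
    then have "a * u * a \<in> conj_Rn a" unfolding conj_Rn_def by blast
    from iff [OF this] * this show "monogenic_proj Rn k p u = 0"
      by (simp add: unit_conj_conj [OF a])
  next
    fix w assume "\<forall>u\<in>Rn. monogenic_proj Rn k p u = 0" "w \<in> conj_Rn a"
    then show "monogenic_proj (conj_Rn a) k p' w = 0"
      using iff conj_mem_Rn by blast
  qed
qed

end

section \<open>Pointwise limits of harmonic polynomials\<close>

text \<open>
  Weights that differentiate every polynomial of degree at most $k$ at $0$ from its values at
  $0, \dots, k$: the derivatives at $0$ of the Lagrange basis polynomials. It suffices to check
  monomials.
\<close>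

lemma derivative_weights_exist:
  "\<exists>\<mu> :: nat \<Rightarrow> real. \<forall>i\<le>k. (\<Sum>m\<le>k. \<mu> m * real m ^ i) = (if i = 1 then 1 else 0)"
proof -
  define P where "P m = (\<Prod>j\<in>{..k} - {m}. [:- real j, 1:])" for m :: nat
  define L where "L m = smult (1 / poly (P m) (real m)) (P m)" for m
  have nz: "poly (P m) (real m) \<noteq> 0" for m
    unfolding P_def poly_prod by (subst prod_zero_iff) auto
  have L: "poly (L m) (real l) = (if l = m then 1 else 0)" if "l \<le> k" for l m
  proof (cases "l = m")
    case False
    have "poly (P m) (real l) = 0"
      unfolding P_def poly_prod using that False by (subst prod_zero_iff) auto
    with False show ?thesis by (simp add: L_def)
  qed (simp add: L_def nz)
  have deg: "degree (L m) \<le> k" if "m \<le> k" for m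
  proof -
    have "degree (P m) \<le> (\<Sum>j\<in>{..k} - {m}. degree [:- real j, 1:])"
      unfolding P_def using degree_prod_sum_le [of "{..k} - {m}" "\<lambda>j. [:- real j, 1:]"]
      by (simp add: o_def)
    also have "\<dots> \<le> k" using that by simp
    finally show ?thesis
      unfolding L_def using degree_smult_le le_trans by blast
  qed
  have mono: "(\<Sum>m\<le>k. smult (real m ^ i) (L m)) = monom 1 i" if "i \<le> k" for i
  proof (rule poly_eqI_degree)
    show "poly (\<Sum>m\<le>k. smult (real m ^ i) (L m)) x = poly (monom 1 i) x" if "x \<in> real ` {..k}" for x
    proof -
      obtain l where l: "l \<le> k" "x = real l" using \<open>x \<in> _\<close> by auto
      have "poly (\<Sum>m\<le>k. smult (real m ^ i) (L m)) x = (\<Sum>m\<le>k. if m = l then real l ^ i else 0)"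
        unfolding poly_sum l(2) by (intro sum.cong refl) (auto simp: L [OF l(1)])
      then show ?thesis using l by (simp add: poly_monom)
    qed
    have card: "card (real ` {..k}) = Suc k"
      by (subst card_image) (auto intro: inj_onI)
    show "degree (\<Sum>m\<le>k. smult (real m ^ i) (L m)) < card (real ` {..k})"
      unfolding card less_Suc_eq_le
      by (rule degree_sum_le [OF finite_atMost])
        (rule order.trans [OF degree_smult_le], simp add: deg)
    show "degree (monom (1::real) i) < card (real ` {..k})"
      unfolding card less_Suc_eq_le using that by (simp add: degree_monom_eq)
  qed
  have "(\<Sum>m\<le>k. poly (pderiv (L m)) 0 * real m ^ i) = (if i = 1 then 1 else 0)" if "i \<le> k" for i
  proof -
    have "(\<Sum>m\<le>k. poly (pderiv (L m)) 0 * real m ^ i) = poly (pderiv (\<Sum>m\<le>k. smult (real m ^ i) (L m))) 0"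
      by (simp add: higher_pderiv_sum [of 1, simplified] pderiv_smult poly_sum mult.commute)
    also have "\<dots> = (if i = 1 then 1 else 0)"
      unfolding mono [OF that] by (auto simp: pderiv_monom poly_monom power_0_left)
    finally show ?thesis .
  qed
  then show ?thesis by (intro exI [of _ "\<lambda>m. poly (pderiv (L m)) 0"] allI impI)
qed

text \<open>
  The derivative along the line is the restriction of a homogeneous polynomial of smaller degree, so an
  induction on the degree integrates it.
\<close>

lemma hom_polys_along_line:
  assumes H: "subspace H" and p: "p \<in> hom_polys H k" and w: "w \<in> H" and b: "b \<in> H"
  shows "\<exists>c. \<forall>t. p (w + t *\<^sub>R b) = (\<Sum>i\<le>k. t ^ i *\<^sub>R c i)"
  using p
proof (induction k arbitrary: p)
  case 0
  have "p (w + t *\<^sub>R b) = p 0" for t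
    using hom_polysD(2) [OF 0, of "w + t *\<^sub>R b" 0] H w b by (simp add: subspace_add subspace_scale)
  then show ?case
    by (intro exI [of _ "\<lambda>_. p 0"]) simp
next
  case (Suc k)
  have "(\<lambda>v. dir_deriv p v b) \<in> hom_polys H k"
    by (rule hom_polys_dir_deriv [OF H Suc.prems b])
  from Suc.IH [OF this] obtain c where c: "\<And>t. dir_deriv p (w + t *\<^sub>R b) b = (\<Sum>i\<le>k. t ^ i *\<^sub>R c i)"
    by blast
  define h where "h t = p (w + t *\<^sub>R b) - (\<Sum>i\<le>k. (t ^ Suc i / real (Suc i)) *\<^sub>R c i)" for t
  have "(h has_vector_derivative 0) (at s within UNIV)" for s
  proof -
    have ws: "w + s *\<^sub>R b \<in> H" by (intro subspace_add subspace_scale H w b)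
    have "((\<lambda>t. p ((w + s *\<^sub>R b) + t *\<^sub>R b)) has_vector_derivative dir_deriv p (w + s *\<^sub>R b) b) (at (s - s))"
      using polynomial_on_dir_deriv(2) [OF H hom_polysD(1) [OF Suc.prems] b ws] by simp
    then have "(((\<lambda>t. p ((w + s *\<^sub>R b) + t *\<^sub>R b)) \<circ> (\<lambda>t. t - s)) has_vector_derivative
        1 *\<^sub>R dir_deriv p (w + s *\<^sub>R b) b) (at s)"
      by (intro vector_diff_chain_at) (auto simp: has_real_derivative_iff_has_vector_derivative [symmetric]
          intro!: derivative_eq_intros)
    then have 1: "((\<lambda>t. p (w + t *\<^sub>R b)) has_vector_derivative (\<Sum>i\<le>k. s ^ i *\<^sub>R c i)) (at s)"
      by (simp add: o_def c scaleR_diff_left)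
    have "((\<lambda>t. t ^ Suc i / real (Suc i)) has_real_derivative s ^ i) (at s)" for i
      using DERIV_cdivide [OF DERIV_power [OF DERIV_ident, of "Suc i"], of "real (Suc i)" s UNIV]
      by simp
    then have "((\<lambda>t. (t ^ Suc i / real (Suc i)) *\<^sub>R c i) has_vector_derivative s ^ i *\<^sub>R c i) (at s)" for i
      using has_vector_derivative_scaleR [OF _ has_vector_derivative_const,
          of "\<lambda>t. t ^ Suc i / real (Suc i)" "s ^ i" s UNIV "c i"] by simp
    then have 2: "((\<lambda>t. \<Sum>i\<le>k. (t ^ Suc i / real (Suc i)) *\<^sub>R c i) has_vector_derivative
        (\<Sum>i\<le>k. s ^ i *\<^sub>R c i)) (at s)"
      by (intro has_vector_derivative_sum)
    from has_vector_derivative_diff [OF 1 2] show ?thesis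
      by (simp add: h_def [abs_def])
  qed
  then obtain d where d: "\<And>t. h t = d"
    using has_vector_derivative_zero_constant [of UNIV h] by auto
  have "p (w + t *\<^sub>R b) = (\<Sum>i\<le>Suc k. t ^ i *\<^sub>R (case i of 0 \<Rightarrow> d | Suc j \<Rightarrow> (1 / real (Suc j)) *\<^sub>R c j))" for t
  proof -
    have "p (w + t *\<^sub>R b) = d + (\<Sum>i\<le>k. (t ^ Suc i / real (Suc i)) *\<^sub>R c i)"
      using d [of t] by (simp add: h_def algebra_simps)
    then show ?thesis
      unfolding sum.atMost_Suc_shift by simp
  qed
  then show ?case by blast
qed

lemma hom_polys_dir_deriv_weights:
  assumes \<mu>: "\<forall>i\<le>k. (\<Sum>m\<le>k. \<mu> m * real m ^ i) = (if i = 1 then 1 else 0)"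
    and H: "subspace H" and p: "p \<in> hom_polys H k" and w: "w \<in> H" and b: "b \<in> H"
  shows "dir_deriv p w b = (\<Sum>m\<le>k. \<mu> m *\<^sub>R p (w + real m *\<^sub>R b))"
proof -
  obtain c where c: "\<And>t. p (w + t *\<^sub>R b) = (\<Sum>i\<le>k. t ^ i *\<^sub>R c i)"
    using hom_polys_along_line [OF H p w b] by blast
  have "((\<lambda>t. t ^ i *\<^sub>R c i) has_vector_derivative (if i = 1 then 1 else 0) *\<^sub>R c i) (at 0)" for i
  proof -
    have "((\<lambda>t::real. t ^ i) has_real_derivative (if i = 1 then 1 else 0)) (at 0)"
      using DERIV_pow [of i 0 UNIV] by (cases i) (auto simp: power_0_left split: if_splits)
    then show ?thesis
      using has_vector_derivative_scaleR [OF _ has_vector_derivative_const,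
          of "\<lambda>t. t ^ i" "if i = 1 then 1 else 0" 0 UNIV "c i"] by simp
  qed
  then have "((\<lambda>t. \<Sum>i\<le>k. t ^ i *\<^sub>R c i) has_vector_derivative
      (\<Sum>i\<le>k. (if i = 1 then 1 else 0) *\<^sub>R c i)) (at 0)"
    by (intro has_vector_derivative_sum)
  then have "dir_deriv p w b = (\<Sum>i\<le>k. (if i = 1 then 1 else 0) *\<^sub>R c i)"
    by (intro dir_deriv_eqI) (simp only: c)
  also have "\<dots> = (\<Sum>i\<le>k. (\<Sum>m\<le>k. \<mu> m * real m ^ i) *\<^sub>R c i)"
    by (intro sum.cong refl) (simp only: \<mu> atMost_iff)
  also have "\<dots> = (\<Sum>i\<le>k. \<Sum>m\<le>k. \<mu> m *\<^sub>R real m ^ i *\<^sub>R c i)"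
    by (simp only: scaleR_sum_left scaleR_scaleR)
  also have "\<dots> = (\<Sum>m\<le>k. \<Sum>i\<le>k. \<mu> m *\<^sub>R real m ^ i *\<^sub>R c i)"
    by (rule sum.swap)
  also have "\<dots> = (\<Sum>m\<le>k. \<mu> m *\<^sub>R p (w + real m *\<^sub>R b))"
    by (simp only: scaleR_sum_right c)
  finally show ?thesis .
qed

text \<open>
  By induction on $k$. The weights express directional derivatives by finitely many values, so they
  converge too, and their limits are homogeneous polynomials of degree $k - 1$. Euler's identity then
  exhibits the limit of the polynomials themselves as a homogeneous polynomial of degree $k$.
\<close>

lemma hom_polys_pointwise_limit:
  fixes p :: "'i \<Rightarrow> ('m::{finite,linorder}) cl \<Rightarrow> 'm cl"
  assumes H: "subspace H" and F: "F \<noteq> bot"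
    and ev: "\<forall>\<^sub>F t in F. p t \<in> hom_polys H k"
    and lim: "\<forall>u\<in>H. ((\<lambda>t. p t u) \<longlongrightarrow> q u) F"
  shows "q \<in> hom_polys H k"
    and "\<And>u b. u \<in> H \<Longrightarrow> b \<in> H \<Longrightarrow> ((\<lambda>t. dir_deriv (p t) u b) \<longlongrightarrow> dir_deriv q u b) F"
proof -
  have diff: "\<exists>\<mu>. (\<forall>i\<le>k. (\<Sum>m\<le>k. \<mu> m * real m ^ i) = (if i = 1 then 1 else 0)) \<and>
    (\<forall>u b. u \<in> H \<longrightarrow> b \<in> H \<longrightarrow>
      ((\<lambda>t. dir_deriv (p t) u b) \<longlongrightarrow> (\<Sum>m\<le>k. \<mu> m *\<^sub>R q (u + real m *\<^sub>R b))) F)"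
    if ev: "\<forall>\<^sub>F t in F. p t \<in> hom_polys H k" and lim: "\<forall>u\<in>H. ((\<lambda>t. p t u) \<longlongrightarrow> q u) F"
    for k and p :: "'i \<Rightarrow> 'm cl \<Rightarrow> 'm cl" and q
  proof -
    obtain \<mu> :: "nat \<Rightarrow> real"
      where \<mu>: "\<forall>i\<le>k. (\<Sum>m\<le>k. \<mu> m * real m ^ i) = (if i = 1 then 1 else 0)"
      using derivative_weights_exist by blast
    have "((\<lambda>t. dir_deriv (p t) u b) \<longlongrightarrow> (\<Sum>m\<le>k. \<mu> m *\<^sub>R q (u + real m *\<^sub>R b))) F"
      if "u \<in> H" "b \<in> H" for u b
    proof (rule Lim_transform_eventually)
      show "((\<lambda>t. \<Sum>m\<le>k. \<mu> m *\<^sub>R p t (u + real m *\<^sub>R b)) \<longlongrightarrow> (\<Sum>m\<le>k. \<mu> m *\<^sub>R q (u + real m *\<^sub>R b))) F"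
        by (intro tendsto_sum tendsto_scaleR tendsto_const bspec [OF lim] subspace_add subspace_scale H that)
      show "\<forall>\<^sub>F t in F. (\<Sum>m\<le>k. \<mu> m *\<^sub>R p t (u + real m *\<^sub>R b)) = dir_deriv (p t) u b"
        using ev by eventually_elim (rule hom_polys_dir_deriv_weights [OF \<mu> H _ that, symmetric])
    qed
    with \<mu> show ?thesis by (intro exI [of _ \<mu>] conjI allI impI) simp_all
  qed
  have closed: "q \<in> hom_polys H k"
    if "\<forall>\<^sub>F t in F. p t \<in> hom_polys H k" "\<forall>u\<in>H. ((\<lambda>t. p t u) \<longlongrightarrow> q u) F"
    for k and p :: "'i \<Rightarrow> 'm cl \<Rightarrow> 'm cl" and q
    using that
  proof (induction k arbitrary: p q)
    case 0
    have const: "q u = q 0" if u: "u \<in> H" for u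
    proof (rule tendsto_unique [OF F bspec [OF 0(2) u]])
      show "((\<lambda>t. p t u) \<longlongrightarrow> q 0) F"
      proof (rule Lim_transform_eventually [OF bspec [OF 0(2) subspace_0 [OF H]]])
        show "\<forall>\<^sub>F t in F. p t 0 = p t u"
          using 0(1)
        proof eventually_elim
          case (elim t)
          from hom_polysD(2) [OF elim u, of 0] show ?case by simp
        qed
      qed
    qed
    have "(\<lambda>_. q 0) \<in> hom_polys H 0"
      by (rule hom_polysI) auto
    then show ?case
      by (rule hom_polys_cong [OF H _ const])
  next
    case (Suc k)
    define B where "B = onb H"
    have B: "orthonormal_basis B H" unfolding B_def by (rule orthonormal_basis_onb [OF H])
    obtain \<mu> where "\<forall>u b. u \<in> H \<longrightarrow> b \<in> H \<longrightarrow>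
        ((\<lambda>t. dir_deriv (p t) u b) \<longlongrightarrow> (\<Sum>m\<le>Suc k. \<mu> m *\<^sub>R q (u + real m *\<^sub>R b))) F"
      using diff [OF Suc.prems] by (elim exE conjE) (rule that)
    then have dlim: "((\<lambda>t. dir_deriv (p t) u b) \<longlongrightarrow> (\<Sum>m\<le>Suc k. \<mu> m *\<^sub>R q (u + real m *\<^sub>R b))) F"
      if "u \<in> H" "b \<in> H" for u b
      using that by iprover
    define q' where "q' b u = (\<Sum>m\<le>Suc k. \<mu> m *\<^sub>R q (u + real m *\<^sub>R b))" for u b
    have q': "q' b \<in> hom_polys H k" if b: "b \<in> H" for b
    proof (rule Suc.IH)
      show "\<forall>\<^sub>F t in F. (\<lambda>u. dir_deriv (p t) u b) \<in> hom_polys H k"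
        using Suc.prems(1) by eventually_elim (rule hom_polys_dir_deriv [OF H _ b])
      show "\<forall>u\<in>H. ((\<lambda>t. dir_deriv (p t) u b) \<longlongrightarrow> q' b u) F"
        unfolding q'_def by (rule ballI) (rule dlim [OF _ b])
    qed
    \<comment> \<open>the candidate for the limit given by Euler's identity\<close>
    define Q where "Q u = (1 / real (Suc k)) *\<^sub>R (\<Sum>b\<in>B. (u \<bullet> b) *\<^sub>R q' b u)" for u
    have "Q \<in> hom_polys H (Suc k)"
      unfolding Q_def
    proof (rule hom_polys_scaleR, rule hom_polys_sum [OF orthonormal_basis_finite [OF B]])
      fix b assume "b \<in> B"
      note q'b = q' [OF orthonormal_basis_subset [OF B this]]
      show "(\<lambda>u. (u \<bullet> b) *\<^sub>R q' b u) \<in> hom_polys H (Suc k)"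
      proof (rule hom_polysI)
        have "polynomial_on H (\<lambda>u. u \<bullet> b)"
          by (rule polynomial_onI [OF polynomial_function_inner [OF polynomial_function_id]]) (rule refl)
        then show "polynomial_on H (\<lambda>u. (u \<bullet> b) *\<^sub>R q' b u)"
          by (rule polynomial_on_scaleR) (rule hom_polysD(1) [OF q'b])
        fix u t assume "u \<in> H"
        from hom_polysD(2) [OF q'b this, of t]
        show "(t *\<^sub>R u \<bullet> b) *\<^sub>R q' b (t *\<^sub>R u) = t ^ Suc k *\<^sub>R (u \<bullet> b) *\<^sub>R q' b u"
          by (simp add: mult_ac)
      qed
    qed
    moreover have "q u = Q u" if u: "u \<in> H" for u
    proof (rule tendsto_unique [OF F bspec [OF Suc.prems(2) u]])
      show "((\<lambda>t. p t u) \<longlongrightarrow> Q u) F"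
      proof (rule Lim_transform_eventually)
        show "((\<lambda>t. (1 / real (Suc k)) *\<^sub>R (\<Sum>b\<in>B. (u \<bullet> b) *\<^sub>R dir_deriv (p t) u b)) \<longlongrightarrow> Q u) F"
          unfolding Q_def q'_def
          by (rule tendsto_scaleR [OF tendsto_const], rule tendsto_sum,
              rule tendsto_scaleR [OF tendsto_const], rule dlim [OF u],
              rule orthonormal_basis_subset [OF B])
        show "\<forall>\<^sub>F t in F. (1 / real (Suc k)) *\<^sub>R (\<Sum>b\<in>B. (u \<bullet> b) *\<^sub>R dir_deriv (p t) u b) = p t u"
          using Suc.prems(1)
        proof eventually_elim
          case (elim t)
          show ?case unfolding euler_identity [OF B elim u] by simp
        qed
      qed
    qed
    ultimately show ?case
      by (rule hom_polys_cong [OF H])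
  qed
  show q: "q \<in> hom_polys H k"
    by (rule closed [OF ev lim])
  fix u b assume ub: "u \<in> H" "b \<in> H"
  obtain \<mu> where \<mu>: "\<forall>i\<le>k. (\<Sum>m\<le>k. \<mu> m * real m ^ i) = (if i = 1 then 1 else 0)"
    and dlim: "\<forall>u b. u \<in> H \<longrightarrow> b \<in> H \<longrightarrow>
      ((\<lambda>t. dir_deriv (p t) u b) \<longlongrightarrow> (\<Sum>m\<le>k. \<mu> m *\<^sub>R q (u + real m *\<^sub>R b))) F"
    using diff [OF ev lim] by (elim exE conjE) (rule that)
  from dlim ub show "((\<lambda>t. dir_deriv (p t) u b) \<longlongrightarrow> dir_deriv q u b) F"
    unfolding hom_polys_dir_deriv_weights [OF \<mu> H q ub] by iprover
qed

lemma harmonics_pointwise_limit: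
  fixes p :: "'i \<Rightarrow> ('m::{finite,linorder}) cl \<Rightarrow> 'm cl"
  assumes H: "subspace H" and F: "F \<noteq> bot"
    and ev: "\<forall>\<^sub>F t in F. p t \<in> harmonics H k" and lim: "\<forall>u\<in>H. ((\<lambda>t. p t u) \<longlongrightarrow> q u) F"
  shows "q \<in> harmonics H k"
proof -
  have evh: "\<forall>\<^sub>F t in F. p t \<in> hom_polys H k"
    using ev by eventually_elim (simp add: harmonics_def)
  have q: "q \<in> hom_polys H k"
    by (rule hom_polys_pointwise_limit(1) [OF H F evh lim])
  have dq: "((\<lambda>t. dir_deriv (p t) u b) \<longlongrightarrow> dir_deriv q u b) F" if "u \<in> H" "b \<in> H" for u b
    by (rule hom_polys_pointwise_limit(2) [OF H F evh lim that(1) that(2)])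
  have "(\<Sum>b\<in>onb H. dir_deriv (\<lambda>v. dir_deriv q v b) w b) = 0" if w: "w \<in> H" for w
  proof (rule tendsto_unique [OF F])
    show "((\<lambda>t. \<Sum>b\<in>onb H. dir_deriv (\<lambda>v. dir_deriv (p t) v b) w b)
      \<longlongrightarrow> (\<Sum>b\<in>onb H. dir_deriv (\<lambda>v. dir_deriv q v b) w b)) F"
    proof (rule tendsto_sum)
      fix b assume "b \<in> onb H"
      then have b: "b \<in> H" using onb_subset [OF H] by blast
      have "\<exists>j. \<forall>\<^sub>F t in F. (\<lambda>v. dir_deriv (p t) v b) \<in> hom_polys H j"
      proof (cases k)
        case 0
        have "\<forall>\<^sub>F t in F. (\<lambda>v. dir_deriv (p t) v b) \<in> hom_polys H 0"
          using evh
        proof eventually_elim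
          case (elim t)
          have "(\<lambda>_. 0) \<in> hom_polys H 0"
            by (rule hom_polysI) auto
          then show ?case
            by (rule hom_polys_cong [OF H]) (rule hom_polys_0_dir_deriv [OF H elim [unfolded 0] _ b])
        qed
        then show ?thesis by (rule exI)
      next
        case (Suc j)
        have "\<forall>\<^sub>F t in F. (\<lambda>v. dir_deriv (p t) v b) \<in> hom_polys H j"
          using evh unfolding Suc by eventually_elim (rule hom_polys_dir_deriv [OF H _ b])
        then show ?thesis by (rule exI)
      qed
      then obtain j where "\<forall>\<^sub>F t in F. (\<lambda>v. dir_deriv (p t) v b) \<in> hom_polys H j"
        by (rule exE)
      then show "((\<lambda>t. dir_deriv (\<lambda>v. dir_deriv (p t) v b) w b) \<longlongrightarrow> dir_deriv (\<lambda>v. dir_deriv q v b) w b) F"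
        by (rule hom_polys_pointwise_limit(2) [OF H F _ _ w b]) (rule ballI, rule dq [OF _ b])
    qed
    show "((\<lambda>t. \<Sum>b\<in>onb H. dir_deriv (\<lambda>v. dir_deriv (p t) v b) w b) \<longlongrightarrow> 0) F"
      by (rule tendsto_eventually) (use ev in eventually_elim, use w in \<open>simp add: harmonics_def\<close>)
  qed
  with q show ?thesis
    by (simp add: harmonics_def)
qed

text \<open>
  The derivative in the parameter $x$ is, at each $u$, the limit of difference quotients that are
  harmonic in $u$.
\<close>

lemma harmonics_dirac_parameter:
  fixes f :: "('m::{finite,linorder}) cl \<Rightarrow> 'm cl \<Rightarrow> 'm cl"
  assumes H: "subspace H" "H \<subseteq> vecs" and B: "finite B" "\<And>b. b \<in> B \<Longrightarrow> \<forall>\<^sub>F t in nhds 0. f (x + t *\<^sub>R b) \<in> harmonics H k"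
    and x: "f x \<in> harmonics H k"
    and d: "\<And>b u. b \<in> B \<Longrightarrow> u \<in> H \<Longrightarrow>
      ((\<lambda>t. f (x + t *\<^sub>R b) u) has_vector_derivative dir_deriv (\<lambda>y. f y u) x b) (at 0)"
  shows "(\<lambda>u. dirac B (\<lambda>y. f y u) x) \<in> harmonics H k"
proof -
  have zero: "(\<lambda>_. 0) \<in> harmonics H k"
    using harmonics_mult_left [OF H(1) x H(2), of 0] by simp
  have deriv: "(\<lambda>u. dir_deriv (\<lambda>y. f y u) x b) \<in> harmonics H k" if b: "b \<in> B" for b
  proof (rule harmonics_pointwise_limit [OF H(1) trivial_limit_at])
    have *: "\<forall>\<^sub>F t in at 0. f (x + t *\<^sub>R b) \<in> harmonics H k"
      using B(2) [OF b] eventually_nhds_conv_at by blast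
    show "\<forall>\<^sub>F t in at (0::real). (\<lambda>u. 0 + (1 / t) *\<^sub>R (f (x + t *\<^sub>R b) u + (- 1) *\<^sub>R f x u)) \<in> harmonics H k"
      using *
    proof eventually_elim
      case (elim t)
      show ?case
        by (rule harmonics_add_scaleR [OF H zero], rule harmonics_add_scaleR [OF H elim x])
    qed
    show "\<forall>u\<in>H. ((\<lambda>t. 0 + (1 / t) *\<^sub>R (f (x + t *\<^sub>R b) u + (- 1) *\<^sub>R f x u)) \<longlongrightarrow> dir_deriv (\<lambda>y. f y u) x b) (at 0)"
    proof
      fix u assume "u \<in> H"
      define D where "D = dir_deriv (\<lambda>y. f y u) x b"
      have "(\<lambda>t. norm (f (x + t *\<^sub>R b) u - f x u - t *\<^sub>R D) / \<bar>t\<bar>) \<midarrow>0\<rightarrow> 0"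
        using d [OF b \<open>u \<in> H\<close>] by (simp add: has_vector_derivative_def has_derivative_at D_def)
      then have "(\<lambda>t. norm ((1 / t) *\<^sub>R (f (x + t *\<^sub>R b) u - f x u) - D)) \<midarrow>0\<rightarrow> 0"
      proof (rule Lim_transform_eventually)
        have eq: "norm (v - t *\<^sub>R D) / \<bar>t\<bar> = norm ((1 / t) *\<^sub>R v - D)" if "t \<noteq> 0" for t v
        proof -
          have "v - t *\<^sub>R D = t *\<^sub>R ((1 / t) *\<^sub>R v - D)"
            using that by (simp add: scaleR_diff_right)
          then show ?thesis
            using that by (simp only: norm_scaleR) simp
        qed
        show "\<forall>\<^sub>F t in at 0. norm (f (x + t *\<^sub>R b) u - f x u - t *\<^sub>R D) / \<bar>t\<bar> =
            norm ((1 / t) *\<^sub>R (f (x + t *\<^sub>R b) u - f x u) - D)"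
          unfolding eventually_at_filter by (intro always_eventually allI impI eq)
      qed
      then have "(\<lambda>t. (1 / t) *\<^sub>R (f (x + t *\<^sub>R b) u - f x u) - D) \<midarrow>0\<rightarrow> 0"
        by (rule tendsto_norm_zero_cancel)
      then show "((\<lambda>t. 0 + (1 / t) *\<^sub>R (f (x + t *\<^sub>R b) u + (- 1) *\<^sub>R f x u)) \<longlongrightarrow> dir_deriv (\<lambda>y. f y u) x b) (at 0)"
        unfolding D_def [symmetric] by (simp add: Lim_null [symmetric])
    qed
  qed
  show ?thesis
    unfolding dirac_def using B(1) deriv
  proof (induction B)
    case (insert b B)
    have 1: "(\<lambda>u. b * dir_deriv (\<lambda>y. f y u) x b) \<in> harmonics H k"
      by (rule harmonics_mult_left [OF H(1) insert.prems H(2)]) simp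
    have "(\<lambda>u. \<Sum>\<epsilon>\<in>B. \<epsilon> * dir_deriv (\<lambda>y. f y u) x \<epsilon>) \<in> harmonics H k"
      by (rule insert.IH) (rule insert.prems, simp)
    from harmonics_add_scaleR [OF H 1 this, of 1] show ?case
      using insert.hyps by simp
  qed (simp add: zero)
qed

section \<open>The Cayley transformation\<close>

lemma range_cl_e: "range (cl_e :: 'm::{finite,linorder} \<Rightarrow> 'm cl) = insert cl_last (cl_e ` {..<Max UNIV})"
proof -
  have "(UNIV :: 'm set) = insert (Max UNIV) {..<Max UNIV}"
    by (auto simp: less_le)
  then show ?thesis
    unfolding cl_last_def by (metis image_insert)
qed

lemma cl_last_notin: "cl_last \<notin> cl_e ` {..<Max UNIV}"
  unfolding cl_last_def using inj_cl_e by (auto dest: injD)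

lemma card_cl_e_Rn: "card (cl_e ` {..<Max (UNIV :: 'm::{finite,linorder} set)}) = CARD('m) - 1"
proof -
  have "card (range (cl_e :: 'm \<Rightarrow> 'm cl)) = Suc (card (cl_e ` {..<Max (UNIV :: 'm set)}))"
    unfolding range_cl_e by (intro card_insert_disjoint cl_last_notin) simp
  then show ?thesis
    by (simp add: card_image [OF inj_cl_e])
qed

lemma dim_Rn: "dim (Rn :: ('m::{finite,linorder}) cl set) = CARD('m) - 1"
  using orthonormal_basis_card [OF orthonormal_basis_Rn] card_cl_e_Rn by metis

lemma vecs_orthogonal_last_in_Rn:
  assumes "v \<in> vecs" "v \<bullet> cl_last = 0"
  shows "v \<in> Rn"
proof -
  have "v = (\<Sum>b\<in>range cl_e. (v \<bullet> b) *\<^sub>R b)"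
    by (rule orthonormal_basis_expansion [OF orthonormal_basis_vecs assms(1), symmetric])
  also have "\<dots> = (\<Sum>b\<in>cl_e ` {..<Max UNIV}. (v \<bullet> b) *\<^sub>R b)"
    unfolding range_cl_e by (subst sum.insert) (simp_all add: cl_last_notin assms(2))
  finally have "v = (\<Sum>b\<in>cl_e ` {..<Max UNIV}. (v \<bullet> b) *\<^sub>R b)" .
  moreover have "(\<Sum>b\<in>cl_e ` {..<Max UNIV}. (v \<bullet> b) *\<^sub>R b) \<in> Rn"
    unfolding Rn_def by (intro span_sum span_scale span_base)
  ultimately show ?thesis by metis
qed

lemma Rn_plus_last:
  assumes "x \<in> Rn"
  shows "x + cl_last \<in> vecs" "(norm (x + cl_last))\<^sup>2 = (norm x)\<^sup>2 + 1" "x + cl_last \<noteq> 0"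
    "(x + cl_last) \<bullet> cl_last = 1"
proof -
  have e: "cl_last \<bullet> cl_last = 1" "x \<bullet> cl_last = 0" "cl_last \<bullet> x = 0"
    using norm_cl_last Rn_inner_last [OF assms] by (simp_all add: dot_square_norm inner_commute)
  show "x + cl_last \<in> vecs"
    using assms Rn_subset_vecs by (intro subspace_add subspace_vecs) auto
  show 1: "(x + cl_last) \<bullet> cl_last = 1"
    by (simp add: inner_add_left e)
  show "(norm (x + cl_last))\<^sup>2 = (norm x)\<^sup>2 + 1"
    by (simp add: power2_norm_eq_inner inner_add_left inner_add_right e)
  show "x + cl_last \<noteq> 0"
    using 1 by (metis inner_zero_left zero_neq_one)
qed

lemma unit_vector:
  assumes "z \<in> vecs" "z \<noteq> 0"
  shows "z /\<^sub>R norm z \<in> vecs" "norm (z /\<^sub>R norm z) = 1"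
  using assms by (simp_all add: subspace_scale subspace_vecs)

text \<open>inversion\<close>

definition inversion_last :: "('m::{finite,linorder}) cl \<Rightarrow> 'm cl" where
  "inversion_last x = cl_last - (2 / (norm (x + cl_last))\<^sup>2) *\<^sub>R (x + cl_last)"

text \<open>
  The Cayley transformation is minus the inversion in the sphere of radius $\sqrt 2$ about $-e$: as $xe = -ex$,
  one finds $(ex + 1) z = 2z - \|z\|^2 e$.
\<close>

lemma cayley_eq:
  assumes x: "x \<in> Rn"
  shows "cayley x = cl_last - (2 / (norm (x + cl_last))\<^sup>2) *\<^sub>R (x + (cl_last :: ('m::{finite,linorder}) cl))"
proof -
  define e :: "'m cl" where "e = cl_last"
  define z where "z = x + e"
  define N where "N = (norm z)\<^sup>2"
  have e: "e \<in> vecs" "e * e = -1"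
    unfolding e_def using unit_square [OF cl_last_in_vecs norm_cl_last] by simp_all
  have xv: "x \<in> vecs" using x Rn_subset_vecs by blast
  have xe: "x * e = - (e * x)"
    using vecs_anticommute [OF xv e(1)] Rn_inner_last [OF x] by (simp add: e_def eq_neg_iff_add_eq_0)
  have zv: "z \<in> vecs" "z \<noteq> 0" unfolding z_def e_def using Rn_plus_last [OF x] by auto
  have N: "N = (norm x)\<^sup>2 + 1" "N \<noteq> 0"
    using zv(2) Rn_plus_last(2) [OF x] unfolding N_def z_def e_def by auto
  have xx: "x * x = - (norm x)\<^sup>2 *\<^sub>R 1" by (rule vecs_square [OF xv])
  have exe: "e * x * e = x"
    by (simp add: mult.assoc xe) (simp add: mult.assoc [symmetric] e(2))
  have "(e * x + 1) * z = e * (x * x) + e * x * e + x + e"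
    by (simp add: z_def algebra_simps)
  also have "\<dots> = 2 *\<^sub>R z - N *\<^sub>R e"
    unfolding exe xx by (simp add: z_def N(1) scaleR_2 algebra_simps)
  finally have "(e * x + 1) * z = 2 *\<^sub>R z - N *\<^sub>R e" .
  then have "cayley x = - ((2 *\<^sub>R z - N *\<^sub>R e) /\<^sub>R N)"
    unfolding cayley_def cl_inv_vec [OF zv, unfolded z_def e_def]
    by (simp add: z_def e_def N_def)
  also have "\<dots> = e - (2 / N) *\<^sub>R z"
    using N(2) by (simp add: scaleR_diff_right divide_inverse mult.commute)
  finally show ?thesis
    unfolding z_def e_def N_def .
qed

lemma cayley_inv_eq:
  assumes y: "y \<in> vecs" "norm y = 1" "y \<noteq> cl_last"
  shows "cayley_inv y = - cl_last - (2 / (norm (y - cl_last))\<^sup>2) *\<^sub>R (y - (cl_last :: ('m::{finite,linorder}) cl))"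
proof -
  define e :: "'m cl" where "e = cl_last"
  define z where "z = y - e"
  define N where "N = (norm z)\<^sup>2"
  have e: "e \<in> vecs" "norm e = 1" "e * e = -1" "e \<bullet> e = 1"
    unfolding e_def using unit_square [OF cl_last_in_vecs norm_cl_last] by (simp_all add: dot_square_norm)
  have zv: "z \<in> vecs" "z \<noteq> 0" unfolding z_def e_def using y by (auto intro!: subspace_diff subspace_vecs)
  have yy: "y * y = - 1" by (rule unit_square [OF y(1,2)])
  have yy': "y \<bullet> y = 1" using y(2) by (simp add: dot_square_norm)
  have N: "N = 2 - 2 * (e \<bullet> y)"
    unfolding N_def power2_norm_eq_inner z_def
    by (simp add: inner_diff_left inner_diff_right inner_commute [of y e] e(4) yy')
  have N0: "N \<noteq> 0"
    using zv(2) by (simp add: N_def)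
  have eye: "e * y * e = y - (2 * (e \<bullet> y)) *\<^sub>R e"
    by (rule unit_conj_reflection [OF e(1,2) y(1)])
  have "(- e * y + 1) * z = - (e * (y * y)) + e * y * e + y - e"
    by (simp add: z_def algebra_simps)
  also have "\<dots> = 2 *\<^sub>R z + N *\<^sub>R e"
    unfolding eye yy by (simp add: z_def N scaleR_2 algebra_simps)
  finally have "(- e * y + 1) * z = 2 *\<^sub>R z + N *\<^sub>R e" .
  then have "cayley_inv y = - ((2 *\<^sub>R z + N *\<^sub>R e) /\<^sub>R N)"
    unfolding cayley_inv_def cl_inv_vec [OF zv, unfolded z_def e_def]
    by (simp add: z_def e_def N_def)
  also have "\<dots> = - e - (2 / N) *\<^sub>R z"
    using N0 by (simp add: scaleR_add_right divide_inverse mult.commute)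
  finally show ?thesis
    unfolding z_def e_def N_def .
qed

text \<open>
  The formula of \<open>cayley_eq\<close> is the reflection of $e$ along $a$, as $z \cdot e = 1$.
\<close>

lemma cayley_conj:
  assumes x: "x \<in> Rn" and a: "a = (x + cl_last) /\<^sub>R norm (x + cl_last)"
  shows "cayley x = a * cl_last * a"
proof -
  note z = Rn_plus_last [OF x]
  have "a * cl_last * a = cl_last - (2 * (a \<bullet> cl_last)) *\<^sub>R a"
    unfolding a by (rule unit_conj_reflection [OF unit_vector [OF z(1,3)] cl_last_in_vecs])
  then show ?thesis
    unfolding cayley_eq [OF x] a by (simp add: z(4) divide_inverse power2_eq_square mult_ac)
qed

lemma cayley_sphere:
  assumes x: "x \<in> Rn"
  shows "cayley x \<in> vecs" "norm (cayley x) = 1" "cayley x \<noteq> cl_last"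
    "cayley x - cl_last = - ((2 / (norm (x + cl_last))\<^sup>2) *\<^sub>R (x + cl_last))"
    "norm (cayley x - cl_last) = 2 / norm (x + cl_last)"
proof -
  note z = Rn_plus_last [OF x]
  note a = unit_vector [OF z(1,3)]
  show "cayley x \<in> vecs"
    unfolding cayley_conj [OF x refl] by (rule unit_conj_in_vecs [OF a cl_last_in_vecs])
  show "norm (cayley x) = 1"
    unfolding cayley_conj [OF x refl] norm_eq_sqrt_inner [of "_ * _"]
      unit_conj_inner [OF a cl_last_in_vecs cl_last_in_vecs] by (simp add: dot_square_norm)
  show 1: "cayley x - cl_last = - ((2 / (norm (x + cl_last))\<^sup>2) *\<^sub>R (x + cl_last))"
    unfolding cayley_eq [OF x] by simp
  then show "cayley x \<noteq> cl_last"
    using z(3) by auto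
  show "norm (cayley x - cl_last) = 2 / norm (x + cl_last)"
    unfolding 1 using z(3) by (simp add: power2_eq_square)
qed

lemma cayley_inv_cayley:
  assumes x: "x \<in> Rn"
  shows "cayley_inv (cayley x) = x"
  using cayley_sphere(5) [OF x] Rn_plus_last(3) [OF x]
  unfolding cayley_inv_eq [OF cayley_sphere(1-3) [OF x]] cayley_sphere(4) [OF x]
  by (simp add: power_divide)

lemma cayley_inv_sphere:
  assumes y: "y \<in> vecs" "norm y = 1" "y \<noteq> cl_last"
  shows "cayley_inv y \<in> Rn" "cayley (cayley_inv y) = y"
proof -
  define N where "N = (norm (y - cl_last))\<^sup>2"
  have N0: "N \<noteq> 0" using y(3) by (simp add: N_def)
  have N: "N = 2 - 2 * (y \<bullet> cl_last)"
    unfolding N_def using y(2)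
    by (simp add: power2_norm_eq_inner inner_diff_left inner_diff_right inner_commute)
      (simp add: dot_square_norm)
  have inv: "cayley_inv y = - cl_last - (2 / N) *\<^sub>R (y - cl_last)"
    unfolding N_def by (rule cayley_inv_eq [OF y])
  show R: "cayley_inv y \<in> Rn"
  proof (rule vecs_orthogonal_last_in_Rn)
    show "cayley_inv y \<in> vecs"
      unfolding inv
      by (intro subspace_diff subspace_neg subspace_scale subspace_vecs y cl_last_in_vecs)
    have "cayley_inv y \<bullet> cl_last = - 1 - (2 / N) * (y \<bullet> cl_last - 1)"
      unfolding inv by (simp add: inner_diff_left) (simp add: dot_square_norm)
    also have "\<dots> = 0" using N0 by (simp add: N field_simps)
    finally show "cayley_inv y \<bullet> cl_last = 0" .
  qed
  have z: "cayley_inv y + cl_last = - ((2 / N) *\<^sub>R (y - cl_last))"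
    unfolding inv by simp
  have "(norm (cayley_inv y + cl_last))\<^sup>2 = (2 / N)\<^sup>2 * N"
    unfolding z norm_minus_cancel norm_scaleR power_mult_distrib by (simp add: N_def)
  then have "2 / (norm (cayley_inv y + cl_last))\<^sup>2 = N / 2"
    using N0 by (simp add: power2_eq_square)
  then show "cayley (cayley_inv y) = y"
    unfolding cayley_eq [OF R] z using N0 by simp
qed

text \<open>
  $C(x) - e$ is a negative multiple of $z$, so the product is a multiple of $-z^2 = \|z\|^2$ in which the powers of
  $\|z\|$ cancel.
\<close>

lemma J_cayley_mult_J_cayley_inv:
  fixes x :: "('m::{finite,linorder}) cl"
  assumes x: "x \<in> Rn"
  shows "J_cayley x * J_cayley_inv (cayley x) = (2 / 2 ^ (CARD('m) - 1)) *\<^sub>R 1"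
proof -
  define z where "z = x + cl_last"
  have z: "z \<in> vecs" "norm z \<noteq> 0" using Rn_plus_last [OF x] by (auto simp: z_def)
  have "J_cayley x * J_cayley_inv (cayley x) =
      ((1 / norm z ^ (CARD('m) - 1)) * (norm z ^ (CARD('m) - 1) / 2 ^ (CARD('m) - 1)) * (2 / (norm z)\<^sup>2)) *\<^sub>R (- (z * z))"
    unfolding J_cayley_def J_cayley_inv_def cayley_sphere(5) [OF x]
    unfolding cayley_sphere(4) [OF x] z_def [symmetric]
    by (simp add: power_divide divide_inverse power_inverse mult_ac)
  also have "- (z * z) = (norm z)\<^sup>2 *\<^sub>R 1"
    unfolding vecs_square [OF z(1)] by simp
  finally show ?thesis
    using z(2) by simp
qed

section \<open>The spherical Dirac operator\<close>

text \<open>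
  The differential of the radial retraction onto the sphere is the orthogonal projection onto the
  tangent space.
\<close>

lemma sgn_has_derivative:
  fixes y :: "'a::real_inner"
  assumes "norm y = 1"
  shows "(sgn has_derivative (\<lambda>w. w - (w \<bullet> y) *\<^sub>R y)) (at y)"
proof -
  have "((\<lambda>v. inverse (norm v) *\<^sub>R v) has_derivative (\<lambda>w. w - (w \<bullet> y) *\<^sub>R y)) (at y)"
  proof -
    have "y \<noteq> 0" using assms by auto
    then have n: "(norm has_derivative (\<lambda>w. w \<bullet> y)) (at y)"
      using has_derivative_norm [of y] assms by (simp add: sgn_div_norm)
    have "((\<lambda>v. inverse (norm v)) has_derivative (\<lambda>w. - (w \<bullet> y))) (at y)"
      using Deriv.has_derivative_inverse [OF _ n] assms by simp
    from has_derivative_scaleR [OF this has_derivative_ident] show ?thesis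
      using assms by simp
  qed
  then show ?thesis
    by (simp add: sgn_div_norm [abs_def])
qed

text \<open>
  The operator is minus the tangential Dirac operator plus $\frac n2 y$. The sum over $i < j$ is half of the
  double sum over all $i, j$; with $T$ the derivative in the direction of the tangential part, anticommuting
  $e_i e_j$ in one half turns the double sum into $2 y \sum_j e_j T(e_j)$ and a multiple of $T(y) = 0$. Multiplication
  by $y$ from the left then gives the sign.
\<close>

lemma dirac_Sn_eq:
  fixes g h :: "('m::{finite,linorder}) cl \<Rightarrow> 'm cl"
  assumes y: "y \<in> vecs" "norm y = 1" and h: "(h has_derivative h') (at y)"
    and ext: "\<forall>\<^sub>F q in nhds y. q \<in> vecs \<and> norm q = 1 \<longrightarrow> g q = h q"
  shows "dirac_Sn g y = (real (CARD('m) - 1) / 2) *\<^sub>R (y * h y)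
    - (\<Sum>b\<in>range cl_e. b * h' (b - (b \<bullet> y) *\<^sub>R y))"
proof -
  define T where "T v = h' (v - (v \<bullet> y) *\<^sub>R y)" for v
  have lin: "linear h'" using h by (rule has_derivative_linear)
  have "linear (\<lambda>v. v - (v \<bullet> y) *\<^sub>R y)"
    by (rule linearI) (simp_all add: algebra_simps inner_add_left)
  then have linT: "linear T"
    using linear_compose [OF _ lin] unfolding T_def o_def by blast
  have T0: "T y = 0"
    using y(2) linear_0 [OF lin] by (simp add: T_def dot_square_norm)
  have sy: "sgn y = y" using y(2) by (simp add: sgn_div_norm)
  have gy: "g y = h y"
    using eventually_nhds_x_imp_x [OF ext] y by blast
  have der: "dir_deriv (\<lambda>v. g (sgn v)) y b = T b" if b: "b \<in> vecs" for b
  proof (rule dir_deriv_eqI)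
    have "((\<lambda>v. h (sgn v)) has_derivative T) (at y)"
      unfolding T_def by (rule has_derivative_compose [OF sgn_has_derivative [OF y(2)]]) (simp add: sy h)
    then have 1: "((\<lambda>t. h (sgn (y + t *\<^sub>R b))) has_vector_derivative T b) (at 0)"
      by (rule has_vector_derivative_along)
    have "y \<noteq> 0" using y(2) by auto
    have c: "((\<lambda>t. y + t *\<^sub>R b) \<longlongrightarrow> y) (nhds 0)"
    proof -
      have "((\<lambda>t. y + t *\<^sub>R b) \<longlongrightarrow> y + 0 *\<^sub>R b) (nhds 0)"
        by (intro tendsto_add tendsto_const tendsto_scaleR filterlim_ident)
      then show ?thesis by simp
    qed
    have s: "((\<lambda>t. sgn (y + t *\<^sub>R b)) \<longlongrightarrow> y) (nhds 0)"
      using tendsto_sgn [OF c \<open>y \<noteq> 0\<close>] by (simp add: sy)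
    have ne: "\<forall>\<^sub>F t in nhds 0. y + t *\<^sub>R b \<noteq> 0"
      using tendsto_imp_eventually_ne [OF c \<open>y \<noteq> 0\<close>] .
    have ev: "\<forall>\<^sub>F t in nhds 0. h (sgn (y + t *\<^sub>R b)) = g (sgn (y + t *\<^sub>R b))"
      using ne eventually_compose_filterlim [OF ext s]
    proof eventually_elim
      case (elim t)
      have "sgn (y + t *\<^sub>R b) \<in> vecs"
        unfolding sgn_div_norm by (intro subspace_scale subspace_add subspace_vecs y b)
      with elim show ?case by (simp add: norm_sgn)
    qed
    show "((\<lambda>t. g (sgn (y + t *\<^sub>R b))) has_vector_derivative T b) (at 0)"
      using 1 ev eventually_nhds_x_imp_x [OF ev]
      by (subst has_vector_derivative_cong_ev [where g = "\<lambda>t. h (sgn (y + t *\<^sub>R b))"])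
        (auto elim: eventually_mono)
  qed
  define D where "D = (\<Sum>b\<in>range cl_e. b * T b)"
  define Y where "Y i = y \<bullet> cl_e i" for i
  define E where "E i = (cl_e i :: 'm cl)" for i
  define A where "A i j = E i * E j * (Y i *\<^sub>R T (E j) - Y j *\<^sub>R T (E i))" for i j
  have D: "D = (\<Sum>j\<in>UNIV. E j * T (E j))"
    unfolding D_def E_def by (simp add: sum.reindex [OF inj_cl_e])
  have Y: "(\<Sum>i\<in>UNIV. Y i *\<^sub>R E i) = y"
    using orthonormal_basis_expansion [OF orthonormal_basis_vecs y(1)]
    by (simp add: sum.reindex [OF inj_cl_e] Y_def E_def)
  \<comment> \<open>the factors $e_i e_j$ anticommute up to the diagonal term that produces $T(y)$\<close>
  have anti: "E i * E j = - (E j * E i) + (if i = j then (-2) *\<^sub>R 1 else 0)" for i j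
    using clifford_relations [of i j] unfolding E_def
    by (auto simp: eq_neg_iff_add_eq_0 scaleR_2 algebra_simps split: if_splits)
  have sym: "A j i = A i j" for i j
  proof (cases "i = j")
    case False
    then have "E j * E i = - (E i * E j)" using anti [of j i] by simp
    then show ?thesis unfolding A_def by (simp add: algebra_simps)
  qed simp
  have diag: "A i i = 0" for i by (simp add: A_def)
  have "Lambda g y = (\<Sum>(i, j) | i < j. A i j)"
    unfolding Lambda_def A_def E_def Y_def by (simp add: der)
  moreover have "(\<Sum>i\<in>UNIV. \<Sum>j\<in>UNIV. A i j) = 2 *\<^sub>R (\<Sum>(i, j) | i < j. A i j)"
  proof -
    have "(\<Sum>i\<in>UNIV. \<Sum>j\<in>UNIV. A i j) = (\<Sum>(i, j)\<in>UNIV. A i j)"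
      by (simp add: sum.cartesian_product)
    also have "UNIV = {(i, j :: 'm). i < j} \<union> ({(i, j). j < i} \<union> {(i, j). i = j})"
      by (auto simp: less_le not_less)
    also have "(\<Sum>(i, j)\<in>\<dots>. A i j) = (\<Sum>(i, j) | i < j. A i j) + ((\<Sum>(i, j) | j < i. A i j) + (\<Sum>(i, j) | i = j. A i j))"
      by (subst sum.union_disjoint, simp, simp, force, subst sum.union_disjoint, simp, simp, force)
        simp
    also have "(\<Sum>(i, j) | j < i. A i j) = (\<Sum>(i, j) | i < j. A i j)"
      by (rule sum.reindex_bij_witness [where i = "\<lambda>(i, j). (j, i)" and j = "\<lambda>(i, j). (j, i)"])
        (auto simp: sym)
    also have "(\<Sum>(i, j) | i = j. A i j) = 0"
      by (intro sum.neutral) (auto simp: diag)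
    finally show ?thesis by (simp add: scaleR_2)
  qed
  moreover have "(\<Sum>i\<in>UNIV. \<Sum>j\<in>UNIV. A i j) = 2 *\<^sub>R (y * D)"
  proof -
    have 1: "(\<Sum>i\<in>UNIV. \<Sum>j\<in>UNIV. E i * E j * (Y i *\<^sub>R T (E j))) = y * D"
      unfolding D by (subst Y [symmetric]) (simp add: sum_product mult.assoc)
    have "(\<Sum>i\<in>UNIV. \<Sum>j\<in>UNIV. E i * E j * (Y j *\<^sub>R T (E i)))
        = (\<Sum>i\<in>UNIV. \<Sum>j\<in>UNIV. - (E j * E i * (Y j *\<^sub>R T (E i))) + (if i = j then (-2) *\<^sub>R (Y i *\<^sub>R T (E i)) else 0))"
      by (intro sum.cong refl) (subst anti, auto simp: algebra_simps)
    also have "\<dots> = - (\<Sum>i\<in>UNIV. \<Sum>j\<in>UNIV. E j * E i * (Y j *\<^sub>R T (E i))) + (\<Sum>i\<in>UNIV. (-2) *\<^sub>R (Y i *\<^sub>R T (E i)))"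
      unfolding sum.distrib sum_negf by simp
    also have "(\<Sum>i\<in>UNIV. \<Sum>j\<in>UNIV. E j * E i * (Y j *\<^sub>R T (E i))) = y * D"
      unfolding 1 [symmetric] by (rule sum.swap)
    also have "(\<Sum>i\<in>UNIV. (-2) *\<^sub>R (Y i *\<^sub>R T (E i))) = (-2) *\<^sub>R T (\<Sum>i\<in>UNIV. Y i *\<^sub>R E i)"
      unfolding scaleR_sum_right [symmetric] by (simp add: linear_sum [OF linT] linear_scale [OF linT])
    also have "\<dots> = 0" unfolding Y T0 by simp
    finally have 2: "(\<Sum>i\<in>UNIV. \<Sum>j\<in>UNIV. E i * E j * (Y j *\<^sub>R T (E i))) = - (y * D)" by simp
    show ?thesis
      unfolding A_def right_diff_distrib sum_subtractf 1 2 by (simp add: scaleR_2)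
  qed
  ultimately have "Lambda g y = y * D"
    by (metis scaleR_cancel_left zero_neq_numeral)
  moreover have "y * (y * D) = - D"
    by (rule unit_cancel [OF y])
  ultimately show ?thesis
    unfolding dirac_Sn_def gy D_def T_def by (simp add: distrib_left)
qed

section \<open>Conformal covariance\<close>

lemma inverse_power_has_real_derivative:
  "r \<noteq> 0 \<Longrightarrow> ((\<lambda>r. inverse (r ^ n)) has_real_derivative - (real n * inverse (r ^ Suc n))) (at r)"
  by (rule DERIV_cong [OF DERIV_inverse' [OF DERIV_pow]]) (simp, cases n, simp_all add: field_simps)

text \<open>
  The case of the exponent $n$ is used for $J$, and that of the exponent $2$ for the Cayley
  transformation itself.
\<close>

lemma scaled_vector_has_derivative:
  fixes z b :: "'a::real_inner"
  assumes "z \<noteq> 0"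
  shows "((\<lambda>t. inverse (norm (z + t *\<^sub>R b) ^ n) *\<^sub>R (z + t *\<^sub>R b)) has_vector_derivative
    inverse (norm z ^ n) *\<^sub>R b - (real n * (z \<bullet> b) * inverse (norm z ^ (n + 2))) *\<^sub>R z) (at 0)"
proof -
  have "(norm has_derivative (\<lambda>w. w \<bullet> sgn z)) (at z)"
    by (rule has_derivative_norm [OF assms])
  from has_vector_derivative_along [OF this, of b]
  have "((\<lambda>t. norm (z + t *\<^sub>R b)) has_real_derivative b \<bullet> sgn z) (at 0)"
    by (simp add: has_real_derivative_iff_has_vector_derivative)
  moreover have "((\<lambda>r. inverse (r ^ n)) has_real_derivative - (real n * inverse (norm z ^ Suc n)))
      (at (norm (z + 0 *\<^sub>R b)))"
    using inverse_power_has_real_derivative [of "norm z" n] assms by simp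
  ultimately have "((\<lambda>t. inverse (norm (z + t *\<^sub>R b) ^ n)) has_real_derivative
      - (real n * inverse (norm z ^ Suc n)) * (b \<bullet> sgn z)) (at 0)"
    using DERIV_chain2 [of "\<lambda>r. inverse (r ^ n)" _ "\<lambda>t. norm (z + t *\<^sub>R b)"] by blast
  moreover have "((\<lambda>t. z + t *\<^sub>R b) has_vector_derivative b) (at 0)"
    by (auto intro!: derivative_eq_intros)
  ultimately have "((\<lambda>t. inverse (norm (z + t *\<^sub>R b) ^ n) *\<^sub>R (z + t *\<^sub>R b)) has_vector_derivative
      inverse (norm (z + 0 *\<^sub>R b) ^ n) *\<^sub>R b
      + (- (real n * inverse (norm z ^ Suc n)) * (b \<bullet> sgn z)) *\<^sub>R (z + 0 *\<^sub>R b)) (at 0)"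
    by (rule has_vector_derivative_scaleR)
  moreover have "(real n * inverse (norm z ^ Suc n)) * (b \<bullet> sgn z)
      = real n * (z \<bullet> b) * inverse (norm z ^ (n + 2))"
    by (simp add: sgn_div_norm inner_commute [of b])
  then have "inverse (norm (z + 0 *\<^sub>R b) ^ n) *\<^sub>R b
      + (- (real n * inverse (norm z ^ Suc n)) * (b \<bullet> sgn z)) *\<^sub>R (z + 0 *\<^sub>R b)
    = inverse (norm z ^ n) *\<^sub>R b - (real n * (z \<bullet> b) * inverse (norm z ^ (n + 2))) *\<^sub>R z"
    by (simp only: mult_minus_left scaleR_minus_left) simp
  ultimately show ?thesis by (simp only:)
qed

text \<open>
  The vectors $a e_j a$ form an orthonormal basis of $\mathbb{R}^{n+1}$, and \<open>T\<close> kills the last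
  one.
\<close>

lemma sum_reflected_frame:
  fixes T :: "('m::{finite,linorder}) cl \<Rightarrow> 'm cl"
  assumes a: "a \<in> vecs" "norm a = 1" and T: "linear T" "T (a * cl_last * a) = 0"
  shows "(\<Sum>b\<in>range cl_e. b * T b) = (\<Sum>b\<in>cl_e ` {..<Max UNIV}. (a * b * a) * T (a * b * a))"
proof -
  define \<phi> where "\<phi> u = a * u * a" for u
  have inj: "inj \<phi>"
    by (rule inj_on_inverseI [where g = \<phi>]) (simp add: \<phi>_def unit_conj_conj [OF a])
  have "\<phi> ` vecs = vecs"
  proof
    show "\<phi> ` vecs \<subseteq> vecs"
      by (auto simp: \<phi>_def intro!: unit_conj_in_vecs [OF a])
    show "vecs \<subseteq> \<phi> ` vecs"
    proof
      fix v :: "'m cl" assume "v \<in> vecs"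
      then have "\<phi> v \<in> vecs" unfolding \<phi>_def by (rule unit_conj_in_vecs [OF a])
      moreover have "v = \<phi> (\<phi> v)" by (simp add: \<phi>_def unit_conj_conj [OF a])
      ultimately show "v \<in> \<phi> ` vecs" by (rule rev_image_eqI)
    qed
  qed
  moreover have "orthonormal_basis (\<phi> ` range cl_e) (\<phi> ` vecs)"
    unfolding \<phi>_def
    by (rule orthonormal_basis_image [OF orthonormal_basis_vecs linear_conj unit_conj_inner [OF a]])
  ultimately have B: "orthonormal_basis (\<phi> ` range cl_e) vecs" by simp
  have "(\<Sum>b\<in>range cl_e. b * T b) = (\<Sum>b\<in>\<phi> ` range cl_e. b * T b)"
    by (rule sum_onb_independent [OF orthonormal_basis_vecs B])
      (simp add: linear_on_subspace_def linear_add [OF T(1)] linear_scale [OF T(1)])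
  also have "\<dots> = (\<Sum>b\<in>range cl_e. \<phi> b * T (\<phi> b))"
    by (subst sum.reindex) (auto intro: inj_on_subset [OF inj])
  also have "\<dots> = (\<Sum>b\<in>cl_e ` {..<Max UNIV}. \<phi> b * T (\<phi> b))"
    unfolding range_cl_e by (subst sum.insert) (use T(2) in \<open>simp_all add: cl_last_notin \<phi>_def\<close>)
  finally show ?thesis unfolding \<phi>_def .
qed

text \<open>
  The product rule, with $-2\|z\|^{-2} aba$ as the derivative of the Cayley transformation in direction
  $b$. Only the values of \<open>g\<close> on the sphere enter, through a differentiable extension \<open>h\<close>.
\<close>

lemma J_cayley_cayley_along:
  fixes x :: "('m::{finite,linorder}) cl" and g h :: "'m cl \<Rightarrow> 'm cl"
  assumes x: "x \<in> Rn" and b: "b \<in> Rn" and h: "(h has_derivative h') (at (cayley x))"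
    and ext: "\<forall>\<^sub>F q in nhds (cayley x). q \<in> vecs \<and> norm q = 1 \<longrightarrow> g q = h q"
  defines "z \<equiv> x + cl_last" and "n \<equiv> CARD('m) - 1"
  defines "a \<equiv> z /\<^sub>R norm z"
  shows "((\<lambda>t. J_cayley (x + t *\<^sub>R b) * g (cayley (x + t *\<^sub>R b))) has_vector_derivative
    (inverse (norm z ^ n) *\<^sub>R z) * (- (2 * inverse ((norm z)\<^sup>2)) *\<^sub>R h' (a * b * a))
    + (inverse (norm z ^ n) *\<^sub>R b - (real n * (z \<bullet> b) * inverse (norm z ^ (n + 2))) *\<^sub>R z) * h (cayley x)) (at 0)"
proof -
  note zz = Rn_plus_last [OF x, folded z_def]
  note a = unit_vector [OF zz(1,3), folded a_def]
  have bv: "b \<in> vecs" using b Rn_subset_vecs by blast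
  have xt: "x + t *\<^sub>R b \<in> Rn" for t by (intro subspace_add subspace_scale subspace_Rn x b)
  have zt: "x + t *\<^sub>R b + cl_last = z + t *\<^sub>R b" for t by (simp add: z_def)
  have J: "((\<lambda>t. J_cayley (x + t *\<^sub>R b)) has_vector_derivative
      inverse (norm z ^ n) *\<^sub>R b - (real n * (z \<bullet> b) * inverse (norm z ^ (n + 2))) *\<^sub>R z) (at 0)"
    using scaled_vector_has_derivative [OF zz(3), of b n] by (simp only: J_cayley_def zt n_def)
  define c where "c t = cayley (x + t *\<^sub>R b)" for t
  have c: "c t = cl_last - 2 *\<^sub>R (inverse ((norm (z + t *\<^sub>R b))\<^sup>2) *\<^sub>R (z + t *\<^sub>R b))" for t
    unfolding c_def cayley_eq [OF xt] zt by (simp add: divide_inverse)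
  have "(c has_vector_derivative
      0 - 2 *\<^sub>R (inverse ((norm z)\<^sup>2) *\<^sub>R b - (real 2 * (z \<bullet> b) * inverse (norm z ^ (2 + 2))) *\<^sub>R z)) (at 0)"
    unfolding c
    by (intro has_vector_derivative_diff has_vector_derivative_const
        bounded_linear.has_vector_derivative [OF bounded_linear_scaleR_right]
        scaled_vector_has_derivative [OF zz(3)])
  also have "0 - 2 *\<^sub>R (inverse ((norm z)\<^sup>2) *\<^sub>R b - (real 2 * (z \<bullet> b) * inverse (norm z ^ (2 + 2))) *\<^sub>R z)
      = - (2 * inverse ((norm z)\<^sup>2)) *\<^sub>R (a * b * a)"
    unfolding unit_conj_reflection [OF a bv] unfolding a_def
    by (simp add: scaleR_diff_right power2_eq_square power_Suc numeral_eq_Suc mult_ac)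
  finally have dc: "(c has_derivative (\<lambda>t. t *\<^sub>R - (2 * inverse ((norm z)\<^sup>2)) *\<^sub>R (a * b * a))) (at 0)"
    by (simp only: has_vector_derivative_def)
  have c0: "c 0 = cayley x" by (simp add: c_def)
  have lin: "linear h'" using h by (rule has_derivative_linear)
  have "((\<lambda>t. h (c t)) has_derivative (\<lambda>t. h' (t *\<^sub>R - (2 * inverse ((norm z)\<^sup>2)) *\<^sub>R (a * b * a)))) (at 0)"
    by (rule has_derivative_compose [OF dc]) (simp add: c0 h)
  then have hc: "((\<lambda>t. h (c t)) has_vector_derivative - (2 * inverse ((norm z)\<^sup>2)) *\<^sub>R h' (a * b * a)) (at 0)"
    unfolding has_vector_derivative_def linear_scale [OF lin] .
  have cont: "(c \<longlongrightarrow> cayley x) (nhds 0)"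
    using has_derivative_continuous [OF dc] unfolding continuous_at c0 [symmetric]
    by (simp add: tendsto_nhds_iff)
  have "\<forall>\<^sub>F t in nhds 0. g (c t) = h (c t)"
    using eventually_compose_filterlim [OF ext cont]
    by eventually_elim (use cayley_sphere(1,2) [OF xt] in \<open>simp add: c_def\<close>)
  then have gc: "((\<lambda>t. g (c t)) has_vector_derivative - (2 * inverse ((norm z)\<^sup>2)) *\<^sub>R h' (a * b * a)) (at 0)"
    using hc by (subst has_vector_derivative_cong_ev [where g = "\<lambda>t. h (c t)"])
      (auto elim: eventually_mono dest: eventually_nhds_x_imp_x)
  have g0: "g (cayley x) = h (cayley x)"
    using eventually_nhds_x_imp_x [OF ext] cayley_sphere [OF x] by blast
  have J0: "J_cayley x = inverse (norm z ^ n) *\<^sub>R z"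
    by (simp add: J_cayley_def z_def n_def)
  from bounded_bilinear.has_vector_derivative [OF bounded_bilinear_cl J gc]
  show ?thesis
    by (simp only: c_def scaleR_zero_left add_0_right g0 J0)
qed

text \<open>
  In the first part of the product rule, $b a = -a (aba)$ moves $a$ to the left and leaves the Dirac sum over the
  reflected frame. In the second part the sum of $b\,\partial_b J$ is a multiple of
  $\|z\|^2 + xz = (x - z) z = -ez$, and $e a = -a\,C(x)$ because $C(x) = aea$.
\<close>

theorem dirac_cayley_covariance:
  fixes x :: "('m::{finite,linorder}) cl" and g h :: "'m cl \<Rightarrow> 'm cl"
  assumes x: "x \<in> Rn" and h: "(h has_derivative h') (at (cayley x))"
    and ext: "\<forall>\<^sub>F q in nhds (cayley x). q \<in> vecs \<and> norm q = 1 \<longrightarrow> g q = h q"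
  shows "dirac_Rn (\<lambda>x. J_cayley x * g (cayley x)) x =
    (- 2 / norm (x + cl_last) ^ CARD('m)) *\<^sub>R
      (((x + cl_last) /\<^sub>R norm (x + cl_last)) * dirac_Sn g (cayley x))"
proof -
  define z where "z = x + cl_last"
  define n where "n = CARD('m) - 1"
  define a where "a = z /\<^sub>R norm z"
  define y where "y = cayley x"
  define B :: "'m cl set" where "B = cl_e ` {..<Max UNIV}"
  define G where "G = h y"
  define r where "r = inverse (norm z ^ CARD('m))"
  note zz = Rn_plus_last [OF x, folded z_def]
  note a = unit_vector [OF zz(1,3), folded a_def]
  note yy = cayley_sphere(1,2) [OF x, folded y_def]
  have ONB: "orthonormal_basis B Rn" unfolding B_def by (rule orthonormal_basis_Rn)
  have lin: "linear h'" using h by (rule has_derivative_linear)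
  have card: "CARD('m) = Suc n" by (simp add: n_def)
  have yconj: "y = a * cl_last * a" unfolding y_def a_def z_def by (rule cayley_conj [OF x refl])
  have Nz: "norm z \<noteq> 0" using zz(3) by simp
  have za: "z = norm z *\<^sub>R a" unfolding a_def using Nz by simp
  define T where "T v = h' (v - (v \<bullet> y) *\<^sub>R y)" for v
  have "linear (\<lambda>v. v - (v \<bullet> y) *\<^sub>R y)"
    by (rule linearI) (simp_all add: algebra_simps inner_add_left)
  then have linT: "linear T"
    using linear_compose [OF _ lin] unfolding T_def o_def by blast
  have "y \<bullet> y = 1" using yy(2) by (simp add: dot_square_norm)
  then have Ty: "T y = 0" by (simp add: T_def linear_0 [OF lin])
  have TB: "T (a * b * a) = h' (a * b * a)" if "b \<in> B" for b
  proof -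
    have b: "b \<in> Rn" using orthonormal_basis_subset [OF ONB that] .
    then have "(a * b * a) \<bullet> y = 0"
      unfolding yconj using Rn_subset_vecs
      by (subst unit_conj_inner [OF a]) (auto simp: Rn_inner_last)
    then show ?thesis by (simp add: T_def)
  qed
  have frame: "(\<Sum>b\<in>range cl_e. b * T b) = (\<Sum>b\<in>B. (a * b * a) * h' (a * b * a))"
    unfolding sum_reflected_frame [OF a linT Ty [unfolded yconj]] B_def [symmetric]
    by (intro sum.cong refl) (simp add: TB)
  have Sn: "dirac_Sn g y = (real n / 2) *\<^sub>R (y * G) - (\<Sum>b\<in>B. (a * b * a) * h' (a * b * a))"
    using dirac_Sn_eq [OF yy h [folded y_def] ext [folded y_def]] frame
    unfolding T_def n_def G_def by simp
  have ay: "a * y = - (cl_last * a)"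
    unfolding yconj by (simp add: mult.assoc unit_cancel [OF a])
  have r1: "inverse (norm z ^ n) = r * norm z"
    unfolding r_def card using Nz by simp
  have r2: "inverse (norm z ^ (n + 2)) = r * inverse (norm z)"
    unfolding r_def card using Nz by simp
  \<comment> \<open>the factor $a$ moves to the left: $b a = -a (aba)$\<close>
  have term1: "b * ((inverse (norm z ^ n) *\<^sub>R z) * (- (2 * inverse ((norm z)\<^sup>2)) *\<^sub>R X))
      = (2 * r) *\<^sub>R (a * ((a * b * a) * X))" for b X
  proof -
    have "a * ((a * b * a) * X) = - (b * (a * X))"
      by (simp add: mult.assoc unit_cancel [OF a])
    moreover have "(inverse (norm z ^ n) *\<^sub>R z) * (- (2 * inverse ((norm z)\<^sup>2)) *\<^sub>R X) = (- (2 * r)) *\<^sub>R (a * X)"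
    proof -
      have "z * X = norm z *\<^sub>R (a * X)"
        using za by (metis mult_scaleR_left)
      moreover have "inverse (norm z) * (inverse (norm z) * (norm z * norm z)) = 1"
        using Nz by (simp add: field_simps)
      ultimately show ?thesis
        unfolding r1 by (simp add: power2_eq_square)
    qed
    ultimately show ?thesis by simp
  qed
  have "(\<Sum>b\<in>B. b * (inverse (norm z ^ n) *\<^sub>R b - (real n * (z \<bullet> b) * inverse (norm z ^ (n + 2))) *\<^sub>R z))
      = (\<Sum>b\<in>B. - (r * norm z) *\<^sub>R 1 - (real n * (r * inverse (norm z))) *\<^sub>R (((x \<bullet> b) *\<^sub>R b) * z))"
  proof (rule sum.cong [OF refl])
    fix b assume b: "b \<in> B"
    have "b \<in> Rn" "norm b = 1"
      using b ONB by (auto simp: orthonormal_basis_def)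
    then have "b * b = - 1" "z \<bullet> b = x \<bullet> b"
      using Rn_subset_vecs unit_square Rn_inner_last [of b]
      by (auto simp: z_def inner_add_left inner_commute [of cl_last])
    then show "b * (inverse (norm z ^ n) *\<^sub>R b - (real n * (z \<bullet> b) * inverse (norm z ^ (n + 2))) *\<^sub>R z)
      = - (r * norm z) *\<^sub>R 1 - (real n * (r * inverse (norm z))) *\<^sub>R (((x \<bullet> b) *\<^sub>R b) * z)"
      unfolding r1 r2 by (simp add: right_diff_distrib mult_ac)
  qed
  also have "\<dots> = real n *\<^sub>R (- (r * norm z) *\<^sub>R 1) - (real n * (r * inverse (norm z))) *\<^sub>R (x * z)"
    unfolding sum_subtractf scaleR_sum_right [symmetric] sum_distrib_right [symmetric]
      orthonormal_basis_expansion [OF ONB x] sum_constant_scaleR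
    by (simp add: B_def card_cl_e_Rn n_def)
  also have "\<dots> = (real n * (r * inverse (norm z))) *\<^sub>R (- ((norm z)\<^sup>2 *\<^sub>R 1) - x * z)"
    using Nz by (simp add: scaleR_diff_right power2_eq_square)
  \<comment> \<open>$-\|z\|^2 = z^2$, and $z - x = e$\<close>
  also have "- ((norm z)\<^sup>2 *\<^sub>R 1) - x * z = cl_last * z"
    using vecs_square [OF zz(1)] by (simp add: z_def algebra_simps)
  also have "(real n * (r * inverse (norm z))) *\<^sub>R (cl_last * z) = - ((real n * r) *\<^sub>R (a * y))"
  proof -
    have "cl_last * z = norm z *\<^sub>R (cl_last * a)"
      using za by (metis mult_scaleR_right)
    then show ?thesis
      unfolding ay using Nz by simp
  qed
  finally have term2: "(\<Sum>b\<in>B. b * (inverse (norm z ^ n) *\<^sub>R b - (real n * (z \<bullet> b) * inverse (norm z ^ (n + 2))) *\<^sub>R z))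
      = - ((real n * r) *\<^sub>R (a * y))" .
  have "dirac_Rn (\<lambda>x. J_cayley x * g (cayley x)) x =
    (\<Sum>b\<in>B. b * ((inverse (norm z ^ n) *\<^sub>R z) * (- (2 * inverse ((norm z)\<^sup>2)) *\<^sub>R h' (a * b * a))
      + (inverse (norm z ^ n) *\<^sub>R b - (real n * (z \<bullet> b) * inverse (norm z ^ (n + 2))) *\<^sub>R z) * G))"
    unfolding dirac_Rn_def dirac_def B_def [symmetric]
  proof (rule sum.cong [OF refl])
    fix b assume "b \<in> B"
    from dir_deriv_eqI [OF J_cayley_cayley_along [OF x orthonormal_basis_subset [OF ONB this] h ext]]
    show "b * dir_deriv (\<lambda>x. J_cayley x * g (cayley x)) x b =
      b * ((inverse (norm z ^ n) *\<^sub>R z) * (- (2 * inverse ((norm z)\<^sup>2)) *\<^sub>R h' (a * b * a))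
      + (inverse (norm z ^ n) *\<^sub>R b - (real n * (z \<bullet> b) * inverse (norm z ^ (n + 2))) *\<^sub>R z) * G)"
      unfolding z_def n_def a_def G_def y_def by simp
  qed
  also have "\<dots> = (\<Sum>b\<in>B. (2 * r) *\<^sub>R (a * ((a * b * a) * h' (a * b * a))))
      + (\<Sum>b\<in>B. b * (inverse (norm z ^ n) *\<^sub>R b - (real n * (z \<bullet> b) * inverse (norm z ^ (n + 2))) *\<^sub>R z)) * G"
    unfolding distrib_left term1 sum.distrib sum_distrib_right by (simp only: mult.assoc)
  also have "\<dots> = (2 * r) *\<^sub>R (a * (\<Sum>b\<in>B. (a * b * a) * h' (a * b * a))) - (real n * r) *\<^sub>R (a * (y * G))"
    unfolding term2 by (simp add: sum_distrib_left scaleR_sum_right mult.assoc)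
  also have "\<dots> = (- (2 * r)) *\<^sub>R (a * dirac_Sn g y)"
    unfolding Sn by (simp add: right_diff_distrib scaleR_diff_right)
  finally show ?thesis
    unfolding r_def a_def z_def y_def by (simp add: divide_inverse)
qed

section \<open>Transfer of Rarita-Schwinger equations\<close>

text \<open>
  Freezing the second variable in a local $C^1$ extension of the function of two variables.
\<close>

lemma C1_on_section:
  fixes g :: "'a::real_normed_vector \<Rightarrow> 'c::real_normed_vector \<Rightarrow> 'b::real_normed_vector"
  assumes "C1_on (S \<times> T) (\<lambda>(y, u). g y u)" "y \<in> S" "u \<in> T"
  obtains W h h' where "open W" "y \<in> W" "(h has_derivative h') (at y)" "\<forall>q\<in>S \<inter> W. g q u = h q"
proof -
  have "(y, u) \<in> S \<times> T" using assms by simp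
  from bspec [OF assms(1) [unfolded C1_on_def] this]
  obtain W h h' where W: "open W" "(y, u) \<in> W"
    and h: "\<forall>q\<in>W. (h has_derivative blinfun_apply (h' q)) (at q)"
    and eq: "\<forall>q\<in>(S \<times> T) \<inter> W. (case q of (y, u) \<Rightarrow> g y u) = h q"
    by (elim exE conjE) (rule that)
  obtain A B where A: "open A" "y \<in> A" and B: "u \<in> B" "A \<times> B \<subseteq> W"
    by (rule open_prod_elim [OF W]) (auto intro: that)
  have "((\<lambda>q. h (q, u)) has_derivative (\<lambda>v. blinfun_apply (h' (y, u)) (v, 0))) (at y)"
    by (rule has_derivative_compose [where g = h, OF has_derivative_Pair [OF has_derivative_ident has_derivative_const]])
      (use h W in simp)
  moreover have "\<forall>q\<in>S \<inter> A. g q u = h (q, u)"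
  proof
    fix q assume "q \<in> S \<inter> A"
    with B assms(3) have "(q, u) \<in> (S \<times> T) \<inter> W" by blast
    from bspec [OF eq this] show "g q u = h (q, u)" by simp
  qed
  ultimately show ?thesis
    by (rule that [OF A])
qed

lemma eventually_along_in_open:
  assumes U: "openin (top_of_set Rn) U" and x: "x \<in> U" and b: "b \<in> Rn"
  shows "\<forall>\<^sub>F t in nhds 0. x + t *\<^sub>R b \<in> U"
proof -
  obtain V where V: "open V" "U = Rn \<inter> V"
    using U unfolding openin_open by blast
  have "((\<lambda>t. x + t *\<^sub>R b) \<longlongrightarrow> x + 0 *\<^sub>R b) (nhds 0)"
    by (intro tendsto_add tendsto_const tendsto_scaleR filterlim_ident)
  then have "\<forall>\<^sub>F t in nhds 0. x + t *\<^sub>R b \<in> V"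
    using V x by (intro topological_tendstoD) auto
  then show ?thesis
    by eventually_elim (use V x b in \<open>auto intro!: subspace_add subspace_scale subspace_Rn\<close>)
qed

lemma differentiable_norm_diff:
  fixes e y :: "'a::real_inner"
  assumes "y \<noteq> e"
  shows "(\<lambda>q. norm (q - e)) differentiable at y"
proof -
  have "(norm has_derivative (\<lambda>w. w \<bullet> sgn (y - e))) (at (y - e))"
    using assms by (intro has_derivative_norm) simp
  moreover have "((\<lambda>q. q - e) has_derivative (\<lambda>w. w)) (at y)"
    by (auto intro!: derivative_eq_intros)
  ultimately have "((\<lambda>q. norm (q - e)) has_derivative (\<lambda>w. w \<bullet> sgn (y - e))) (at y)"
    by (intro has_derivative_compose [where g = norm and f = "\<lambda>q. q - e" and f' = "\<lambda>w. w"])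
  then show ?thesis
    by (rule differentiableI)
qed

text \<open>
  A formula for the inverse Cayley transformation on the sphere that makes sense, and is differentiable, at all
  points of the algebra except $e$, so that it can be used to extend functions off the sphere.
\<close>

definition stereographic :: "('m::{finite,linorder}) cl \<Rightarrow> 'm cl" where
  "stereographic y = - cl_last - (2 * inverse ((norm (y - cl_last))\<^sup>2)) *\<^sub>R (y - cl_last)"

lemma cayley_inv_stereographic:
  assumes "y \<in> vecs" "norm y = 1" "y \<noteq> cl_last"
  shows "cayley_inv y = stereographic y"
  unfolding cayley_inv_eq [OF assms] stereographic_def by (simp add: divide_inverse)

lemma stereographic_differentiable:
  assumes "y \<noteq> cl_last"
  shows "stereographic differentiable at y"
  unfolding stereographic_def [abs_def] using assms
  by (intro derivative_intros differentiable_norm_diff) auto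

text \<open>
  The image of \<open>U\<close> is open in the sphere because the inverse transformation is continuous; this makes it
  harmless to differentiate functions that are controlled only on that image.
\<close>

lemma eventually_sphere_in_cayley_image:
  assumes U: "openin (top_of_set Rn) U" and x: "x \<in> U" and W: "open W" "x \<in> W"
  shows "\<forall>\<^sub>F q in nhds (cayley x). q \<in> vecs \<and> norm q = 1 \<longrightarrow>
    q \<in> cayley ` U \<and> cayley_inv q \<in> U \<inter> W \<and> stereographic q = cayley_inv q"
proof -
  obtain V where V: "open V" "U = Rn \<inter> V"
    using U unfolding openin_open by blast
  have xR: "x \<in> Rn" using V x by blast
  note y = cayley_sphere(1-3) [OF xR]
  have "isCont stereographic (cayley x)"
    by (rule differentiable_imp_continuous_within [OF stereographic_differentiable [OF y(3)]])
  then have "(stereographic \<longlongrightarrow> x) (nhds (cayley x))"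
    using cayley_inv_stereographic [OF y] cayley_inv_cayley [OF xR]
    by (simp add: continuous_at tendsto_nhds_iff)
  then have "\<forall>\<^sub>F q in nhds (cayley x). stereographic q \<in> V \<inter> W"
    using V W x by (intro topological_tendstoD) auto
  moreover have "\<forall>\<^sub>F q in nhds (cayley x). q \<noteq> cl_last"
    by (rule tendsto_imp_eventually_ne [OF filterlim_ident y(3)])
  ultimately show ?thesis
  proof eventually_elim
    case (elim q)
    show ?case
    proof
      assume q: "q \<in> vecs \<and> norm q = 1"
      have s: "cayley_inv q = stereographic q"
        using cayley_inv_stereographic q elim(2) by blast
      have "cayley_inv q \<in> Rn" "cayley (cayley_inv q) = q"
        using cayley_inv_sphere [of q] q elim(2) by auto
      moreover from this have "cayley_inv q \<in> U"
        using elim(1) V s by simp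
      ultimately show "q \<in> cayley ` U \<and> cayley_inv q \<in> U \<inter> W \<and> stereographic q = cayley_inv q"
        using elim(1) s by (metis IntD2 IntI image_eqI)
    qed
  qed
qed

text \<open>
  Stated with an extension because the two functions to which it is applied, $g$ and the pullback of $f$ by the
  inverse transformation, are controlled on an open part of the sphere only.
\<close>

definition sphere_differentiable ::
  "(('m::{finite,linorder}) cl \<Rightarrow> 'm cl) \<Rightarrow> 'm cl \<Rightarrow> bool" where
  "sphere_differentiable g y \<longleftrightarrow> (\<exists>h h'. (h has_derivative h') (at y) \<and>
     (\<forall>\<^sub>F q in nhds y. q \<in> vecs \<and> norm q = 1 \<longrightarrow> g q = h q))"

lemma sphere_differentiableE:
  assumes "sphere_differentiable g y"
  obtains h h' where "(h has_derivative h') (at y)"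
    "\<forall>\<^sub>F q in nhds y. q \<in> vecs \<and> norm q = 1 \<longrightarrow> g q = h q"
  using assms unfolding sphere_differentiable_def by (elim exE conjE) (rule that)

lemma sphere_differentiableI:
  assumes "(h has_derivative h') (at y)"
    "\<forall>\<^sub>F q in nhds y. q \<in> vecs \<and> norm q = 1 \<longrightarrow> g q = h q"
  shows "sphere_differentiable g y"
  unfolding sphere_differentiable_def using assms by (intro exI conjI)

lemma dirac_cayley:
  assumes "x \<in> Rn" "sphere_differentiable g (cayley x)"
  shows "dirac_Rn (\<lambda>x. J_cayley x * g (cayley x)) x =
    (- 2 / norm (x + cl_last) ^ CARD('m::{finite,linorder})) *\<^sub>R
      (((x + cl_last) /\<^sub>R norm (x + cl_last)) * dirac_Sn g (cayley (x :: 'm cl)))"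
  by (rule sphere_differentiableE [OF assms(2)]) (rule dirac_cayley_covariance [OF assms(1)])

lemma dir_deriv_cayley:
  assumes "x \<in> Rn" "b \<in> Rn" "sphere_differentiable g (cayley x)"
  shows "((\<lambda>t. J_cayley (x + t *\<^sub>R b) * g (cayley (x + t *\<^sub>R b))) has_vector_derivative
    dir_deriv (\<lambda>x. J_cayley x * g (cayley x)) x b) (at 0)"
proof -
  obtain d where d: "((\<lambda>t. J_cayley (x + t *\<^sub>R b) * g (cayley (x + t *\<^sub>R b))) has_vector_derivative d) (at 0)"
    by (rule sphere_differentiableE [OF assms(3)]) (rule that, rule J_cayley_cayley_along [OF assms(1,2)])
  from d dir_deriv_eqI [OF d] show ?thesis by simp
qed

text \<open>
  The covariance formula turns this into harmonicity of the spherical Dirac derivative; the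
  argument by limits is thus needed on the flat side only.
\<close>

lemma dirac_Rn_harmonics:
  fixes U :: "('m::{finite,linorder}) cl set"
  assumes U: "openin (top_of_set Rn) U" and x: "x \<in> U"
    and harm: "\<And>y. y \<in> cayley ` U \<Longrightarrow> g y \<in> harmonics Rn k"
    and diff: "\<And>u. u \<in> Rn \<Longrightarrow> sphere_differentiable (\<lambda>y. g y u) (cayley x)"
  shows "(\<lambda>u. dirac_Rn (\<lambda>x. J_cayley x * g (cayley x) u) x) \<in> harmonics Rn k"
  unfolding dirac_Rn_def
proof (rule harmonics_dirac_parameter [OF subspace_Rn Rn_subset_vecs, where f = "\<lambda>x u. J_cayley x * g (cayley x) u"])
  have xR: "x \<in> Rn" using openin_subset [OF U] x by auto
  have F: "(\<lambda>u. J_cayley x * g (cayley x) u) \<in> harmonics Rn k" if "x \<in> U" for x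
    by (rule harmonics_mult_left [OF subspace_Rn harm Rn_subset_vecs]) (use that in blast)
  show "finite (cl_e ` {..<Max UNIV})" by simp
  show "(\<lambda>u. J_cayley x * g (cayley x) u) \<in> harmonics Rn k" by (rule F [OF x])
  fix b :: "'m cl" assume "b \<in> cl_e ` {..<Max UNIV}"
  then have b: "b \<in> Rn" by (rule orthonormal_basis_subset [OF orthonormal_basis_Rn])
  show "\<forall>\<^sub>F t in nhds 0. (\<lambda>u. J_cayley (x + t *\<^sub>R b) * g (cayley (x + t *\<^sub>R b)) u) \<in> harmonics Rn k"
    using eventually_along_in_open [OF U x b] by eventually_elim (rule F)
  show "((\<lambda>t. J_cayley (x + t *\<^sub>R b) * g (cayley (x + t *\<^sub>R b)) u) has_vector_derivative
      dir_deriv (\<lambda>x. J_cayley x * g (cayley x) u) x b) (at 0)" if "u \<in> Rn" for u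
    by (rule dir_deriv_cayley [OF xR b diff [OF that]])
qed

lemma harmonics_scaled_mult_left:
  assumes p: "p \<in> harmonics Rn k" and q: "\<And>u. u \<in> Rn \<Longrightarrow> q u = c *\<^sub>R (a * p u)"
  shows "q \<in> harmonics Rn k"
  by (rule harmonics_cong [OF subspace_Rn Rn_subset_vecs
        harmonics_mult_left [OF subspace_Rn p Rn_subset_vecs, of "c *\<^sub>R a"]]) (simp add: q)

lemma sphere_differentiable_C1:
  assumes U: "openin (top_of_set Rn) U" and x: "x \<in> U" and u: "u \<in> Rn"
    and C1: "C1_on (cayley ` U \<times> Rn) (\<lambda>(y, u). g y u)"
  shows "sphere_differentiable (\<lambda>y. g y u) (cayley x)"
proof -
  obtain W h h' where W: "open W" "cayley x \<in> W" and h: "(h has_derivative h') (at (cayley x))"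
    and eq: "\<forall>q\<in>cayley ` U \<inter> W. g q u = h q"
    by (rule C1_on_section [OF C1 imageI [OF x] u])
  have "\<forall>\<^sub>F q in nhds (cayley x). q \<in> vecs \<and> norm q = 1 \<longrightarrow> g q u = h q"
    using eventually_sphere_in_cayley_image [OF U x open_UNIV UNIV_I] eventually_nhds_in_open [OF W]
    by eventually_elim (use eq in blast)
  with h show ?thesis by (rule sphere_differentiableI)
qed

lemma sphere_differentiable_pullback:
  assumes U: "openin (top_of_set Rn) U" and x: "x \<in> U" and u: "u \<in> Rn"
    and C1: "C1_on (U \<times> Rn) (\<lambda>(x, u). f x u)"
  shows "sphere_differentiable (\<lambda>y. J_cayley_inv y * f (cayley_inv y) u) (cayley (x :: ('m::{finite,linorder}) cl))"
proof -
  define y where "y = cayley x"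
  have xR: "x \<in> Rn" using openin_subset [OF U] x by auto
  note yy = cayley_sphere(1-3) [OF xR, folded y_def]
  have sy: "stereographic y = x"
    using cayley_inv_stereographic [OF yy] cayley_inv_cayley [OF xR] by (simp add: y_def)
  obtain W h h' where W: "open W" "x \<in> W" and h: "(h has_derivative h') (at x)"
    and eq: "\<forall>q\<in>U \<inter> W. f q u = h q"
    by (rule C1_on_section [OF C1 x u])
  obtain s' where s: "(stereographic has_derivative s') (at y)"
    using stereographic_differentiable [OF yy(3)] unfolding differentiable_def by (elim exE) (rule that)
  have "(\<lambda>q. inverse (norm (q - cl_last) ^ (CARD('m) - 1)) *\<^sub>R (q - cl_last)) differentiable at y"
    using yy(3) by (intro derivative_intros differentiable_norm_diff) auto
  then obtain J' where J: "(J_cayley_inv has_derivative J') (at y)"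
    unfolding differentiable_def J_cayley_inv_def [abs_def, symmetric] by (elim exE) (rule that)
  have "((\<lambda>q. h (stereographic q)) has_derivative (\<lambda>v. h' (s' v))) (at y)"
    by (rule has_derivative_compose [OF s]) (simp add: sy h)
  from bounded_bilinear.FDERIV [OF bounded_bilinear_cl J this]
  have "((\<lambda>q. J_cayley_inv q * h (stereographic q)) has_derivative
      (\<lambda>v. J_cayley_inv y * h' (s' v) + J' v * h (stereographic y))) (at y)" .
  moreover have "\<forall>\<^sub>F q in nhds y. q \<in> vecs \<and> norm q = 1 \<longrightarrow>
      J_cayley_inv q * f (cayley_inv q) u = J_cayley_inv q * h (stereographic q)"
    using eventually_sphere_in_cayley_image [OF U x W] unfolding y_def [symmetric]
    by eventually_elim (auto simp: eq)
  ultimately show ?thesis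
    unfolding y_def [symmetric] by (rule sphere_differentiableI)
qed

text \<open>
  At each point the two polynomials under the projections correspond under $p \mapsto c\,a\,p(a \cdot a)$
  with a nonzero real $c$.
\<close>

lemma rarita_cayley:
  fixes U :: "('m::{finite,linorder}) cl set"
  assumes dim: "CARD('m) \<ge> 2" and U: "openin (top_of_set Rn) U" and x: "x \<in> U"
    and C1: "C1_on (cayley ` U \<times> Rn) (\<lambda>(y, u). g y u)" and mono: "\<forall>y \<in> cayley ` U. g y \<in> monogenics Rn k"
    and a: "a = (x + cl_last) /\<^sub>R norm (x + cl_last)"
  shows "(\<forall>w \<in> conj_Rn a. rarita_Rn_conj a k (\<lambda>x u. J_cayley x * g (cayley x) u) x w = 0) \<longleftrightarrow>
    (\<forall>u \<in> Rn. rarita_Sn k g (cayley x) u = 0)"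
proof -
  have xR: "x \<in> Rn" using openin_subset [OF U] x by auto
  note z = Rn_plus_last [OF xR]
  have au: "a \<in> vecs" "norm a = 1" unfolding a using unit_vector [OF z(1,3)] by auto
  define c where "c = - 2 / norm (x + cl_last) ^ CARD('m)"
  have c: "c \<noteq> 0" using z(3) by (simp add: c_def)
  define S where "S u = dirac_Sn (\<lambda>y. g y u) (cayley x)" for u
  define D where "D u = dirac_Rn (\<lambda>x. J_cayley x * g (cayley x) u) x" for u
  have diff: "sphere_differentiable (\<lambda>y. g y u) (cayley x)" if "u \<in> Rn" for u
    by (rule sphere_differentiable_C1 [OF U x that C1])
  have DS: "D u = c *\<^sub>R (a * S u)" if "u \<in> Rn" for u
    unfolding D_def S_def c_def a by (rule dirac_cayley [OF xR diff [OF that]])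
  have harm: "g y \<in> harmonics Rn k" if "y \<in> cayley ` U" for y
    using mono that monogenics_subset_harmonics [OF subspace_Rn Rn_subset_vecs] by blast
  have "D \<in> harmonics Rn k"
    unfolding D_def [abs_def] by (rule dirac_Rn_harmonics [OF U x harm diff])
  then have S: "S \<in> harmonics Rn k"
    by (rule harmonics_scaled_mult_left [where c = "- (1 / c)" and a = a]) (simp add: DS unit_cancel [OF au] c)
  have dim': "dim (Rn :: 'm cl set) > 0" using dim by (simp add: dim_Rn)
  have "(\<forall>w \<in> conj_Rn a. monogenic_proj (conj_Rn a) k (\<lambda>w. D (a * w * a)) w = 0) \<longleftrightarrow>
      (\<forall>u \<in> Rn. monogenic_proj Rn k S u = 0)"
    by (rule monogenic_proj_conj_eq_0_iff [OF au dim' S c]) (rule DS [OF conj_mem_Rn [OF au]])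
  then show ?thesis
    unfolding rarita_Rn_conj_def rarita_Sn_def D_def S_def [abs_def] .
qed

text \<open>
  The covariance formula for $g(y,u) = J(C^{-1},y) f(C^{-1}(y),u)$, solved for the spherical side. The unit vector
  $b$ on the sphere is $-a$.
\<close>

lemma rarita_cayley_inv:
  fixes U :: "('m::{finite,linorder}) cl set"
  assumes dim: "CARD('m) \<ge> 2" and U: "openin (top_of_set Rn) U" and x: "x \<in> U"
    and C1: "C1_on (U \<times> Rn) (\<lambda>(x, u). f x u)" and mono: "\<forall>x \<in> U. f x \<in> monogenics Rn k"
    and b: "b = (cayley x - cl_last) /\<^sub>R norm (cayley x - cl_last)"
  shows "(\<forall>w \<in> conj_Rn b. rarita_Sn_conj b k (\<lambda>y u. J_cayley_inv y * f (cayley_inv y) u) (cayley x) w = 0) \<longleftrightarrow>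
    (\<forall>u \<in> Rn. rarita_Rn k f x u = 0)"
proof -
  have UR: "U \<subseteq> Rn" using openin_subset [OF U] by simp
  have xR: "x \<in> Rn" using UR x by auto
  note z = Rn_plus_last [OF xR] and y = cayley_sphere [OF xR]
  have bu: "b \<in> vecs" "norm b = 1"
    unfolding b using y(1,3)
    by (auto intro!: unit_vector subspace_diff subspace_vecs)
  have ab: "(x + cl_last) /\<^sub>R norm (x + cl_last) = - b"
  proof -
    define N where "N = norm (x + cl_last)"
    have "N \<noteq> 0" using z(3) by (simp add: N_def)
    then have N: "inverse (2 / N) * (2 / N\<^sup>2) = inverse N"
      by (simp add: power2_eq_square divide_simps)
    show ?thesis
      unfolding b y(5) unfolding y(4) N_def [symmetric]
      by (simp only: scaleR_minus_right minus_minus scaleR_scaleR N)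
  qed
  define c where "c = - 2 / norm (x + cl_last) ^ CARD('m)"
  define \<kappa> :: real where "\<kappa> = 2 / 2 ^ (CARD('m) - 1)"
  have c: "c \<noteq> 0" "\<kappa> \<noteq> 0" using z(3) by (simp_all add: c_def \<kappa>_def)
  define g where "g y u = J_cayley_inv y * f (cayley_inv y) u" for y u
  define S where "S u = dirac_Sn (\<lambda>y. g y u) (cayley x)" for u
  define D where "D u = dirac_Rn (\<lambda>x. J_cayley x * g (cayley x) u) x" for u
  define R where "R u = dirac_Rn (\<lambda>x. f x u) x" for u
  have diff: "sphere_differentiable (\<lambda>y. g y u) (cayley x)" if "u \<in> Rn" for u
    unfolding g_def by (rule sphere_differentiable_pullback [OF U x that C1])
  have DS: "D u = c *\<^sub>R (- b * S u)" if "u \<in> Rn" for u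
    unfolding D_def S_def c_def ab [symmetric] by (rule dirac_cayley [OF xR diff [OF that]])
  have Jg: "J_cayley x * g (cayley x) u = \<kappa> *\<^sub>R f x u" if "x \<in> Rn" for x u
  proof -
    have "J_cayley x * g (cayley x) u = (J_cayley x * J_cayley_inv (cayley x)) * f x u"
      by (simp add: g_def cayley_inv_cayley [OF that] mult.assoc)
    also have "\<dots> = \<kappa> *\<^sub>R f x u"
      by (subst J_cayley_mult_J_cayley_inv [OF that]) (simp add: \<kappa>_def)
    finally show ?thesis .
  qed
  have DR: "R u = (1 / \<kappa>) *\<^sub>R D u" if u: "u \<in> Rn" for u
    unfolding R_def D_def dirac_Rn_def dirac_def scaleR_sum_right
  proof (rule sum.cong [OF refl])
    fix v assume "v \<in> cl_e ` {..<Max (UNIV :: 'm set)}"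
    then have v: "v \<in> Rn" by (rule orthonormal_basis_subset [OF orthonormal_basis_Rn])
    have xt: "x + t *\<^sub>R v \<in> Rn" for t by (intro subspace_add subspace_scale subspace_Rn xR v)
    from bounded_linear.has_vector_derivative [OF bounded_linear_scaleR_right dir_deriv_cayley [OF xR v diff [OF u]], of "1 / \<kappa>"]
    have "((\<lambda>t. f (x + t *\<^sub>R v) u) has_vector_derivative
        (1 / \<kappa>) *\<^sub>R dir_deriv (\<lambda>x. J_cayley x * g (cayley x) u) x v) (at 0)"
      using c(2) by (simp add: Jg [OF xt])
    from dir_deriv_eqI [OF this]
    show "v * dir_deriv (\<lambda>x. f x u) x v = (1 / \<kappa>) *\<^sub>R (v * dir_deriv (\<lambda>x. J_cayley x * g (cayley x) u) x v)"
      by simp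
  qed
  have harm: "g y \<in> harmonics Rn k" if "y \<in> cayley ` U" for y
  proof -
    obtain x' where x': "x' \<in> U" "y = cayley x'" using \<open>y \<in> cayley ` U\<close> by blast
    have "f x' \<in> harmonics Rn k"
      using mono x'(1) monogenics_subset_harmonics [OF subspace_Rn Rn_subset_vecs] by blast
    moreover have "cayley_inv y = x'"
      using x' UR cayley_inv_cayley by blast
    ultimately show ?thesis
      unfolding g_def by (simp add: harmonics_mult_left [OF subspace_Rn _ Rn_subset_vecs])
  qed
  have "D \<in> harmonics Rn k"
    unfolding D_def [abs_def] by (rule dirac_Rn_harmonics [OF U x harm diff])
  then have R: "R \<in> harmonics Rn k"
    by (rule harmonics_scaled_mult_left [where c = "1 / \<kappa>" and a = 1]) (simp add: DR)
  have SR: "S u = (\<kappa> / c) *\<^sub>R (b * R u)" if "u \<in> Rn" for u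
    using c by (simp add: DR [OF that] DS [OF that] unit_cancel [OF bu])
  have dim': "dim (Rn :: 'm cl set) > 0" using dim by (simp add: dim_Rn)
  have "(\<forall>w \<in> conj_Rn b. monogenic_proj (conj_Rn b) k (\<lambda>w. S (b * w * b)) w = 0) \<longleftrightarrow>
      (\<forall>u \<in> Rn. monogenic_proj Rn k R u = 0)"
    by (rule monogenic_proj_conj_eq_0_iff [OF bu dim' R, where c = "\<kappa> / c"])
      (use c in simp, rule SR [OF conj_mem_Rn [OF bu]])
  then show ?thesis
    unfolding rarita_Sn_conj_def rarita_Rn_def S_def R_def [abs_def] g_def .
qed

theorem theorem5:
  fixes U :: "('m::{finite,linorder}) cl set"
    and g f :: "'m cl \<Rightarrow> 'm cl \<Rightarrow> 'm cl"
    and k :: nat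
  assumes "CARD('m) \<ge> 2"
    and "openin (top_of_set Rn) U" and "connected U" and "U \<noteq> {}"
  shows
    "(C1_on (cayley ` U \<times> Rn) (\<lambda>(y, u). g y u) \<and> (\<forall>y \<in> cayley ` U. g y \<in> monogenics Rn k) \<longrightarrow>
       ((\<forall>y \<in> cayley ` U. \<forall>u \<in> Rn. rarita_Sn k g y u = 0) \<longleftrightarrow>
        (\<forall>x \<in> U. let a = (x + cl_last) /\<^sub>R norm (x + cl_last) in
           \<forall>w \<in> conj_Rn a. rarita_Rn_conj a k (\<lambda>x u. J_cayley x * g (cayley x) u) x w = 0)))
     \<and>
     (C1_on (U \<times> Rn) (\<lambda>(x, u). f x u) \<and> (\<forall>x \<in> U. f x \<in> monogenics Rn k) \<longrightarrow>
       ((\<forall>x \<in> U. \<forall>u \<in> Rn. rarita_Rn k f x u = 0) \<longleftrightarrow>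
        (\<forall>y \<in> cayley ` U. let a = (y - cl_last) /\<^sub>R norm (y - cl_last) in
           \<forall>w \<in> conj_Rn a. rarita_Sn_conj a k (\<lambda>y u. J_cayley_inv y * f (cayley_inv y) u) y w = 0)))"
proof (intro conjI impI; elim conjE)
  assume "C1_on (cayley ` U \<times> Rn) (\<lambda>(y, u). g y u)" "\<forall>y \<in> cayley ` U. g y \<in> monogenics Rn k"
  note eq = rarita_cayley [OF assms(1,2) _ this refl]
  show "(\<forall>y \<in> cayley ` U. \<forall>u \<in> Rn. rarita_Sn k g y u = 0) \<longleftrightarrow>
        (\<forall>x \<in> U. let a = (x + cl_last) /\<^sub>R norm (x + cl_last) in
           \<forall>w \<in> conj_Rn a. rarita_Rn_conj a k (\<lambda>x u. J_cayley x * g (cayley x) u) x w = 0)"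
    unfolding Let_def ball_simps(9) by (rule ball_cong [OF refl]) (rule eq [symmetric])
next
  assume "C1_on (U \<times> Rn) (\<lambda>(x, u). f x u)" "\<forall>x \<in> U. f x \<in> monogenics Rn k"
  note eq = rarita_cayley_inv [OF assms(1,2) _ this refl]
  show "(\<forall>x \<in> U. \<forall>u \<in> Rn. rarita_Rn k f x u = 0) \<longleftrightarrow>
        (\<forall>y \<in> cayley ` U. let a = (y - cl_last) /\<^sub>R norm (y - cl_last) in
           \<forall>w \<in> conj_Rn a. rarita_Sn_conj a k (\<lambda>y u. J_cayley_inv y * f (cayley_inv y) u) y w = 0)"
    unfolding Let_def ball_simps(9) by (rule ball_cong [OF refl]) (rule eq [symmetric])
qed

end
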